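(* Let $\kappa_0,\kappa_t,\kappa_\infty,\eta\in\mathbb{C}$ with $\eta\neq0$, put $\kappa=\frac{(\kappa_0+\kappa_t)^2}{4}-\frac{\kappa_\infty^2}{4}$, and consider the Hamiltonian system $y_5'=\partial H/\partial z_5$, $z_5'=-\partial H/\partial y_5$ with the Okamoto Hamiltonian $$H(y_5,z_5;x)=\frac1x\Big(y_5(y_5-1)^2z_5^2-z_5\big(\kappa_0(y_5-1)^2+\kappa_t\,y_5(y_5-1)-\eta\,x\,y_5\big)+\kappa(y_5-1)\Big).$$ Let $q=q(x)$ be a solution of $(\mathrm{P}_{\mathrm V})$ with parameters $\alpha=\frac12(\kappa_0+\kappa_t)^2-2\kappa$, $\beta=-\frac12\kappa_0^2$, $\gamma=-\eta(\kappa_t+1)$, $\delta=-\frac12\eta^2$. Applying to this system the transformation $(y_5,z_5)\mapsto(y,z)$ defined by $$y_5=z+q,\qquad z_5=yz+\frac{x\,q'-q\,(x\eta+2\kappa_0+\kappa_t)+q^2(\kappa_0+\kappa_t)+\kappa_0}{2q(q-1)^2}$$ gives rise to a system in $(y,z)$ that is Bureau-Guillot for $(\mathrm{P}_{\mathrm V})$.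
   Context: The independent variable is $x\in\mathbb{C}$ and $'=d/dx$. The fifth Painlevé equation is $$(\mathrm{P}_{\mathrm V})\colon\ y''=\left(\frac{1}{2y}+\frac{1}{y-1}\right)(y')^2-\frac{y'}{x}+\frac{(y-1)^2}{x^2}\left(\alpha y+\frac{\beta}{y}\right)+\frac{\gamma y}{x}+\frac{\delta y(y+1)}{y-1}.$$ The Hamiltonian system with coefficients rational in $x$ associated with $(\mathrm{P}_{\mathrm V})$ is the one with the Hamiltonian $H$ in the claim (its component $y_5$ satisfies $(\mathrm{P}_{\mathrm V})$ with the stated parameters). Regularisation process. A system $y'=P(y,z;x)$, $z'=Q(y,z;x)$, with $P,Q$ rational in $(y,z)$ and coefficients depending on $x$, is extended to $\mathbb{P}^2$, covered by the affine charts $(y,z)$, $(u_0,v_0)$, $(U_0,V_0)$ with $[1:y:z]=[u_0:1:v_0]=[V_0:U_0:1]$. In each chart one looks for base points, i.e. points where the right-hand side of one of the (rational) equations becomes $0/0$. Each base point (in a chart $(y,z)$, at $(a,b)$) is blown up, by introducing the charts $u=y-a$, $v=\frac{z-b}{y-a}$ and $U=\frac{y-a}{z-b}$, $V=z-b$, with exceptional curve $\{u=0\}\cup\{V=0\}$; new base points on it are blown up again, which gives for each base point one or more finite sequences ("cascades") of blow-ups, until no indeterminacy is left in the final charts. The system is regularised if in every cascade it is regular on the last exceptional curve in one of the final charts. The regularising conditions are the (differential) constraints on the coefficient functions of the system which make it regular on the last exceptional curves in this sense. Definition. A system $y'=P(y,z;x)$, $z'=Q(y,z;x)$ is an analogue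 of the Bureau-Guillot system (Bureau-Guillot, for short) for $(\mathrm{P}_{\mathrm J})$ if: (i) it is birationally equivalent (by a transformation of $(y,z)$ with coefficients depending on $x$) to the Hamiltonian system with coefficients rational in $x$ associated with $(\mathrm{P}_{\mathrm J})$; (ii) it has coefficient functions both rational and meromorphic in $x$ which are functions of the Painlevé transcendent $\mathrm{P}_{\mathrm J}$ (here $q$) and its derivatives; (iii) the Painlevé equation $(\mathrm{P}_{\mathrm J})$ is obtained as a regularising condition in the regularisation process of the system, i.e., regarding $q$ as an a priori undetermined function, the regularising conditions are differential equations for $q$ that are satisfied when $q$ solves $(\mathrm{P}_{\mathrm J})$.
   Formalization: The sign of γ is corrected to γ = +η(κ_t+1), which this Hamiltonian actually yields (the stated −η(κ_t+1) makes the claim false unless κ_t = −1); each point of the projective plane or an exceptional curve is tested for 0/0 in one chart only. *)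

theory Defs
  imports "HOL-Complex_Analysis.Complex_Analysis"
begin

section \<open>Rational functions and systems over a field of coefficient functions\<close>

text \<open>
  The coefficient functions live in a field \<open>'k\<close> with a derivation \<open>d\<close>
  (below: Laurent series in \<open>x - x0\<close> with \<open>fls_deriv\<close>).  A bivariate polynomial is an
  \<open>'k poly poly\<close> whose outer variable is \<open>y\<close> and whose inner variable is \<open>z\<close>.
\<close>

definition eval2 :: "'k::comm_semiring_0 poly poly \<Rightarrow> 'k \<Rightarrow> 'k \<Rightarrow> 'k" where
  "eval2 N y z = poly (poly N [:y:]) z"

abbreviation Ypol :: "'k::comm_semiring_1 poly poly" where "Ypol \<equiv> [:0, 1:]"
abbreviation Zpol :: "'k::comm_semiring_1 poly poly" where "Zpol \<equiv> [:[:0, 1:]:]"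
abbreviation Cpol :: "'k::comm_semiring_1 \<Rightarrow> 'k poly poly" where "Cpol c \<equiv> [:[:c:]:]"

definition d_dy :: "'k::idom poly poly \<Rightarrow> 'k poly poly" where "d_dy N = pderiv N"
definition d_dz :: "'k::idom poly poly \<Rightarrow> 'k poly poly" where "d_dz N = map_poly pderiv N"

text \<open>Off some algebraic curve.\<close>

definition generically :: "('k::field \<Rightarrow> 'k \<Rightarrow> bool) \<Rightarrow> bool" where
  "generically R \<longleftrightarrow> (\<exists>E::'k poly poly. E \<noteq> 0 \<and> (\<forall>y z. eval2 E y z \<noteq> 0 \<longrightarrow> R y z))"

text \<open>
  \<open>S y z = (P(y,z), Q(y,z))\<close> stands for the system \<open>y' = P, z' = Q\<close>.  Only the class of
  \<open>P, Q\<close> as rational functions matters: the values on the zero set of a denominator, where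
  HOL's \<open>a / 0 = 0\<close> intervenes, are ignored by the notions below.
\<close>

type_synonym 'k system = "'k \<Rightarrow> 'k \<Rightarrow> 'k \<times> 'k"

definition represents :: "('k::field \<Rightarrow> 'k \<Rightarrow> 'k) \<Rightarrow> 'k poly poly \<Rightarrow> 'k poly poly \<Rightarrow> bool" where
  "represents f N M \<longleftrightarrow> M \<noteq> 0 \<and> generically (\<lambda>y z. f y z = eval2 N y z / eval2 M y z)"

text \<open>\<open>f\<close>, written in lowest terms, becomes \<open>0/0\<close> at \<open>(a,b)\<close>.\<close>

definition indeterminate_at :: "('k::field \<Rightarrow> 'k \<Rightarrow> 'k) \<Rightarrow> 'k \<Rightarrow> 'k \<Rightarrow> bool" where
  "indeterminate_at f a b \<longleftrightarrow>
     (\<exists>N M. represents f N M \<and> coprime N M \<and> eval2 N a b = 0 \<and> eval2 M a b = 0)"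

definition regular_at :: "('k::field \<Rightarrow> 'k \<Rightarrow> 'k) \<Rightarrow> 'k \<Rightarrow> 'k \<Rightarrow> bool" where
  "regular_at f a b \<longleftrightarrow> (\<exists>N M. represents f N M \<and> eval2 M a b \<noteq> 0)"

definition base_point :: "'k::field system \<Rightarrow> 'k \<Rightarrow> 'k \<Rightarrow> bool" where
  "base_point S a b \<longleftrightarrow>
     indeterminate_at (\<lambda>y z. fst (S y z)) a b \<or> indeterminate_at (\<lambda>y z. snd (S y z)) a b"

definition regular_system_at :: "'k::field system \<Rightarrow> 'k \<Rightarrow> 'k \<Rightarrow> bool" where
  "regular_system_at S a b \<longleftrightarrow>
     regular_at (\<lambda>y z. fst (S y z)) a b \<and> regular_at (\<lambda>y z. snd (S y z)) a b"

section \<open>The regularisation process\<close>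

text \<open>
  The system in the charts \<open>(u0,v0)\<close> and \<open>(U0,V0)\<close> of the projective plane,
  \<open>[1:y:z] = [u0:1:v0] = [V0:U0:1]\<close>.
\<close>

definition chart_uv :: "'k::field system \<Rightarrow> 'k system" where
  "chart_uv S u v = (let (P, Q) = S (1 / u) (v / u) in (- (u\<^sup>2 * P), u * Q - u * v * P))"

definition chart_UV :: "'k::field system \<Rightarrow> 'k system" where
  "chart_UV S U V = (let (P, Q) = S (U / V) (1 / V) in (V * P - U * V * Q, - (V\<^sup>2 * Q)))"

text \<open>
  Blow-up at the point \<open>(a,b)\<close>, which moves with \<open>x\<close>: the chart \<open>u = y - a\<close>,
  \<open>v = (z - b)/(y - a)\<close> and the chart \<open>U = (y - a)/(z - b)\<close>, \<open>V = z - b\<close>.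
\<close>

definition blowup_uv :: "('k::field \<Rightarrow> 'k) \<Rightarrow> 'k system \<Rightarrow> 'k \<Rightarrow> 'k \<Rightarrow> 'k system" where
  "blowup_uv d S a b u v =
     (let (P, Q) = S (a + u) (b + u * v)
      in (P - d a, (Q - d b - v * (P - d a)) / u))"

definition blowup_UV :: "('k::field \<Rightarrow> 'k) \<Rightarrow> 'k system \<Rightarrow> 'k \<Rightarrow> 'k \<Rightarrow> 'k system" where
  "blowup_UV d S a b U V =
     (let (P, Q) = S (a + U * V) (b + V)
      in ((P - d a - U * (Q - d b)) / V, Q - d b))"

text \<open>
  \<open>cascades_regular d S a b\<close>: blowing up the base point \<open>(a,b)\<close>, then all base points on the
  exceptional curve, and so on, ends after finitely many steps, and whenever the exceptional
  curve carries no further base point, the system is regular along it in one of its two charts.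

  The exceptional curve consists of \<open>{V = 0}\<close> and the single remaining point \<open>u = v = 0\<close>;
  each of its points is examined in one chart only.  This matters, since a \<open>0/0\<close> in one of the
  two components is not invariant under change of chart: at a point where the vector field
  merely has a pole, \<open>u' = V U' + U V'\<close> can be \<open>0/0\<close> although neither \<open>U'\<close> nor \<open>V'\<close> is.
\<close>

inductive cascades_regular :: "('k::field \<Rightarrow> 'k) \<Rightarrow> 'k system \<Rightarrow> 'k \<Rightarrow> 'k \<Rightarrow> bool"
  for d :: "'k::field \<Rightarrow> 'k" where
  "\<lbrakk>\<And>c. base_point (blowup_UV d S a b) c 0 \<Longrightarrow> cascades_regular d (blowup_UV d S a b) c 0;
    base_point (blowup_uv d S a b) 0 0 \<Longrightarrow> cascades_regular d (blowup_uv d S a b) 0 0;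
    \<lbrakk>\<forall>c. \<not> base_point (blowup_UV d S a b) c 0; \<not> base_point (blowup_uv d S a b) 0 0\<rbrakk> \<Longrightarrow>
      (\<forall>c. regular_system_at (blowup_uv d S a b) 0 c) \<or>
      (\<forall>c. regular_system_at (blowup_UV d S a b) c 0)\<rbrakk>
   \<Longrightarrow> cascades_regular d S a b"

text \<open>
  Likewise the projective plane is the disjoint union of the affine chart, of \<open>{V0 = 0}\<close> and
  of the point \<open>u0 = v0 = 0\<close>.
\<close>

definition regularised :: "('k::field \<Rightarrow> 'k) \<Rightarrow> 'k system \<Rightarrow> bool" where
  "regularised d S \<longleftrightarrow>
     (\<forall>a b. base_point S a b \<longrightarrow> cascades_regular d S a b) \<and>
     (\<forall>c. base_point (chart_UV S) c 0 \<longrightarrow> cascades_regular d (chart_UV S) c 0) \<and>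
     (base_point (chart_uv S) 0 0 \<longrightarrow> cascades_regular d (chart_uv S) 0 0)"

section \<open>Transformations of systems\<close>

type_synonym 'k ratfun = "'k poly poly \<times> 'k poly poly"

fun rat_eval :: "'k::field ratfun \<Rightarrow> 'k \<Rightarrow> 'k \<Rightarrow> 'k" where
  "rat_eval (N, M) y z = eval2 N y z / eval2 M y z"

text \<open>The derivative of \<open>N(y,z)\<close>, resp. \<open>N(y,z)/M(y,z)\<close>, along the system \<open>S\<close>.\<close>

definition poly_along :: "('k::field \<Rightarrow> 'k) \<Rightarrow> 'k system \<Rightarrow> 'k poly poly \<Rightarrow> 'k \<Rightarrow> 'k \<Rightarrow> 'k" where
  "poly_along d S N y z =
     eval2 (map_poly (map_poly d) N) y z
     + eval2 (d_dy N) y z * fst (S y z) + eval2 (d_dz N) y z * snd (S y z)"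

fun rat_along :: "('k::field \<Rightarrow> 'k) \<Rightarrow> 'k system \<Rightarrow> 'k ratfun \<Rightarrow> 'k \<Rightarrow> 'k \<Rightarrow> 'k" where
  "rat_along d S (N, M) y z =
     (poly_along d S N y z * eval2 M y z - eval2 N y z * poly_along d S M y z) / (eval2 M y z)\<^sup>2"

type_synonym 'k ratmap = "'k ratfun \<times> 'k ratfun"

definition ratmap_ok :: "'k::field ratmap \<Rightarrow> bool" where
  "ratmap_ok T \<longleftrightarrow> snd (fst T) \<noteq> 0 \<and> snd (snd T) \<noteq> 0"

definition map_eval :: "'k::field ratmap \<Rightarrow> 'k \<Rightarrow> 'k \<Rightarrow> 'k \<times> 'k" where
  "map_eval T y z = (rat_eval (fst T) y z, rat_eval (snd T) y z)"

definition birational :: "'k::field ratmap \<Rightarrow> bool" where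
  "birational T \<longleftrightarrow> ratmap_ok T \<and>
     (\<exists>T'. ratmap_ok T' \<and>
        generically (\<lambda>y z. case_prod (map_eval T') (map_eval T y z) = (y, z)) \<and>
        generically (\<lambda>y z. case_prod (map_eval T) (map_eval T' y z) = (y, z)))"

text \<open>
  \<open>T\<close> expresses the unknowns of the system \<open>S'\<close> through the unknowns \<open>(y,z)\<close> of the
  system \<open>S\<close>, and substituting \<open>T\<close> in \<open>S'\<close> gives \<open>S\<close>.
\<close>

definition transforms_to :: "('k::field \<Rightarrow> 'k) \<Rightarrow> 'k system \<Rightarrow> 'k ratmap \<Rightarrow> 'k system \<Rightarrow> bool" where
  "transforms_to d S' T S \<longleftrightarrow> ratmap_ok T \<and>
     generically (\<lambda>y z.
       (rat_along d S (fst T) y z, rat_along d S (snd T) y z) = case_prod S' (map_eval T y z))"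

definition hamiltonian_system :: "'k::field poly poly \<Rightarrow> 'k system" where
  "hamiltonian_system H y z = (eval2 (d_dz H) y z, - eval2 (d_dy H) y z)"

section \<open>Coefficients that are rational in x, q and the derivatives of q\<close>

datatype dexp = Const complex | Indep | Deriv nat | Plus dexp dexp | Times dexp dexp | Recip dexp

text \<open>
  \<open>Indep\<close> stands for \<open>x\<close> and \<open>Deriv n\<close> for the \<open>n\<close>-th derivative of \<open>q\<close>.  The
  embedding \<open>h\<close> of the constants, the value of \<open>x\<close> and those of the derivatives are parameters.
\<close>

primrec dexp_val :: "(complex \<Rightarrow> 'k::field) \<Rightarrow> 'k \<Rightarrow> (nat \<Rightarrow> 'k) \<Rightarrow> dexp \<Rightarrow> 'k" where
  "dexp_val h x w (Const c) = h c"
| "dexp_val h x w Indep = x"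
| "dexp_val h x w (Deriv n) = w n"
| "dexp_val h x w (Plus a b) = dexp_val h x w a + dexp_val h x w b"
| "dexp_val h x w (Times a b) = dexp_val h x w a * dexp_val h x w b"
| "dexp_val h x w (Recip a) = inverse (dexp_val h x w a)"

primrec dexp_defined :: "(complex \<Rightarrow> 'k::field) \<Rightarrow> 'k \<Rightarrow> (nat \<Rightarrow> 'k) \<Rightarrow> dexp \<Rightarrow> bool" where
  "dexp_defined h x w (Const c) \<longleftrightarrow> True"
| "dexp_defined h x w Indep \<longleftrightarrow> True"
| "dexp_defined h x w (Deriv n) \<longleftrightarrow> True"
| "dexp_defined h x w (Plus a b) \<longleftrightarrow> dexp_defined h x w a \<and> dexp_defined h x w b"
| "dexp_defined h x w (Times a b) \<longleftrightarrow> dexp_defined h x w a \<and> dexp_defined h x w b"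
| "dexp_defined h x w (Recip a) \<longleftrightarrow> dexp_defined h x w a \<and> dexp_val h x w a \<noteq> 0"

primrec dexp_order :: "dexp \<Rightarrow> nat" where
  "dexp_order (Const c) = 0"
| "dexp_order Indep = 0"
| "dexp_order (Deriv n) = n"
| "dexp_order (Plus a b) = max (dexp_order a) (dexp_order b)"
| "dexp_order (Times a b) = max (dexp_order a) (dexp_order b)"
| "dexp_order (Recip a) = dexp_order a"

definition dexp_fun :: "(complex \<Rightarrow> complex) \<Rightarrow> dexp \<Rightarrow> complex \<Rightarrow> complex" where
  "dexp_fun q e x = dexp_val id x (\<lambda>n. (deriv ^^ n) q x) e"

text \<open>
  The germ at \<open>x0\<close> of a meromorphic function is its Laurent series at \<open>x0\<close>; on these series
  \<open>d/dx\<close> is \<open>fls_deriv\<close> and \<open>x\<close> is \<open>x0 + (x - x0)\<close>.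
\<close>

definition x_germ :: "complex \<Rightarrow> complex fls" where
  "x_germ x0 = fls_const x0 + fls_X"

definition dexp_germ :: "complex \<Rightarrow> complex fls \<Rightarrow> dexp \<Rightarrow> complex fls" where
  "dexp_germ x0 q = dexp_val fls_const (x_germ x0) (\<lambda>n. (fls_deriv ^^ n) q)"

definition dexp_germ_defined :: "complex \<Rightarrow> complex fls \<Rightarrow> dexp \<Rightarrow> bool" where
  "dexp_germ_defined x0 q = dexp_defined fls_const (x_germ x0) (\<lambda>n. (fls_deriv ^^ n) q)"

text \<open>
  A pair of quotients of polynomials in \<open>(y,z)\<close> with coefficients of type \<open>'c\<close>; the list
  entry \<open>(c,i,j)\<close> stands for the term \<open>c y\<^sup>i z\<^sup>j\<close>.
\<close>

type_synonym 'c terms = "('c \<times> nat \<times> nat) list"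
type_synonym 'c pair = "('c terms \<times> 'c terms) \<times> ('c terms \<times> 'c terms)"

definition terms_poly :: "('c \<Rightarrow> 'k::comm_monoid_add) \<Rightarrow> 'c terms \<Rightarrow> 'k poly poly" where
  "terms_poly h ts = (\<Sum>(c, i, j)\<leftarrow>ts. monom (monom (h c) j) i)"

fun pair_map :: "('c \<Rightarrow> 'k::field) \<Rightarrow> 'c pair \<Rightarrow> 'k ratmap" where
  "pair_map h ((N1, M1), (N2, M2)) =
     ((terms_poly h N1, terms_poly h M1), (terms_poly h N2, terms_poly h M2))"

fun pair_coeffs :: "'c pair \<Rightarrow> 'c set" where
  "pair_coeffs ((N1, M1), (N2, M2)) = fst ` (set N1 \<union> set M1 \<union> set N2 \<union> set M2)"

text \<open>
  A \<open>dexp pair\<close> is a system \<open>y' = P(y,z;x), z' = Q(y,z;x)\<close> whose coefficients are expressions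
  in \<open>x\<close> and an undetermined function \<open>q\<close>; \<open>system_at x0 q S\<close> is the system obtained for a
  particular germ \<open>q\<close>.
\<close>

definition system_at :: "complex \<Rightarrow> complex fls \<Rightarrow> dexp pair \<Rightarrow> complex fls system" where
  "system_at x0 q S = map_eval (pair_map (dexp_germ x0 q) S)"

definition system_defined :: "complex \<Rightarrow> complex fls \<Rightarrow> dexp pair \<Rightarrow> bool" where
  "system_defined x0 q S \<longleftrightarrow>
     (\<forall>c\<in>pair_coeffs S. dexp_germ_defined x0 q c) \<and> ratmap_ok (pair_map (dexp_germ x0 q) S)"

section \<open>Bureau-Guillot systems\<close>

definition satisfies :: "complex \<Rightarrow> complex fls \<Rightarrow> dexp list \<Rightarrow> bool" where
  "satisfies x0 q \<Phi> \<longleftrightarrow> (\<forall>\<phi>\<in>set \<Phi>. dexp_germ_defined x0 q \<phi> \<and> dexp_germ x0 q \<phi> = 0)"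

text \<open>
  \<open>Ham x0\<close> is the Hamiltonian system (over the germs at \<open>x0\<close>) and \<open>sol D q\<close> says that \<open>q\<close>
  solves the Painleve equation on the domain \<open>D\<close>.  The three conjuncts are:
  birational equivalence by a transformation with meromorphic coefficients;
  meromorphy of the coefficients (their rationality in \<open>x\<close>, \<open>q\<close> and the derivatives of \<open>q\<close>
  is built into the type \<open>dexp pair\<close>);
  the regularising conditions, for undetermined \<open>q\<close>, are differential equations \<open>\<Phi>\<close> for \<open>q\<close>,
  not satisfied by all functions, but satisfied by the solutions of the Painleve equation.
\<close>

definition bureau_guillot ::
  "(complex \<Rightarrow> complex fls system) \<Rightarrow> (complex set \<Rightarrow> (complex \<Rightarrow> complex) \<Rightarrow> bool) \<Rightarrow>
   dexp pair \<Rightarrow> bool" where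
  "bureau_guillot Ham sol S \<longleftrightarrow>
     (\<forall>D q. sol D q \<longrightarrow>
        (\<exists>T :: (complex \<Rightarrow> complex) pair.
           (\<forall>c\<in>pair_coeffs T. c meromorphic_on D) \<and>
           (\<forall>x0\<in>D. birational (pair_map (\<lambda>c. laurent_expansion c x0) T) \<and>
              transforms_to fls_deriv (Ham x0) (pair_map (\<lambda>c. laurent_expansion c x0) T)
                (system_at x0 (laurent_expansion q x0) S)))) \<and>
     (\<forall>D q. sol D q \<longrightarrow>
        (\<forall>c\<in>pair_coeffs S. dexp_fun q c meromorphic_on D) \<and>
        (\<forall>x0\<in>D. system_defined x0 (laurent_expansion q x0) S)) \<and>
     (\<exists>\<Phi>.
        (\<forall>x0 q. q meromorphic_on {x0} \<longrightarrow> system_defined x0 (laurent_expansion q x0) S \<longrightarrow>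
           (regularised fls_deriv (system_at x0 (laurent_expansion q x0) S) \<longleftrightarrow>
            satisfies x0 (laurent_expansion q x0) \<Phi>)) \<and>
        (\<forall>x0. \<exists>q. q meromorphic_on {x0} \<and> system_defined x0 (laurent_expansion q x0) S \<and>
           \<not> satisfies x0 (laurent_expansion q x0) \<Phi>) \<and>
        (\<forall>D q. sol D q \<longrightarrow> (\<forall>x0\<in>D. satisfies x0 (laurent_expansion q x0) \<Phi>)))"

section \<open>The fifth Painleve equation\<close>

definition painleve_V_rhs ::
  "complex \<Rightarrow> complex \<Rightarrow> complex \<Rightarrow> complex \<Rightarrow> complex \<Rightarrow> complex \<Rightarrow> complex \<Rightarrow> complex" where
  "painleve_V_rhs \<alpha> \<beta> \<gamma> \<delta> x y y' =
     (1 / (2 * y) + 1 / (y - 1)) * y'\<^sup>2 - y' / x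
     + (y - 1)\<^sup>2 / x\<^sup>2 * (\<alpha> * y + \<beta> / y) + \<gamma> * y / x + \<delta> * y * (y + 1) / (y - 1)"

text \<open>
  A solution is a (single-valued) meromorphic function on a domain, not identically 0 or 1,
  where the equation has no meaning; \<open>\<forall>\<^sub>\<approx>\<close> (off a discrete set) leaves out the poles of \<open>q\<close>, the
  points where \<open>q\<close> is 0 or 1, and \<open>x = 0\<close>.
\<close>

definition painleve_V_solution ::
  "complex \<Rightarrow> complex \<Rightarrow> complex \<Rightarrow> complex \<Rightarrow> complex set \<Rightarrow> (complex \<Rightarrow> complex) \<Rightarrow> bool" where
  "painleve_V_solution \<alpha> \<beta> \<gamma> \<delta> D q \<longleftrightarrow>
     open D \<and> connected D \<and> q meromorphic_on D \<and>
     (\<forall>\<^sub>\<approx>x\<in>D. q x \<noteq> 0 \<and> q x \<noteq> 1 \<and>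
        deriv (deriv q) x = painleve_V_rhs \<alpha> \<beta> \<gamma> \<delta> x (q x) (deriv q x))"

definition okamoto_hamiltonian :: "'k::field \<Rightarrow> 'k \<Rightarrow> 'k \<Rightarrow> 'k \<Rightarrow> 'k \<Rightarrow> 'k poly poly" where
  "okamoto_hamiltonian \<kappa>0 \<kappa>t \<kappa> \<eta> x =
     Cpol (1 / x) *
       (Ypol * (Ypol - 1)\<^sup>2 * Zpol\<^sup>2
        - Zpol * (Cpol \<kappa>0 * (Ypol - 1)\<^sup>2 + Cpol \<kappa>t * Ypol * (Ypol - 1) - Cpol (\<eta> * x) * Ypol)
        + Cpol \<kappa> * (Ypol - 1))"

definition okamoto_system :: "complex \<Rightarrow> complex \<Rightarrow> complex \<Rightarrow> complex \<Rightarrow> complex \<Rightarrow> complex fls system" where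
  "okamoto_system \<kappa>0 \<kappa>t \<kappa> \<eta> x0 =
     hamiltonian_system
       (okamoto_hamiltonian (fls_const \<kappa>0) (fls_const \<kappa>t) (fls_const \<kappa>) (fls_const \<eta>) (x_germ x0))"

text \<open>
  The sign of \<open>\<gamma>\<close> that belongs to this Hamiltonian is \<open>\<gamma> = + \<eta> (\<kappa>t + 1)\<close>.  Below \<open>y1, z1\<close> are the
  values of \<open>y', z'\<close> given by the Hamiltonian system; the last assumption is the derivative of
  its first equation, and \<open>y2\<close> the resulting value of \<open>y''\<close>.
\<close>

lemma okamoto_painleve_V:
  fixes x y z y1 z1 y2 \<kappa>0 \<kappa>t \<kappa> \<eta> :: complex
  assumes nz: "x \<noteq> 0" "y \<noteq> 0" "y \<noteq> 1"
    and y1: "x * y1 = 2 * y * (y - 1)\<^sup>2 * z - (\<kappa>0 * (y - 1)\<^sup>2 + \<kappa>t * y * (y - 1) - \<eta> * x * y)"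
    and z1: "x * z1 = - ((y - 1) * (3 * y - 1) * z\<^sup>2
               - z * (2 * \<kappa>0 * (y - 1) + \<kappa>t * (2 * y - 1) - \<eta> * x) + \<kappa>)"
    and y2: "y1 + x * y2 = 2 * (y - 1) * (3 * y - 1) * y1 * z + 2 * y * (y - 1)\<^sup>2 * z1
               - (2 * \<kappa>0 * (y - 1) * y1 + \<kappa>t * (2 * y - 1) * y1 - \<eta> * y - \<eta> * x * y1)"
  shows "y2 = painleve_V_rhs ((\<kappa>0 + \<kappa>t)\<^sup>2 / 2 - 2 * \<kappa>) (- \<kappa>0\<^sup>2 / 2) (\<eta> * (\<kappa>t + 1)) (- \<eta>\<^sup>2 / 2) x y y1"
proof -
  define w where "w = y - 1"
  have w: "w \<noteq> 0" "y = w + 1" using nz by (auto simp: w_def)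
  have Y1: "y1 = (2 * y * w\<^sup>2 * z - (\<kappa>0 * w\<^sup>2 + \<kappa>t * y * w - \<eta> * x * y)) / x"
    using y1 nz by (simp add: w_def field_simps)
  have Z1: "z1 = - (w * (3 * y - 1) * z\<^sup>2 - z * (2 * \<kappa>0 * w + \<kappa>t * (2 * y - 1) - \<eta> * x) + \<kappa>) / x"
    using z1 nz by (simp add: w_def field_simps)
  have Y2: "y2 = (2 * w * (3 * y - 1) * y1 * z + 2 * y * w\<^sup>2 * z1
       - (2 * \<kappa>0 * w * y1 + \<kappa>t * (2 * y - 1) * y1 - \<eta> * y - \<eta> * x * y1) - y1) / x"
    using y2 nz by (simp add: w_def field_simps)
  show ?thesis
    unfolding painleve_V_rhs_def Y2 Z1 Y1 w_def[symmetric]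
    using nz w(1) unfolding w(2) by (simp add: divide_simps) algebra
qed

text \<open>\<open>(y,z) \<mapsto> (y5,z5)\<close>\<close>

definition bg_transformation ::
  "complex \<Rightarrow> complex \<Rightarrow> complex \<Rightarrow> complex \<Rightarrow> complex fls \<Rightarrow> complex fls ratmap" where
  "bg_transformation \<kappa>0 \<kappa>t \<eta> x0 q =
     (let x = x_germ x0; k0 = fls_const \<kappa>0; kt = fls_const \<kappa>t;
          p = (x * fls_deriv q - q * (x * fls_const \<eta> + 2 * k0 + kt) + q\<^sup>2 * (k0 + kt) + k0)
              / (2 * q * (q - 1)\<^sup>2)
      in ((Zpol + Cpol q, 1), (Ypol * Zpol + Cpol p, 1)))"

text \<open>
  \<open>S\<close> is the system to which the Hamiltonian system is brought.  Substituting the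
  transformation produces \<open>q''\<close>, which is eliminated by means of the Painleve equation, so that
  the coefficients of \<open>S\<close> involve only \<open>x, q, q'\<close>.  As a solution can have arbitrary initial
  values \<open>(q, q')\<close>, these coefficients are then uniquely determined as rational functions.
\<close>

definition gives_rise_to ::
  "complex \<Rightarrow> complex \<Rightarrow> complex \<Rightarrow> complex \<Rightarrow>
   (complex set \<Rightarrow> (complex \<Rightarrow> complex) \<Rightarrow> bool) \<Rightarrow> dexp pair \<Rightarrow> bool" where
  "gives_rise_to \<kappa>0 \<kappa>t \<kappa> \<eta> sol S \<longleftrightarrow>
     (\<forall>c\<in>pair_coeffs S. dexp_order c \<le> 1) \<and>
     (\<forall>D q. sol D q \<longrightarrow>
        (\<forall>x0\<in>D. system_defined x0 (laurent_expansion q x0) S \<and>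
           transforms_to fls_deriv (okamoto_system \<kappa>0 \<kappa>t \<kappa> \<eta> x0)
             (bg_transformation \<kappa>0 \<kappa>t \<eta> x0 (laurent_expansion q x0))
             (system_at x0 (laurent_expansion q x0) S)))"

end

theory Submission
  imports Defs "HOL-Computational_Algebra.Field_as_Ring"
    "HOL-Computational_Algebra.Polynomial_Factorial"
begin

text \<open>
  Let \<open>p\<close> be the rational function of \<open>x, q, q'\<close> that is added to \<open>yz\<close>.  It is chosen such that
  \<open>(q,p)\<close> satisfies the first Okamoto equation for every \<open>q\<close>; let \<open>ka\<close> be the function that has to
  replace \<open>\<kappa>\<close> in order that \<open>(q,p)\<close> also satisfies the second one.  Then \<open>(z + q, yz + p)\<close> satisfies the
  Okamoto system with \<open>\<kappa>\<close> replaced by \<open>ka\<close> whenever \<open>(y,z)\<close> satisfies the system of the theorem,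
  whose coefficients do not contain \<open>q''\<close>.  All charts of the blow-ups are pairs of generators of
  one field with a derivation, the function field of the plane, and the calculations are made there.
  The cascades over \<open>y5 = 0\<close> and \<open>y5 = 1\<close> always end in a regular system, as in Okamoto's space of
  initial values.  Over \<open>y5 = \<infinity>\<close> the last base points are the roots \<open>s\<close> of
  \<open>s\<^sup>2 - (\<kappa>0 + \<kappa>t) s + ka = 0\<close>, and the blow-up of such a point is regular if and only if \<open>s' = 0\<close>.
  Hence the regularising condition is \<open>ka' = 0\<close>, a differential equation of the third order for \<open>q\<close>
  with the first integral \<open>ka\<close>, and the Painleve equation is \<open>ka = \<kappa>\<close>.
\<close>

instantiation fls :: (field)
  "{unique_euclidean_ring, normalization_euclidean_semiring, normalization_semidom_multiplicative}"
begin

definition [simp]: "normalize_fls = (normalize_field :: 'a fls \<Rightarrow> _)"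
definition [simp]: "unit_factor_fls = (unit_factor_field :: 'a fls \<Rightarrow> _)"
definition [simp]: "modulo_fls = (mod_field :: 'a fls \<Rightarrow> _)"
definition [simp]: "euclidean_size_fls = (euclidean_size_field :: 'a fls \<Rightarrow> _)"
definition [simp]: "division_segment (x :: 'a fls) = 1"

instance
  by standard (simp_all add: dvd_field_iff field_split_simps split: if_splits)

end

instantiation fls :: (field) euclidean_ring_gcd
begin

definition gcd_fls :: "'a fls \<Rightarrow> 'a fls \<Rightarrow> 'a fls" where "gcd_fls = Euclidean_Algorithm.gcd"
definition lcm_fls :: "'a fls \<Rightarrow> 'a fls \<Rightarrow> 'a fls" where "lcm_fls = Euclidean_Algorithm.lcm"
definition Gcd_fls :: "'a fls set \<Rightarrow> 'a fls" where "Gcd_fls = Euclidean_Algorithm.Gcd"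
definition Lcm_fls :: "'a fls set \<Rightarrow> 'a fls" where "Lcm_fls = Euclidean_Algorithm.Lcm"

instance by standard (simp_all add: gcd_fls_def lcm_fls_def Gcd_fls_def Lcm_fls_def)

end

instance fls :: (field) field_gcd ..

section \<open>Evaluation of bivariate polynomials\<close>

definition ring_hom1 :: "('a::comm_ring_1 \<Rightarrow> 'b::comm_ring_1) \<Rightarrow> bool" where
  "ring_hom1 f \<longleftrightarrow> f 0 = 0 \<and> f 1 = 1 \<and> (\<forall>a b. f (a + b) = f a + f b) \<and> (\<forall>a b. f (a * b) = f a * f b)"

lemma ring_hom1_id: "ring_hom1 (\<lambda>x. x)"
  by (simp add: ring_hom1_def)

lemma ring_hom1_minus: "ring_hom1 f \<Longrightarrow> f (- a) = - f a"
  unfolding ring_hom1_def by (metis add.right_inverse add_eq_0_iff)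

lemma ring_hom1_diff: "ring_hom1 f \<Longrightarrow> f (a - b) = f a - f b"
  using ring_hom1_minus[of f b] unfolding ring_hom1_def by (metis diff_conv_add_uminus)

lemma ring_hom1_poly:
  assumes "ring_hom1 f"
  shows "ring_hom1 (\<lambda>p. poly (map_poly f p) b)"
proof -
  have f: "f 0 = 0" "f 1 = 1" "\<And>x y. f (x + y) = f x + f y" "\<And>x y. f (x * y) = f x * f y"
    using assms by (auto simp: ring_hom1_def)
  have pC: "map_poly f (pCons a p) = pCons (f a) (map_poly f p)" for a p
    by (simp add: map_poly_pCons f)
  have add: "map_poly f (p + q) = map_poly f p + map_poly f q" for p q
    by (rule poly_eqI) (simp add: coeff_map_poly f)
  have smult: "map_poly f (smult a q) = smult (f a) (map_poly f q)" for a q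
    by (rule poly_eqI) (simp add: coeff_map_poly f)
  have mult: "map_poly f (p * q) = map_poly f p * map_poly f q" for p q
    by (induction p) (simp_all add: pC add smult f)
  show ?thesis
    unfolding ring_hom1_def by (simp add: add mult f map_poly_1')
qed

lemma ring_hom1_poly_apply:
  assumes "ring_hom1 f"
  shows "f (poly p b) = poly (map_poly f p) (f b)"
  using assms by (induction p) (simp_all add: ring_hom1_def map_poly_pCons)

definition ev :: "('k::comm_ring_1 \<Rightarrow> 'l::comm_ring_1) \<Rightarrow> 'k poly poly \<Rightarrow> 'l \<Rightarrow> 'l \<Rightarrow> 'l" where
  "ev f N u v = poly (map_poly (\<lambda>r. poly (map_poly f r) v) N) u"

lemma ring_hom1_ev: "ring_hom1 f \<Longrightarrow> ring_hom1 (\<lambda>N. ev f N u v)"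
  unfolding ev_def by (intro ring_hom1_poly)

lemma ev_gens [simp]:
  assumes "ring_hom1 f"
  shows "ev f (Cpol c) u v = f c" "ev f Ypol u v = u" "ev f Zpol u v = v"
  using assms by (simp_all add: ev_def ring_hom1_def map_poly_pCons)

lemma ev_arith:
  assumes "ring_hom1 f"
  shows "ev f 0 u v = 0" "ev f 1 u v = 1"
    "ev f (N + M) u v = ev f N u v + ev f M u v"
    "ev f (N * M) u v = ev f N u v * ev f M u v"
    "ev f (N - M) u v = ev f N u v - ev f M u v"
    "ev f (- M) u v = - ev f M u v"
    "ev f (N ^ n) u v = ev f N u v ^ n"
proof -
  note h = ring_hom1_ev[OF assms, of u v]
  show z: "ev f 0 u v = 0" "ev f 1 u v = 1"
    "ev f (N + M) u v = ev f N u v + ev f M u v"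
    and m: "ev f (N * M) u v = ev f N u v * ev f M u v" for N M
    using h by (simp_all add: ring_hom1_def)
  show "ev f (N - M) u v = ev f N u v - ev f M u v" "ev f (- M) u v = - ev f M u v"
    using ring_hom1_diff[OF h] ring_hom1_minus[OF h] by auto
  show "ev f (N ^ n) u v = ev f N u v ^ n"
    by (induction n) (simp_all add: z m)
qed

lemma eval2_ev: "eval2 N y z = ev (\<lambda>x. x) N y z"
proof -
  have h: "ring_hom1 (\<lambda>p. poly p z)"
    using ring_hom1_poly[OF ring_hom1_id, of z] by (simp add: map_poly_idI)
  show ?thesis
    using ring_hom1_poly_apply[OF h, of N "[:y:]"] by (simp add: eval2_def ev_def map_poly_idI)
qed

lemma eval2_simps [simp]:
  fixes N M :: "'k::comm_ring_1 poly poly"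
  shows "eval2 (Cpol c) u v = c" "eval2 Ypol u v = u" "eval2 Zpol u v = v"
    "eval2 (0 :: 'k poly poly) u v = 0" "eval2 (1 :: 'k poly poly) u v = 1"
    "eval2 (N + M) u v = eval2 N u v + eval2 M u v"
    "eval2 (N * M) u v = eval2 N u v * eval2 M u v"
    "eval2 (N - M) u v = eval2 N u v - eval2 M u v"
    "eval2 (- M) u v = - eval2 M u v"
    "eval2 (N ^ n) u v = eval2 N u v ^ n"
  by (simp_all add: eval2_ev ev_arith[OF ring_hom1_id] ev_gens[OF ring_hom1_id] del: pCons_0_0)

definition PC :: "'k::comm_ring_1 \<Rightarrow> 'k poly poly" where "PC c = Cpol c"
definition PY :: "'k::comm_ring_1 poly poly" where "PY = Ypol"
definition PZ :: "'k::comm_ring_1 poly poly" where "PZ = Zpol"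

lemma ev_gens' [simp]:
  assumes "ring_hom1 f"
  shows "ev f (PC c) u v = f c" "ev f PY u v = u" "ev f PZ u v = v"
  using ev_gens[OF assms] by (simp_all only: PC_def PY_def PZ_def)

lemma eval2_gens' [simp]: "eval2 (PC c) u v = c" "eval2 PY u v = u" "eval2 PZ u v = v"
  by (simp_all only: PC_def PY_def PZ_def eval2_simps)

lemma poly2_induct [case_names const Y Z add mult]:
  fixes N :: "'k::comm_ring_1 poly poly"
  assumes C: "\<And>c. P (PC c)" and Y: "P PY" and Z: "P PZ"
    and add: "\<And>N M. P N \<Longrightarrow> P M \<Longrightarrow> P (N + M)"
    and mult: "\<And>N M. P N \<Longrightarrow> P M \<Longrightarrow> P (N * M)"
  shows "P N"
proof -
  have 1: "P [:r:]" for r :: "'k poly"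
  proof (induction r)
    case 0
    then show ?case using C[of 0, unfolded PC_def] by simp
  next
    case (pCons a r)
    have "[:pCons a r:] = Cpol a + Zpol * [:r:]" by simp
    then show ?case using pCons C[unfolded PC_def] Z[unfolded PZ_def] add mult by metis
  qed
  show ?thesis
  proof (induction N)
    case 0
    then show ?case using C[of 0, unfolded PC_def] by simp
  next
    case (pCons a N)
    have "pCons a N = [:a:] + Ypol * N" by simp
    then show ?case using pCons 1 Y[unfolded PY_def] add mult by metis
  qed
qed

lemma eval2_zero_imp:
  fixes N :: "'k::field_char_0 poly poly"
  assumes "\<And>y z. eval2 N y z = 0"
  shows "N = 0"
proof -
  have "poly N [:y:] = 0" for y
    using assms poly_all_0_iff_0[of "poly N [:y:]"] by (simp add: eval2_def)
  moreover have "infinite (range (\<lambda>y::'k. [:y:]))"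
    using finite_imageD[of "\<lambda>y::'k. [:y:]" UNIV] infinite_UNIV_char_0[where ?'a = 'k]
    by (auto simp: inj_on_def)
  ultimately show ?thesis
    using poly_roots_finite[of N] by (metis (mono_tags, lifting) finite_subset mem_Collect_eq rangeE subsetI)
qed

lemma eval2_nonzero_point:
  fixes N :: "'k::field_char_0 poly poly"
  assumes "N \<noteq> 0"
  obtains y z where "eval2 N y z \<noteq> 0"
  using assms eval2_zero_imp by blast

lemma generically_conj:
  fixes R :: "'k::field \<Rightarrow> 'k \<Rightarrow> bool"
  assumes "generically R" "generically R'"
  shows "generically (\<lambda>y z. R y z \<and> R' y z)"
proof -
  obtain E E' where "E \<noteq> 0" "E' \<noteq> 0" "\<forall>y z. eval2 E y z \<noteq> 0 \<longrightarrow> R y z"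
    "\<forall>y z. eval2 E' y z \<noteq> 0 \<longrightarrow> R' y z"
    using assms by (auto simp: generically_def)
  then show ?thesis
    unfolding generically_def by (intro exI[of _ "E * E'"]) auto
qed

lemma generically_mono:
  "generically R \<Longrightarrow> (\<And>y z. R y z \<Longrightarrow> R' y z) \<Longrightarrow> generically R'"
  unfolding generically_def by blast

lemma generically_nonzero: "N \<noteq> 0 \<Longrightarrow> generically (\<lambda>y z. eval2 N y z \<noteq> 0)"
  unfolding generically_def by blast

lemma generically_ex:
  fixes R :: "'k::field_char_0 \<Rightarrow> 'k \<Rightarrow> bool"
  assumes "generically R"
  obtains y z where "R y z"
  using assms unfolding generically_def by (metis eval2_nonzero_point)

lemma poly2_eq_generically:
  fixes N M :: "'k::field_char_0 poly poly"
  assumes "generically (\<lambda>y z. eval2 N y z = eval2 M y z)"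
  shows "N = M"
proof (rule ccontr)
  assume "N \<noteq> M"
  then have "generically (\<lambda>y z. eval2 (N - M) y z \<noteq> 0)" by (intro generically_nonzero) simp
  from generically_ex[OF generically_conj[OF assms this]] show False by auto
qed

lemma represents_cross:
  fixes f :: "'k::field_char_0 \<Rightarrow> 'k \<Rightarrow> 'k"
  assumes "represents f N M" "represents f N' M'"
  shows "N * M' = N' * M"
proof (rule poly2_eq_generically)
  have "generically (\<lambda>y z. ((f y z = eval2 N y z / eval2 M y z \<and> f y z = eval2 N' y z / eval2 M' y z) \<and>
     eval2 M y z \<noteq> 0) \<and> eval2 M' y z \<noteq> 0)"
    using assms unfolding represents_def
    by (intro generically_conj generically_nonzero) auto
  then show "generically (\<lambda>y z. eval2 (N * M') y z = eval2 (N' * M) y z)"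
    by (rule generically_mono) (auto simp: field_simps)
qed

lemma represents_cong:
  fixes f :: "'k::field_char_0 \<Rightarrow> 'k \<Rightarrow> 'k"
  assumes "represents f N M" "N * M' = N' * M" "M' \<noteq> 0"
  shows "represents f N' M'"
proof -
  have "generically (\<lambda>y z. (f y z = eval2 N y z / eval2 M y z \<and> eval2 M y z \<noteq> 0) \<and> eval2 M' y z \<noteq> 0)"
    using assms unfolding represents_def
    by (intro generically_conj generically_nonzero) auto
  then have "generically (\<lambda>y z. f y z = eval2 N' y z / eval2 M' y z)"
  proof (rule generically_mono)
    fix y z
    assume a: "(f y z = eval2 N y z / eval2 M y z \<and> eval2 M y z \<noteq> 0) \<and> eval2 M' y z \<noteq> 0"
    have "eval2 N y z * eval2 M' y z = eval2 N' y z * eval2 M y z"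
      using arg_cong[OF assms(2), of "\<lambda>P. eval2 P y z"] by simp
    with a show "f y z = eval2 N' y z / eval2 M' y z" by (simp add: field_simps)
  qed
  with assms(3) show ?thesis by (simp add: represents_def)
qed

lemma not_indeterminateI:
  fixes f :: "'k::{field_char_0,field_gcd} \<Rightarrow> 'k \<Rightarrow> 'k"
  assumes "represents f N M" "eval2 N a b \<noteq> 0 \<or> eval2 M a b \<noteq> 0"
  shows "\<not> indeterminate_at f a b"
proof
  assume "indeterminate_at f a b"
  then obtain N0 M0 where r: "represents f N0 M0" and co: "coprime N0 M0"
    and z: "eval2 N0 a b = 0" "eval2 M0 a b = 0"
    by (auto simp: indeterminate_at_def)
  have eq: "N0 * M = N * M0" using represents_cross[OF r assms(1)] .
  then have "N0 dvd N * M0" by (metis dvd_triv_left)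
  then have "N0 dvd N" using co by (simp add: coprime_dvd_mult_left_iff)
  then have "eval2 N a b = 0" using z by (auto elim!: dvdE)
  have "M0 dvd M * N0" using eq by (metis dvd_triv_right mult.commute)
  then have "M0 dvd M" using co by (simp add: coprime_dvd_mult_left_iff coprime_commute)
  then have "eval2 M a b = 0" using z by (auto elim!: dvdE)
  with \<open>eval2 N a b = 0\<close> assms(2) show False by simp
qed

lemma not_indeterminateD:
  fixes f :: "'k::{field_char_0,field_gcd} \<Rightarrow> 'k \<Rightarrow> 'k"
  assumes "represents f N M" "\<not> indeterminate_at f a b"
  obtains N0 M0 where "represents f N0 M0" "eval2 N0 a b \<noteq> 0 \<or> eval2 M0 a b \<noteq> 0"
proof -
  have M: "M \<noteq> 0" using assms(1) by (simp add: represents_def)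
  define N0 M0 where "N0 = N div gcd N M" and "M0 = M div gcd N M"
  have e: "N = N0 * gcd N M" "M = M0 * gcd N M" by (simp_all add: N0_def M0_def)
  have co: "coprime N0 M0" unfolding N0_def M0_def using M by (intro div_gcd_coprime) simp
  have "M0 \<noteq> 0" using e M by auto
  have "N * M0 = N0 * M" using e by (metis mult.assoc mult.commute)
  then have r: "represents f N0 M0" using represents_cong[OF assms(1)] \<open>M0 \<noteq> 0\<close> by blast
  with assms(2) co that show ?thesis unfolding indeterminate_at_def by blast
qed

lemma dvd_PZ_iff:
  fixes N :: "'k::field_char_0 poly poly"
  shows "PZ dvd N \<longleftrightarrow> (\<forall>c. eval2 N c 0 = 0)"
proof
  assume "PZ dvd N"
  then obtain k where "N = PZ * k" by (elim dvdE)
  then have "eval2 N c 0 = eval2 PZ c 0 * eval2 k c 0" for c by simp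
  then show "\<forall>c. eval2 N c 0 = 0" by simp
next
  assume *: "\<forall>c. eval2 N c 0 = 0"
  have "map_poly (\<lambda>r. poly r 0) N = 0"
  proof -
    have "poly (map_poly (\<lambda>r. poly r 0) N) c = 0" for c
      using * by (simp add: eval2_ev ev_def map_poly_idI)
    then show ?thesis using poly_all_0_iff_0 by blast
  qed
  then have "poly (coeff N i) 0 = 0" for i
    by (metis coeff_0 coeff_map_poly poly_0)
  then have d: "[:0, 1:] dvd coeff N i" for i
    by (metis dvd_iff_poly_eq_0 minus_zero)
  show "PZ dvd N"
    by (simp add: PZ_def const_poly_dvd_iff d)
qed

section \<open>Charts of a function field with a derivation\<close>

lemma hadamard_add_mult:
  fixes N M :: "'a::comm_ring_1"
  assumes "N = n + A * R1 + B * R2" "M = m + A * S1 + B * S2"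
  shows "N + M = (n + m) + A * (R1 + S1) + B * (R2 + S2)"
    "N * M = n * m + A * (R1 * M + n * S1) + B * (R2 * M + n * S2)"
proof -
  show "N + M = (n + m) + A * (R1 + S1) + B * (R2 + S2)"
    unfolding assms by (simp add: algebra_simps)
  have "N * M = n * M + A * (R1 * M) + B * (R2 * M)"
    by (subst assms(1)) (simp add: algebra_simps)
  also have "n * M = n * m + A * (n * S1) + B * (n * S2)"
    by (subst assms(2)) (simp add: algebra_simps)
  finally show "N * M = n * m + A * (R1 * M + n * S1) + B * (R2 * M + n * S2)"
    by (simp add: algebra_simps)
qed

lemma poly2_hadamard:
  fixes N :: "'k::comm_ring_1 poly poly"
  shows "\<exists>R1 R2. N = PC (eval2 N a b) + (PY - PC a) * R1 + (PZ - PC b) * R2"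
proof (induction N rule: poly2_induct)
  case (const c)
  show ?case by (rule exI[of _ 0], rule exI[of _ 0]) simp
next
  case Y
  show ?case unfolding eval2_simps by (rule exI[of _ 1], rule exI[of _ 0]) simp
next
  case Z
  show ?case unfolding eval2_simps by (rule exI[of _ 0], rule exI[of _ 1]) simp
next
  case (add N M)
  then obtain R1 R2 S1 S2 where
    e: "N = PC (eval2 N a b) + (PY - PC a) * R1 + (PZ - PC b) * R2"
       "M = PC (eval2 M a b) + (PY - PC a) * S1 + (PZ - PC b) * S2" by blast
  have "PC (eval2 (N + M) a b) = PC (eval2 N a b) + PC (eval2 M a b)" by (simp add: PC_def)
  then have "N + M = PC (eval2 (N + M) a b) + (PY - PC a) * (R1 + S1) + (PZ - PC b) * (R2 + S2)"
    using hadamard_add_mult(1)[OF e] by metis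
  then show ?case by blast
next
  case (mult N M)
  then obtain R1 R2 S1 S2 where
    e: "N = PC (eval2 N a b) + (PY - PC a) * R1 + (PZ - PC b) * R2"
       "M = PC (eval2 M a b) + (PY - PC a) * S1 + (PZ - PC b) * S2" by blast
  have "PC (eval2 (N * M) a b) = PC (eval2 N a b) * PC (eval2 M a b)" by (simp add: PC_def)
  then have "N * M = PC (eval2 (N * M) a b) + (PY - PC a) * (R1 * M + PC (eval2 N a b) * S1)
      + (PZ - PC b) * (R2 * M + PC (eval2 N a b) * S2)"
    using hadamard_add_mult(2)[OF e] by metis
  then show ?case by blast
qed

lemma prime_elem_PZ: "prime_elem (PZ :: 'k::{field_char_0,field_gcd} poly poly)"
  unfolding PZ_def by (intro lift_prime_elem_poly prime_elem_linear_field_poly) simp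

lemma prime_elem_PY: "prime_elem (PY :: 'k::{field_char_0,field_gcd} poly poly)"
proof (rule prime_elemI)
  show "\<not> is_unit (PY :: 'k poly poly)"
  proof
    assume "is_unit (PY :: 'k poly poly)"
    then obtain k :: "'k poly poly" where "1 = PY * k" by (elim dvdE)
    from arg_cong[OF this, of "\<lambda>P. eval2 P 0 0"] show False by simp
  qed
  fix a b :: "'k poly poly"
  assume "PY dvd a * b"
  then have "poly (a * b) 0 = 0" unfolding PY_def by (metis dvd_iff_poly_eq_0 minus_zero)
  then have "poly a 0 = 0 \<or> poly b 0 = 0" by simp
  then show "PY dvd a \<or> PY dvd b" unfolding PY_def by (metis dvd_iff_poly_eq_0 minus_zero)
qed (simp add: PY_def)

locale function_field =
  fixes i :: "'k::{field_char_0,field_gcd} \<Rightarrow> 'l::field_char_0" and D :: "'l \<Rightarrow> 'l"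
    and d :: "'k \<Rightarrow> 'k" and x :: 'k
  assumes hom: "ring_hom1 i"
    and D_add: "D (f + g) = D f + D g"
    and D_mult: "D (f * g) = D f * g + f * D g"
    and D_i: "D (i c) = i (x * d c)"
    and x_nonzero: "x \<noteq> 0"
begin

lemma i_simps [simp]: "i 0 = 0" "i 1 = 1" "i (a + b) = i a + i b" "i (a * b) = i a * i b"
    "i (- a) = - i a" "i (a - b) = i a - i b"
  using hom ring_hom1_minus[OF hom] ring_hom1_diff[OF hom] by (auto simp: ring_hom1_def)

lemma i_power [simp]: "i (a ^ n) = i a ^ n"
  by (induction n) auto

lemma i_of_nat: "i (of_nat n) = of_nat n"
  by (induction n) auto

lemma i_numeral [simp]: "i (numeral n) = numeral n"
  using i_of_nat[of "numeral n"] by simp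

lemma i_eq_0 [simp]: "i a = 0 \<longleftrightarrow> a = 0"
proof
  assume "i a = 0"
  show "a = 0"
  proof (rule ccontr)
    assume "a \<noteq> 0"
    then have "i a * i (inverse a) = 1" unfolding i_simps(4)[symmetric] by simp
    with \<open>i a = 0\<close> show False by simp
  qed
qed simp

lemma i_inverse [simp]: "i (inverse a) = inverse (i a)"
proof (cases "a = 0")
  case False
  then have "i a * i (inverse a) = 1" unfolding i_simps(4)[symmetric] by simp
  then show ?thesis by (metis inverse_unique)
qed simp

lemma i_divide [simp]: "i (a / b) = i a / i b"
  by (simp add: divide_inverse)

lemma ev_i [simp]:
  "ev i (PC c) u v = i c" "ev i PY u v = u" "ev i PZ u v = v"
  "ev i 0 u v = 0" "ev i 1 u v = 1"
  "ev i (N + M) u v = ev i N u v + ev i M u v"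
  "ev i (N * M) u v = ev i N u v * ev i M u v"
  "ev i (N - M) u v = ev i N u v - ev i M u v"
  "ev i (- M) u v = - ev i M u v"
  "ev i (N ^ n) u v = ev i N u v ^ n"
  using ev_gens'[OF hom] ev_arith[OF hom] by auto

lemma D_0 [simp]: "D 0 = 0"
  using D_add[of 0 0] by simp

lemma D_1 [simp]: "D 1 = 0"
  using D_mult[of 1 1] by simp

lemma D_uminus: "D (- f) = - D f"
  using D_add[of "- f" f] by (simp add: eq_neg_iff_add_eq_0)

lemma D_diff: "D (f - g) = D f - D g"
  using D_add[of f "- g"] by (simp add: D_uminus)

lemma D_divide: "g \<noteq> 0 \<Longrightarrow> D (f / g) = (D f - f / g * D g) / g"
  using D_mult[of "f / g" g] by (simp add: eq_divide_eq)

lemma D_inverse: "g \<noteq> 0 \<Longrightarrow> D (1 / g) = - D g / g\<^sup>2"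
  using D_divide[of g 1] by (simp add: power2_eq_square)

lemma D_numeral [simp]: "D (numeral n) = 0"
proof -
  have "D (of_nat k) = 0" for k by (induction k) (simp_all add: D_add)
  from this[of "numeral n"] show ?thesis by simp
qed

lemma D_power2: "D (f\<^sup>2) = 2 * f * D f"
  by (simp add: power2_eq_square D_mult)

definition indep :: "'l \<Rightarrow> 'l \<Rightarrow> bool" where
  "indep U V \<longleftrightarrow> (\<forall>N. N \<noteq> 0 \<longrightarrow> ev i N U V \<noteq> 0)"

text \<open>The element \<open>g\<close> of the function field is the function \<open>f\<close> of the coordinates \<open>U, V\<close>.\<close>

definition rep :: "'l \<Rightarrow> 'l \<Rightarrow> ('k \<Rightarrow> 'k \<Rightarrow> 'k) \<Rightarrow> 'l \<Rightarrow> bool" where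
  "rep U V f g \<longleftrightarrow> (\<exists>N M. represents f N M \<and> g * ev i M U V = ev i N U V)"

definition realizes :: "'k system \<Rightarrow> 'l \<Rightarrow> 'l \<Rightarrow> bool" where
  "realizes S U V \<longleftrightarrow> indep U V \<and> rep U V (\<lambda>y z. fst (S y z)) (D U / i x) \<and>
     rep U V (\<lambda>y z. snd (S y z)) (D V / i x)"

text \<open>The element \<open>f\<close> is regular at the point \<open>(a,b)\<close> of the chart \<open>(U,V)\<close>, with value \<open>c\<close>.\<close>

definition val :: "'l \<Rightarrow> 'l \<Rightarrow> 'l \<Rightarrow> 'k \<Rightarrow> 'k \<Rightarrow> 'k \<Rightarrow> bool" where
  "val U V f a b c \<longleftrightarrow>
     (\<exists>N M. eval2 M a b \<noteq> 0 \<and> f * ev i M U V = ev i N U V \<and> eval2 N a b = c * eval2 M a b)"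

lemma val_poly: "val U V (ev i N U V) a b (eval2 N a b)"
  unfolding val_def by (rule exI[of _ N], rule exI[of _ 1]) simp

lemma val_const: "val U V (i c) a b c"
  using val_poly[of U V "PC c" a b] by simp

lemma val_fst: "val U V U a b a"
  using val_poly[of U V PY a b] by simp

lemma val_snd: "val U V V a b b"
  using val_poly[of U V PZ a b] by simp

lemma val_0: "val U V 0 a b 0" and val_1: "val U V 1 a b 1" and
  val_numeral: "val U V (numeral n) a b (numeral n)"
  using val_const[of U V 0 a b] val_const[of U V 1 a b] val_const[of U V "numeral n" a b] by auto

lemma val_add:
  assumes "val U V f a b c" "val U V g a b e"
  shows "val U V (f + g) a b (c + e)"
proof -
  obtain N M N' M' where *: "eval2 M a b \<noteq> 0" "f * ev i M U V = ev i N U V" "eval2 N a b = c * eval2 M a b"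
    "eval2 M' a b \<noteq> 0" "g * ev i M' U V = ev i N' U V" "eval2 N' a b = e * eval2 M' a b"
    using assms by (auto simp: val_def)
  show ?thesis
    unfolding val_def
    by (rule exI[of _ "N * M' + N' * M"], rule exI[of _ "M * M'"])
      (simp add: *(1,3,4,6) *(2,5)[symmetric] algebra_simps)
qed

lemma val_mult:
  assumes "val U V f a b c" "val U V g a b e"
  shows "val U V (f * g) a b (c * e)"
proof -
  obtain N M N' M' where *: "eval2 M a b \<noteq> 0" "f * ev i M U V = ev i N U V" "eval2 N a b = c * eval2 M a b"
    "eval2 M' a b \<noteq> 0" "g * ev i M' U V = ev i N' U V" "eval2 N' a b = e * eval2 M' a b"
    using assms by (auto simp: val_def)
  show ?thesis
    unfolding val_def
    by (rule exI[of _ "N * N'"], rule exI[of _ "M * M'"])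
      (simp add: *(1,3,4,6) *(2,5)[symmetric] algebra_simps)
qed

lemma val_uminus: "val U V f a b c \<Longrightarrow> val U V (- f) a b (- c)"
  using val_mult[OF val_const[of U V "-1" a b], of f c] by simp

lemma val_diff: "val U V f a b c \<Longrightarrow> val U V g a b e \<Longrightarrow> val U V (f - g) a b (c - e)"
  using val_add[of U V f a b c "- g" "- e"] val_uminus[of U V g a b e] by simp

lemma val_power: "val U V f a b c \<Longrightarrow> val U V (f ^ n) a b (c ^ n)"
  by (induction n) (simp_all add: val_1 val_mult)

lemma indep_D: "indep U V \<Longrightarrow> eval2 M a b \<noteq> 0 \<Longrightarrow> ev i M U V \<noteq> 0"
  unfolding indep_def by (drule spec[of _ M]) auto

lemma indep_cancel: "indep U V \<Longrightarrow> ev i N U V = ev i M U V \<Longrightarrow> N = M"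
  unfolding indep_def by (drule spec[of _ "N - M"]) auto

lemma indep_nonzero: "indep U V \<Longrightarrow> U \<noteq> 0" "indep U V \<Longrightarrow> V \<noteq> 0"
  using indep_D[of U V PY 1 0] indep_D[of U V PZ 0 1] by auto

lemma indep_diff_nonzero: "indep U V \<Longrightarrow> U - i a \<noteq> 0" "indep U V \<Longrightarrow> V - i b \<noteq> 0"
  using indep_D[of U V "PY - PC a" "a + 1" 0] indep_D[of U V "PZ - PC b" 0 "b + 1"]
  by auto

lemma val_unique:
  assumes "indep U V" "val U V f a b c" "val U V f a b c'"
  shows "c = c'"
proof -
  obtain N M N' M' where *: "eval2 M a b \<noteq> 0" "f * ev i M U V = ev i N U V" "eval2 N a b = c * eval2 M a b"
    "eval2 M' a b \<noteq> 0" "f * ev i M' U V = ev i N' U V" "eval2 N' a b = c' * eval2 M' a b"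
    using assms by (auto simp: val_def)
  have "ev i (N * M') U V = ev i (N' * M) U V"
    by (simp add: *(2,5)[symmetric] algebra_simps)
  then have "N * M' = N' * M" by (rule indep_cancel[OF assms(1)])
  then have "eval2 N a b * eval2 M' a b = eval2 N' a b * eval2 M a b" by (metis eval2_simps(7))
  then show ?thesis using * by simp
qed

lemma val_nonzero: "indep U V \<Longrightarrow> val U V f a b c \<Longrightarrow> c \<noteq> 0 \<Longrightarrow> f \<noteq> 0"
  using val_unique[of U V f a b c 0] val_0[of U V a b] by metis

lemma val_divide_nonzero:
  assumes "val U V f a b c" "val U V g a b e" "e \<noteq> 0" "g \<noteq> 0"
  shows "val U V (f / g) a b (c / e)"
proof -
  obtain N M where *: "eval2 M a b \<noteq> 0" "g * ev i M U V = ev i N U V" "eval2 N a b = e * eval2 M a b"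
    using assms by (auto simp: val_def)
  have "val U V (1 / g) a b (1 / e)"
    unfolding val_def using *(1,3) assms(3,4)
    by (intro exI[of _ M] exI[of _ N]) (simp add: *(2)[symmetric])
  from val_mult[OF assms(1) this] show ?thesis by simp
qed

lemma val_divide:
  "val U V f a b c \<Longrightarrow> val U V g a b e \<Longrightarrow> e \<noteq> 0 \<Longrightarrow> indep U V \<Longrightarrow> val U V (f / g) a b (c / e)"
  using val_divide_nonzero val_nonzero by metis

lemma val_cong: "val U V f a b c \<Longrightarrow> f = f' \<Longrightarrow> c = c' \<Longrightarrow> val U V f' a b c'"
  by simp

lemma val_ev:
  assumes "val U V X a b a'" "val U V X' a b b'"
  shows "val U V (ev i N X X') a b (eval2 N a' b')"
  by (induction N rule: poly2_induct)
    (simp_all only: ev_i eval2_simps eval2_gens' val_const assms val_add val_mult)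

lemma val_comp:
  assumes "indep U V" "val U V X a b a'" "val U V X' a b b'" "val X X' f a' b' c"
  shows "val U V f a b c"
proof -
  obtain N M where *: "eval2 M a' b' \<noteq> 0" "f * ev i M X X' = ev i N X X'" "eval2 N a' b' = c * eval2 M a' b'"
    using assms by (auto simp: val_def)
  have vM: "val U V (ev i M X X') a b (eval2 M a' b')" and vN: "val U V (ev i N X X') a b (eval2 N a' b')"
    using assms by (auto intro: val_ev)
  have "ev i M X X' \<noteq> 0" using val_nonzero[OF assms(1) vM] * by blast
  then have f: "ev i N X X' / ev i M X X' = f" using * by (simp add: field_simps)
  show ?thesis
    by (rule val_cong[OF val_divide[OF vN vM *(1) assms(1)]]) (use * f in simp_all)
qed

definition reg :: "'l \<Rightarrow> 'l \<Rightarrow> 'l \<Rightarrow> 'k \<Rightarrow> 'k \<Rightarrow> bool" where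
  "reg U V f a b \<longleftrightarrow> (\<exists>c. val U V f a b c)"

lemma regI: "val U V f a b c \<Longrightarrow> reg U V f a b"
  by (auto simp: reg_def)

lemma reg_add: "reg U V f a b \<Longrightarrow> reg U V g a b \<Longrightarrow> reg U V (f + g) a b"
  unfolding reg_def using val_add by blast

lemma reg_mult: "reg U V f a b \<Longrightarrow> reg U V g a b \<Longrightarrow> reg U V (f * g) a b"
  unfolding reg_def using val_mult by blast

lemma reg_diff: "reg U V f a b \<Longrightarrow> reg U V g a b \<Longrightarrow> reg U V (f - g) a b"
  unfolding reg_def using val_diff by blast

lemma reg_uminus: "reg U V f a b \<Longrightarrow> reg U V (- f) a b"
  unfolding reg_def using val_uminus by blast

lemma reg_power: "reg U V f a b \<Longrightarrow> reg U V (f ^ m) a b"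
  unfolding reg_def using val_power by blast

lemmas reg_intros = val_const[THEN regI] val_fst[THEN regI] val_snd[THEN regI] val_0[THEN regI]
  val_1[THEN regI] val_numeral[THEN regI] reg_add reg_mult reg_diff reg_uminus reg_power

lemma reg_divide:
  "reg U V f a b \<Longrightarrow> val U V g a b e \<Longrightarrow> e \<noteq> 0 \<Longrightarrow> indep U V \<Longrightarrow> reg U V (f / g) a b"
  unfolding reg_def using val_divide by blast

lemma reg_deriv:
  assumes "indep U V" "val U V X a b a'" "val U V X' a b b'" "reg X X' f a' b'"
    "reg U V (D X) a b" "reg U V (D X') a b"
  shows "reg U V (D f) a b"
proof -
  obtain c where c: "val X X' f a' b' c" using assms(4) by (auto simp: reg_def)
  obtain N M where *: "eval2 M a' b' \<noteq> 0" "f * ev i M X X' = ev i N X X'"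
    using c by (auto simp: val_def)
  have p: "reg U V (ev i R X X') a b" for R
    using val_ev[OF assms(2,3)] regI by blast
  have Dp: "reg U V (D (ev i R X X')) a b" for R
    by (induction R rule: poly2_induct)
      (simp_all only: ev_i assms D_i D_add D_mult reg_intros p)
  have f: "reg U V f a b" using val_comp[OF assms(1-3) c] regI by blast
  have vM: "val U V (ev i M X X') a b (eval2 M a' b')" by (rule val_ev[OF assms(2,3)])
  then have nz: "ev i M X X' \<noteq> 0" using val_nonzero[OF assms(1)] * by blast
  have "D f * ev i M X X' + f * D (ev i M X X') = D (ev i N X X')"
    using *(2) D_mult by metis
  then have "D f = (D (ev i N X X') - f * D (ev i M X X')) / ev i M X X'"
    using nz by (simp add: field_simps)
  then show ?thesis using reg_divide[OF _ vM *(1) assms(1)] reg_intros f Dp by simp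
qed

lemma val_hadamard:
  assumes "indep U V" "val U V f a b c"
  obtains g h g0 h0 where "val U V g a b g0" "val U V h a b h0"
    "f = i c + (U - i a) * g + (V - i b) * h"
proof -
  obtain N M where *: "eval2 M a b \<noteq> 0" "f * ev i M U V = ev i N U V" "eval2 N a b = c * eval2 M a b"
    using assms by (auto simp: val_def)
  define R where "R = N - PC c * M"
  have "eval2 R a b = 0" by (simp add: R_def *)
  then obtain R1 R2 where R: "R = (PY - PC a) * R1 + (PZ - PC b) * R2"
    using poly2_hadamard[of R a b] by (auto simp: PC_def)
  have nz: "ev i M U V \<noteq> 0" using indep_D assms(1) * by blast
  have "(f - i c) * ev i M U V = ev i R U V" by (simp add: R_def *(2)[symmetric] algebra_simps)
  also have "\<dots> = (U - i a) * ev i R1 U V + (V - i b) * ev i R2 U V" by (simp add: R)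
  finally have fe: "f - i c = ((U - i a) * ev i R1 U V + (V - i b) * ev i R2 U V) / ev i M U V"
    using nz by (simp add: field_simps)
  have "f = i c + (f - i c)" by simp
  then have "f = i c + (U - i a) * (ev i R1 U V / ev i M U V) + (V - i b) * (ev i R2 U V / ev i M U V)"
    unfolding fe by (simp add: add_divide_distrib)
  then show ?thesis
    using that val_divide[OF val_poly val_poly *(1) assms(1)] by blast
qed

lemma val_divide_snd:
  assumes "indep U V" "reg U V f a 0" "\<And>c. val U V f c 0 0"
  obtains g g0 where "val U V g a 0 g0" "f = V * g"
proof -
  obtain N M where *: "eval2 M a 0 \<noteq> 0" "f * ev i M U V = ev i N U V"
    using assms by (auto simp: val_def reg_def)
  have "eval2 N c 0 = 0" for c
  proof -
    have "val U V (f * ev i M U V) c 0 (0 * eval2 M c 0)" by (intro val_mult assms val_poly)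
    then have "val U V (ev i N U V) c 0 0" using *(2) by simp
    then show ?thesis using val_unique[OF assms(1) val_poly] by blast
  qed
  then have "PZ dvd N" by (simp add: dvd_PZ_iff)
  then obtain R where R: "N = PZ * R" by (elim dvdE)
  have nz: "ev i M U V \<noteq> 0" using indep_D assms(1) * by blast
  then have "f = V * (ev i R U V / ev i M U V)" using *(2) R by (simp add: field_simps)
  then show ?thesis using that val_divide[OF val_poly val_poly *(1) assms(1)] by blast
qed

subsection \<open>Base points and regularity\<close>

lemma rep_represents:
  assumes "indep U V" "rep U V f g" "g * ev i M U V = ev i N U V" "M \<noteq> 0"
  shows "represents f N M"
proof -
  obtain N' M' where *: "represents f N' M'" "g * ev i M' U V = ev i N' U V"
    using assms by (auto simp: rep_def)
  have "ev i (N' * M) U V = ev i (N * M') U V"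
    by (simp add: *(2)[symmetric] assms(3)[symmetric] algebra_simps)
  then have "N' * M = N * M'" by (rule indep_cancel[OF assms(1)])
  then show ?thesis using represents_cong * assms(4) by blast
qed

lemma represents_rep:
  assumes "indep U V" "rep U V f g" "represents f N M"
  shows "g * ev i M U V = ev i N U V"
proof -
  obtain N' M' where *: "represents f N' M'" "g * ev i M' U V = ev i N' U V"
    using assms by (auto simp: rep_def)
  have "M' \<noteq> 0" using * by (simp add: represents_def)
  then have nz: "ev i M' U V \<noteq> 0" using assms(1) by (auto simp: indep_def)
  have "N' * M = N * M'" using represents_cross * assms by blast
  then have "ev i N' U V * ev i M U V = ev i N U V * ev i M' U V" by (metis ev_i(7))
  then have "g * ev i M U V * ev i M' U V = ev i N U V * ev i M' U V"
    by (simp add: *(2)[symmetric] algebra_simps)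
  then show ?thesis using nz by simp
qed

lemma regular_at_iff:
  assumes "indep U V" "rep U V f g"
  shows "regular_at f a b \<longleftrightarrow> reg U V g a b"
proof
  assume "regular_at f a b"
  then obtain N M where *: "represents f N M" "eval2 M a b \<noteq> 0" by (auto simp: regular_at_def)
  show "reg U V g a b"
    unfolding reg_def val_def
    by (rule exI[of _ "eval2 N a b / eval2 M a b"], rule exI[of _ N], rule exI[of _ M])
      (use * represents_rep[OF assms *(1)] in simp)
next
  assume "reg U V g a b"
  then obtain N M where *: "eval2 M a b \<noteq> 0" "g * ev i M U V = ev i N U V"
    by (auto simp: val_def reg_def)
  then have "M \<noteq> 0" by auto
  then show "regular_at f a b"
    unfolding regular_at_def using rep_represents[OF assms] * by blast
qed

lemma not_indeterminate:
  assumes "indep U V" "rep U V f g" "val U V (g * h) a b c" "val U V h a b e" "h \<noteq> 0"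
    "c \<noteq> 0 \<or> e \<noteq> 0"
  shows "\<not> indeterminate_at f a b"
proof -
  obtain N M where *: "eval2 M a b \<noteq> 0" "g * h * ev i M U V = ev i N U V" "eval2 N a b = c * eval2 M a b"
    using assms by (auto simp: val_def)
  obtain N' M' where **: "eval2 M' a b \<noteq> 0" "h * ev i M' U V = ev i N' U V" "eval2 N' a b = e * eval2 M' a b"
    using assms by (auto simp: val_def)
  have nz: "ev i M U V \<noteq> 0" "ev i M' U V \<noteq> 0" using * ** indep_D assms(1) by blast+
  then have "ev i N' U V \<noteq> 0" using ** assms(5) by (metis mult_eq_0_iff)
  then have "N' * M \<noteq> 0" using * by auto
  moreover have "g * ev i (N' * M) U V = ev i (N * M') U V"
    by (simp add: *(2)[symmetric] **(2)[symmetric] algebra_simps)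
  ultimately have "represents f (N * M') (N' * M)"
    using rep_represents[OF assms(1,2)] by blast
  then show ?thesis using * ** assms(6) by (intro not_indeterminateI) auto
qed

lemma indeterminate:
  assumes "indep U V" "rep U V f g" "prime_elem \<pi>" "eval2 \<pi> a b = 0" "eval2 \<pi> a' b' = 0"
    "val U V (g * ev i \<pi> U V ^ k) a b 0" "val U V (g * ev i \<pi> U V ^ k) a' b' c" "c \<noteq> 0" "k > 0"
  shows "indeterminate_at f a b"
proof (rule ccontr)
  assume no: "\<not> indeterminate_at f a b"
  obtain N' M' where "represents f N' M'" using assms(2) by (auto simp: rep_def)
  then obtain N0 M0 where r: "represents f N0 M0" and nz: "eval2 N0 a b \<noteq> 0 \<or> eval2 M0 a b \<noteq> 0"
    using not_indeterminateD no by blast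
  note g = represents_rep[OF assms(1,2) r]
  have cross: "N * M0 = N0 * \<pi> ^ k * M" if "g * ev i \<pi> U V ^ k * ev i M U V = ev i N U V" for N M
  proof -
    have "ev i (N * M0) U V = ev i (N0 * \<pi> ^ k * M) U V"
      by (simp add: that[symmetric] g[symmetric] algebra_simps)
    then show ?thesis by (rule indep_cancel[OF assms(1)])
  qed
  obtain N M where *: "eval2 M a b \<noteq> 0" "g * ev i \<pi> U V ^ k * ev i M U V = ev i N U V" "eval2 N a b = 0"
    using assms(6) by (auto simp: val_def)
  obtain N2 M2 where **: "eval2 M2 a' b' \<noteq> 0" "g * ev i \<pi> U V ^ k * ev i M2 U V = ev i N2 U V"
      "eval2 N2 a' b' = c * eval2 M2 a' b'"
    using assms(7) by (auto simp: val_def)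
  have "eval2 N2 a' b' \<noteq> 0" using ** assms(8) by simp
  then have "\<not> \<pi> dvd N2" using assms(5) by (auto elim!: dvdE)
  then have "coprime (\<pi> ^ k) N2"
    using prime_elem_imp_coprime[OF assms(3)] by simp
  moreover have "\<pi> ^ k dvd N2 * M0" using cross[OF **(2)] by simp
  ultimately have "\<pi> ^ k dvd M0" using coprime_dvd_mult_right_iff by blast
  then obtain M1 where M1: "M0 = \<pi> ^ k * M1" by (elim dvdE)
  have "\<pi> ^ k \<noteq> 0" using assms(3) by auto
  moreover have "\<pi> ^ k * (N * M1) = \<pi> ^ k * (N0 * M)"
    using cross[OF *(2)] M1 by (simp add: algebra_simps)
  ultimately have "N * M1 = N0 * M" by (metis mult_cancel_left)
  then have "eval2 N a b * eval2 M1 a b = eval2 N0 a b * eval2 M a b" by (metis eval2_simps(7))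
  then have "eval2 N0 a b = 0" using * by simp
  moreover have "eval2 M0 a b = 0" using M1 assms(4,9) by simp
  ultimately show False using nz by simp
qed


lemma rep_quotient:
  assumes "g * ev i M U V = ev i N U V" "M \<noteq> 0"
    "generically (\<lambda>s t. f s t = eval2 N s t / eval2 M s t)"
  shows "rep U V f g"
  using assms unfolding rep_def represents_def by blast

lemma rep_ev: "rep U V (eval2 N) (ev i N U V)"
  by (rule rep_quotient[of _ 1 _ _ N]) (auto simp: generically_def intro: exI[of _ 1])

lemma rep_const: "rep U V (\<lambda>s t. c) (i c)" and rep_fst: "rep U V (\<lambda>s t. s) U"
  and rep_snd: "rep U V (\<lambda>s t. t) V"
proof -
  have "eval2 (PC c) = (\<lambda>s t. c)" "eval2 PY = (\<lambda>s t::'k. s)" "eval2 PZ = (\<lambda>s t::'k. t)"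
    by (intro ext, simp)+
  then show "rep U V (\<lambda>s t. c) (i c)" "rep U V (\<lambda>s t. s) U" "rep U V (\<lambda>s t. t) V"
    using rep_ev[of U V "PC c"] rep_ev[of U V PY] rep_ev[of U V PZ] by simp_all
qed

lemma rep_generic:
  assumes "rep U V f g"
  obtains N M where "M \<noteq> 0" "g * ev i M U V = ev i N U V"
    "generically (\<lambda>s t. f s t = eval2 N s t / eval2 M s t \<and> eval2 M s t \<noteq> 0)"
proof -
  obtain N M where *: "represents f N M" "g * ev i M U V = ev i N U V"
    using assms by (auto simp: rep_def)
  have "generically (\<lambda>s t. f s t = eval2 N s t / eval2 M s t \<and> eval2 M s t \<noteq> 0)"
    using *(1) unfolding represents_def by (intro generically_conj generically_nonzero) auto
  then show ?thesis using that * by (auto simp: represents_def)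
qed

lemma rep_add:
  assumes "rep U V f g" "rep U V f' g'"
  shows "rep U V (\<lambda>s t. f s t + f' s t) (g + g')"
proof -
  obtain N M where 1: "M \<noteq> 0" "g * ev i M U V = ev i N U V"
    "generically (\<lambda>s t. f s t = eval2 N s t / eval2 M s t \<and> eval2 M s t \<noteq> 0)"
    by (rule rep_generic[OF assms(1)])
  obtain N' M' where 2: "M' \<noteq> 0" "g' * ev i M' U V = ev i N' U V"
    "generically (\<lambda>s t. f' s t = eval2 N' s t / eval2 M' s t \<and> eval2 M' s t \<noteq> 0)"
    by (rule rep_generic[OF assms(2)])
  note * = 1 2
  show ?thesis
    by (rule rep_quotient[of _ "M * M'" _ _ "N * M' + N' * M"],
        simp add: *(2,5)[symmetric] algebra_simps, simp add: *(1,4),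
        rule generically_mono[OF generically_conj[OF *(3,6)]], elim conjE) (simp add: add_frac_eq)
qed

lemma rep_mult:
  assumes "rep U V f g" "rep U V f' g'"
  shows "rep U V (\<lambda>s t. f s t * f' s t) (g * g')"
proof -
  obtain N M where 1: "M \<noteq> 0" "g * ev i M U V = ev i N U V"
    "generically (\<lambda>s t. f s t = eval2 N s t / eval2 M s t \<and> eval2 M s t \<noteq> 0)"
    by (rule rep_generic[OF assms(1)])
  obtain N' M' where 2: "M' \<noteq> 0" "g' * ev i M' U V = ev i N' U V"
    "generically (\<lambda>s t. f' s t = eval2 N' s t / eval2 M' s t \<and> eval2 M' s t \<noteq> 0)"
    by (rule rep_generic[OF assms(2)])
  note * = 1 2
  show ?thesis
    by (rule rep_quotient[of _ "M * M'" _ _ "N * N'"],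
        simp add: *(2,5)[symmetric] algebra_simps, simp add: *(1,4),
        rule generically_mono[OF generically_conj[OF *(3,6)]], elim conjE) (simp add: add_frac_eq)
qed

lemma rep_uminus: "rep U V f g \<Longrightarrow> rep U V (\<lambda>s t. - f s t) (- g)"
  using rep_mult[OF rep_const[of U V "-1"], of f g] by simp

lemma rep_diff: "rep U V f g \<Longrightarrow> rep U V f' g' \<Longrightarrow> rep U V (\<lambda>s t. f s t - f' s t) (g - g')"
  using rep_add[of U V f g "\<lambda>s t. - f' s t" "- g'"] rep_uminus[of U V f' g'] by simp

lemma rep_power: "rep U V f g \<Longrightarrow> rep U V (\<lambda>s t. f s t ^ n) (g ^ n)"
proof (induction n)
  case 0
  then show ?case using rep_const[of U V 1] by simp
next
  case (Suc n)
  then show ?case using rep_mult[of U V f g "\<lambda>s t. f s t ^ n" "g ^ n"] by simp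
qed

lemma rep_divide:
  assumes "rep U V f g" "rep U V f' g'" "g' \<noteq> 0" "indep U V"
  shows "rep U V (\<lambda>s t. f s t / f' s t) (g / g')"
proof -
  obtain N M where 1: "M \<noteq> 0" "g * ev i M U V = ev i N U V"
    "generically (\<lambda>s t. f s t = eval2 N s t / eval2 M s t \<and> eval2 M s t \<noteq> 0)"
    by (rule rep_generic[OF assms(1)])
  obtain N' M' where 2: "M' \<noteq> 0" "g' * ev i M' U V = ev i N' U V"
    "generically (\<lambda>s t. f' s t = eval2 N' s t / eval2 M' s t \<and> eval2 M' s t \<noteq> 0)"
    by (rule rep_generic[OF assms(2)])
  note * = 1 2
  have "ev i M' U V \<noteq> 0" using *(4) assms(4) by (auto simp: indep_def)
  then have "ev i N' U V \<noteq> 0" using *(5) assms(3) by (metis mult_eq_0_iff)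
  then have "N' \<noteq> 0" by auto
  show ?thesis
    by (rule rep_quotient[of _ "M * N'" _ _ "N * M'"],
        use assms(3) in \<open>simp add: *(2,5)[symmetric] algebra_simps\<close>,
        simp add: *(1) \<open>N' \<noteq> 0\<close>,
        rule generically_mono[OF generically_conj[OF generically_conj[OF *(3,6)]
          generically_nonzero[OF \<open>N' \<noteq> 0\<close>]]], elim conjE) simp
qed

lemma homogenize:
  "\<exists>n H. (\<forall>s t. eval2 W s t \<noteq> 0 \<longrightarrow>
       eval2 H s t = eval2 N (eval2 X s t / eval2 W s t) (eval2 X' s t / eval2 W s t) * eval2 W s t ^ n) \<and>
     (\<forall>u v. ev i W u v \<noteq> 0 \<longrightarrow>
       ev i H u v = ev i N (ev i X u v / ev i W u v) (ev i X' u v / ev i W u v) * ev i W u v ^ n)"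
proof (induction N rule: poly2_induct)
  case (const c)
  show ?case by (rule exI[of _ 0], rule exI[of _ "PC c"]) simp
next
  case Y
  show ?case by (rule exI[of _ 1], rule exI[of _ X]) simp
next
  case Z
  show ?case by (rule exI[of _ 1], rule exI[of _ X']) simp
next
  case (add N M)
  then obtain n H m K where
    *: "\<forall>s t. eval2 W s t \<noteq> 0 \<longrightarrow>
       eval2 H s t = eval2 N (eval2 X s t / eval2 W s t) (eval2 X' s t / eval2 W s t) * eval2 W s t ^ n"
      "\<forall>u v. ev i W u v \<noteq> 0 \<longrightarrow>
       ev i H u v = ev i N (ev i X u v / ev i W u v) (ev i X' u v / ev i W u v) * ev i W u v ^ n"
      "\<forall>s t. eval2 W s t \<noteq> 0 \<longrightarrow>
       eval2 K s t = eval2 M (eval2 X s t / eval2 W s t) (eval2 X' s t / eval2 W s t) * eval2 W s t ^ m"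
      "\<forall>u v. ev i W u v \<noteq> 0 \<longrightarrow>
       ev i K u v = ev i M (ev i X u v / ev i W u v) (ev i X' u v / ev i W u v) * ev i W u v ^ m"
    by blast
  show ?case
    by (rule exI[of _ "n + m"], rule exI[of _ "H * W ^ m + K * W ^ n"])
      (simp add: * algebra_simps power_add)
next
  case (mult N M)
  then obtain n H m K where
    *: "\<forall>s t. eval2 W s t \<noteq> 0 \<longrightarrow>
       eval2 H s t = eval2 N (eval2 X s t / eval2 W s t) (eval2 X' s t / eval2 W s t) * eval2 W s t ^ n"
      "\<forall>u v. ev i W u v \<noteq> 0 \<longrightarrow>
       ev i H u v = ev i N (ev i X u v / ev i W u v) (ev i X' u v / ev i W u v) * ev i W u v ^ n"
      "\<forall>s t. eval2 W s t \<noteq> 0 \<longrightarrow>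
       eval2 K s t = eval2 M (eval2 X s t / eval2 W s t) (eval2 X' s t / eval2 W s t) * eval2 W s t ^ m"
      "\<forall>u v. ev i W u v \<noteq> 0 \<longrightarrow>
       ev i K u v = ev i M (ev i X u v / ev i W u v) (ev i X' u v / ev i W u v) * ev i W u v ^ m"
    by blast
  show ?case
    by (rule exI[of _ "n + m"], rule exI[of _ "H * K"]) (simp add: * algebra_simps power_add)
qed

lemma rep_compose:
  assumes UV: "indep U V" and uv: "indep u v"
    and p: "rep u v p U" and r: "rep u v r V" and f: "rep U V f g"
  shows "rep u v (\<lambda>s t. f (p s t) (r s t)) g"
proof -
  obtain X0 W0 where 1: "W0 \<noteq> 0" "U * ev i W0 u v = ev i X0 u v"
    "generically (\<lambda>s t. p s t = eval2 X0 s t / eval2 W0 s t \<and> eval2 W0 s t \<noteq> 0)"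
    by (rule rep_generic[OF p])
  obtain X1 W1 where 2: "W1 \<noteq> 0" "V * ev i W1 u v = ev i X1 u v"
    "generically (\<lambda>s t. r s t = eval2 X1 s t / eval2 W1 s t \<and> eval2 W1 s t \<noteq> 0)"
    by (rule rep_generic[OF r])
  note pr = 1 2
  obtain N M where f': "M \<noteq> 0" "g * ev i M U V = ev i N U V"
    "generically (\<lambda>s t. f s t = eval2 N s t / eval2 M s t \<and> eval2 M s t \<noteq> 0)"
    by (rule rep_generic[OF f])
  obtain E where E: "E \<noteq> 0"
    "\<And>s t. eval2 E s t \<noteq> 0 \<Longrightarrow> f s t = eval2 N s t / eval2 M s t \<and> eval2 M s t \<noteq> 0"
    using f'(3) unfolding generically_def by blast
  define X X' W where "X = X0 * W1" and "X' = X1 * W0" and "W = W0 * W1"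
  have W: "W \<noteq> 0" using pr by (simp add: W_def)
  have Wn: "ev i W u v \<noteq> 0" using W uv by (auto simp: indep_def)
  then have U: "ev i X u v / ev i W u v = U" and V: "ev i X' u v / ev i W u v = V"
    by (auto simp: X_def X'_def W_def pr(2,5)[symmetric] field_simps)
  obtain n N' where N': "\<And>s t. eval2 W s t \<noteq> 0 \<Longrightarrow>
       eval2 N' s t = eval2 N (eval2 X s t / eval2 W s t) (eval2 X' s t / eval2 W s t) * eval2 W s t ^ n"
     "ev i N' u v = ev i N U V * ev i W u v ^ n"
    using homogenize[of W N X X'] Wn U V by metis
  obtain m M' where M': "\<And>s t. eval2 W s t \<noteq> 0 \<Longrightarrow>
       eval2 M' s t = eval2 M (eval2 X s t / eval2 W s t) (eval2 X' s t / eval2 W s t) * eval2 W s t ^ m"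
     "ev i M' u v = ev i M U V * ev i W u v ^ m"
    using homogenize[of W M X X'] Wn U V by metis
  obtain k E' where E': "\<And>s t. eval2 W s t \<noteq> 0 \<Longrightarrow>
       eval2 E' s t = eval2 E (eval2 X s t / eval2 W s t) (eval2 X' s t / eval2 W s t) * eval2 W s t ^ k"
     "ev i E' u v = ev i E U V * ev i W u v ^ k"
    using homogenize[of W E X X'] Wn U V by metis
  have "ev i M' u v \<noteq> 0" "ev i E' u v \<noteq> 0"
    using M'(2) E'(2) Wn UV f'(1) E(1) by (auto simp: indep_def)
  then have nz: "M' \<noteq> 0" "E' \<noteq> 0" by auto
  show ?thesis
  proof (rule rep_quotient[of _ "M' * W ^ n" _ _ "N' * W ^ m"])
    show "g * ev i (M' * W ^ n) u v = ev i (N' * W ^ m) u v"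
      by (simp add: M'(2) N'(2) f'(2)[symmetric] algebra_simps)
    show "M' * W ^ n \<noteq> 0" using nz W by simp
    have "generically (\<lambda>s t. ((p s t = eval2 X0 s t / eval2 W0 s t \<and> eval2 W0 s t \<noteq> 0) \<and>
       (r s t = eval2 X1 s t / eval2 W1 s t \<and> eval2 W1 s t \<noteq> 0)) \<and> eval2 E' s t \<noteq> 0)"
      by (rule generically_conj[OF generically_conj[OF pr(3,6)] generically_nonzero[OF nz(2)]])
    then show "generically (\<lambda>s t. f (p s t) (r s t) = eval2 (N' * W ^ m) s t / eval2 (M' * W ^ n) s t)"
    proof (rule generically_mono)
      fix s t
      assume a: "((p s t = eval2 X0 s t / eval2 W0 s t \<and> eval2 W0 s t \<noteq> 0) \<and>
       (r s t = eval2 X1 s t / eval2 W1 s t \<and> eval2 W1 s t \<noteq> 0)) \<and> eval2 E' s t \<noteq> 0"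
      then have Ws: "eval2 W s t \<noteq> 0" by (simp add: W_def)
      have ps: "eval2 X s t / eval2 W s t = p s t" "eval2 X' s t / eval2 W s t = r s t"
        using a by (auto simp: X_def X'_def W_def)
      have "eval2 E (p s t) (r s t) \<noteq> 0" using a E'(1)[OF Ws] ps by auto
      from E(2)[OF this] show "f (p s t) (r s t) = eval2 (N' * W ^ m) s t / eval2 (M' * W ^ n) s t"
        using Ws N'(1)[OF Ws] M'(1)[OF Ws] ps by (simp add: field_simps)
    qed
  qed
qed

lemma indep_change:
  assumes UV: "indep U V" and pu: "rep U V pu u" and pv: "rep U V pv v"
    and "B \<noteq> 0" "W \<noteq> 0"
    and 1: "\<And>y z. eval2 B y z \<noteq> 0 \<Longrightarrow> eval2 W (pu y z) (pv y z) \<noteq> 0 \<and>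
        eval2 X (pu y z) (pv y z) / eval2 W (pu y z) (pv y z) = y \<and>
        eval2 X' (pu y z) (pv y z) / eval2 W (pu y z) (pv y z) = z"
    and 2: "\<And>s t. eval2 W s t \<noteq> 0 \<Longrightarrow> pu (eval2 X s t / eval2 W s t) (eval2 X' s t / eval2 W s t) = s \<and>
        pv (eval2 X s t / eval2 W s t) (eval2 X' s t / eval2 W s t) = t"
  shows "indep u v"
  unfolding indep_def
proof (intro allI impI notI)
  fix N :: "'k poly poly"
  assume "N \<noteq> 0" and z: "ev i N u v = 0"
  have r0: "rep U V (\<lambda>y z. eval2 N (pu y z) (pv y z)) (ev i N u v)"
    by (induction N rule: poly2_induct)
      (simp_all add: rep_const pu pv rep_add rep_mult)
  obtain N0 M0 where *: "M0 \<noteq> 0" "0 * ev i M0 U V = ev i N0 U V"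
    "generically (\<lambda>y z. eval2 N (pu y z) (pv y z) = eval2 N0 y z / eval2 M0 y z \<and> eval2 M0 y z \<noteq> 0)"
    by (rule rep_generic[OF r0[unfolded z]])
  then have "N0 = 0" using UV by (auto simp: indep_def)
  then obtain E where E: "E \<noteq> 0" "\<And>y z. eval2 E y z \<noteq> 0 \<Longrightarrow> eval2 N (pu y z) (pv y z) = 0"
    using *(3) unfolding generically_def by auto
  obtain n H where H: "\<And>s t. eval2 W s t \<noteq> 0 \<Longrightarrow>
     eval2 H s t = eval2 E (eval2 X s t / eval2 W s t) (eval2 X' s t / eval2 W s t) * eval2 W s t ^ n"
    using homogenize[of W E X X'] by metis
  obtain y0 z0 where "eval2 (E * B) y0 z0 \<noteq> 0"
    using eval2_nonzero_point E(1) assms(4) by (metis mult_eq_0_iff)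
  then have "eval2 H (pu y0 z0) (pv y0 z0) \<noteq> 0"
    using 1[of y0 z0] H[of "pu y0 z0" "pv y0 z0"] by auto
  then have "H \<noteq> 0" by auto
  then obtain s t where st: "eval2 (N * H * W) s t \<noteq> 0"
    using eval2_nonzero_point \<open>N \<noteq> 0\<close> assms(5) by (metis mult_eq_0_iff)
  then have "eval2 E (eval2 X s t / eval2 W s t) (eval2 X' s t / eval2 W s t) \<noteq> 0"
    using H[of s t] by auto
  from E(2)[OF this] show False using 2[of s t] st by auto
qed

lemma nonzero_PY [simp]: "PY \<noteq> (0 :: 'k poly poly)"
  by (simp add: PY_def)

lemma nonzero_PZ [simp]: "PZ \<noteq> (0 :: 'k poly poly)"
  by (simp add: PZ_def)

lemma PY_PZ_neq_PC [simp]: "PY \<noteq> (PC a :: 'k poly poly)" "PZ \<noteq> (PC a :: 'k poly poly)"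
  by (simp_all add: PY_def PZ_def PC_def)

lemmas rep_intros = rep_const rep_fst rep_snd rep_add rep_mult rep_diff rep_uminus rep_power

lemma realizes_blowup_UV:
  assumes "realizes S U V"
  shows "realizes (blowup_UV d S a b) ((U - i a) / (V - i b)) (V - i b)"
proof -
  have UV: "indep U V" and f: "rep U V (\<lambda>y z. fst (S y z)) (D U / i x)"
    and g: "rep U V (\<lambda>y z. snd (S y z)) (D V / i x)"
    using assms by (auto simp: realizes_def)
  define u v where "u = (U - i a) / (V - i b)" and "v = V - i b"
  have v: "v \<noteq> 0" using indep_diff_nonzero[OF UV] by (simp add: v_def)
  have pu: "rep U V (\<lambda>y z. (y - a) / (z - b)) u" and pv: "rep U V (\<lambda>y z. z - b) v"
    unfolding u_def v_def using UV v[unfolded v_def] by (intro rep_intros rep_divide; simp)+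
  have uv: "indep u v"
    by (rule indep_change[OF UV pu pv, of "PZ - PC b" PZ "(PC a + PY * PZ) * PZ" "(PC b + PZ) * PZ"]) auto
  have U: "U = i a + u * v" and V: "V = i b + v" using v by (auto simp: u_def v_def)
  have p: "rep u v (\<lambda>s t. a + s * t) U" and r: "rep u v (\<lambda>s t. b + t) V"
    unfolding U V by (intro rep_intros)+
  note c = rep_compose[OF UV uv p r]
  have "D v = D V - i (x * d b)" by (simp add: v_def D_diff D_i)
  then have Dv: "D v / i x = D V / i x - i (d b)" using x_nonzero by (simp add: field_simps)
  have hD: "D u = (D U - i (x * d a) - u * D v) / v"
    using D_divide[OF v[unfolded v_def], of "U - i a"] by (simp add: u_def v_def D_diff D_i)
  have Du: "D u / i x = (D U / i x - i (d a) - u * (D v / i x)) / v"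
    unfolding hD using x_nonzero v by (simp add: field_simps)
  have "rep u v (\<lambda>s t. (fst (S (a + s * t) (b + t)) - d a - s * (snd (S (a + s * t) (b + t)) - d b)) / t)
     (D u / i x)"
    unfolding Du Dv by (intro rep_intros rep_divide c f g v uv)
  moreover have "rep u v (\<lambda>s t. snd (S (a + s * t) (b + t)) - d b) (D v / i x)"
    unfolding Dv by (intro rep_intros c g)
  ultimately have "realizes (blowup_UV d S a b) u v"
    unfolding realizes_def using uv by (simp add: blowup_UV_def case_prod_beta Let_def)
  then show ?thesis by (simp only: u_def v_def)
qed

lemma realizes_blowup_uv:
  assumes "realizes S U V"
  shows "realizes (blowup_uv d S a b) (U - i a) ((V - i b) / (U - i a))"
proof -
  have UV: "indep U V" and f: "rep U V (\<lambda>y z. fst (S y z)) (D U / i x)"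
    and g: "rep U V (\<lambda>y z. snd (S y z)) (D V / i x)"
    using assms by (auto simp: realizes_def)
  define u v where "u = U - i a" and "v = (V - i b) / (U - i a)"
  have u: "u \<noteq> 0" using indep_diff_nonzero[OF UV] by (simp add: u_def)
  have pu: "rep U V (\<lambda>y z. y - a) u" and pv: "rep U V (\<lambda>y z. (z - b) / (y - a)) v"
    unfolding u_def v_def using UV u[unfolded u_def] by (intro rep_intros rep_divide; simp)+
  have uv: "indep u v"
    by (rule indep_change[OF UV pu pv, of "PY - PC a" PY "(PC a + PY) * PY" "(PC b + PY * PZ) * PY"]) auto
  have U: "U = i a + u" and V: "V = i b + u * v" using u by (auto simp: u_def v_def)
  have p: "rep u v (\<lambda>s t. a + s) U" and r: "rep u v (\<lambda>s t. b + s * t) V"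
    unfolding U V by (intro rep_intros)+
  note c = rep_compose[OF UV uv p r]
  have "D u = D U - i (x * d a)" by (simp add: u_def D_diff D_i)
  then have Du: "D u / i x = D U / i x - i (d a)" using x_nonzero by (simp add: field_simps)
  have hD: "D v = (D V - i (x * d b) - v * D u) / u"
    using D_divide[OF u[unfolded u_def], of "V - i b"] by (simp add: u_def v_def D_diff D_i)
  have Dv: "D v / i x = (D V / i x - i (d b) - v * (D u / i x)) / u"
    unfolding hD using x_nonzero u by (simp add: field_simps)
  have "rep u v (\<lambda>s t. (snd (S (a + s) (b + s * t)) - d b - t * (fst (S (a + s) (b + s * t)) - d a)) / s)
     (D v / i x)"
    unfolding Du Dv by (intro rep_intros rep_divide c f g u uv)
  moreover have "rep u v (\<lambda>s t. fst (S (a + s) (b + s * t)) - d a) (D u / i x)"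
    unfolding Du by (intro rep_intros c f)
  ultimately have "realizes (blowup_uv d S a b) u v"
    unfolding realizes_def using uv by (simp add: blowup_uv_def case_prod_beta Let_def)
  then show ?thesis by (simp only: u_def v_def)
qed

lemma realizes_chart_uv:
  assumes "realizes S Y Z"
  shows "realizes (chart_uv S) (1 / Y) (Z / Y)"
proof -
  have UV: "indep Y Z" and f: "rep Y Z (\<lambda>y z. fst (S y z)) (D Y / i x)"
    and g: "rep Y Z (\<lambda>y z. snd (S y z)) (D Z / i x)"
    using assms by (auto simp: realizes_def)
  define u v where "u = 1 / Y" and "v = Z / Y"
  have Y: "Y \<noteq> 0" using indep_nonzero[OF UV] by simp
  then have u: "u \<noteq> 0" by (simp add: u_def)
  have pu: "rep Y Z (\<lambda>y z. 1 / y) u" and pv: "rep Y Z (\<lambda>y z. z / y) v"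
    unfolding u_def v_def using UV Y rep_const[of _ _ 1] by (intro rep_intros rep_divide; simp)+
  have uv: "indep u v"
    by (rule indep_change[OF UV pu pv, of PY PY 1 PZ]) auto
  have Yu: "Y = 1 / u" and Zu: "Z = v / u" using Y by (auto simp: u_def v_def)
  have p: "rep u v (\<lambda>s t. 1 / s) Y" and r: "rep u v (\<lambda>s t. t / s) Z"
    unfolding Yu Zu using rep_const[of _ _ 1] uv u by (intro rep_intros rep_divide; simp)+
  note c = rep_compose[OF UV uv p r]
  have Du: "D u / i x = - (u\<^sup>2 * (D Y / i x))"
    by (simp add: u_def D_inverse[OF Y] power_divide)
  have Dv: "D v / i x = u * (D Z / i x) - u * v * (D Y / i x)"
    using Y x_nonzero by (simp add: u_def v_def D_divide[OF Y, of Z] field_simps)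
  have "rep u v (\<lambda>s t. - (s\<^sup>2 * fst (S (1 / s) (t / s)))) (D u / i x)"
    unfolding Du by (intro rep_intros c f)
  moreover have "rep u v (\<lambda>s t. s * snd (S (1 / s) (t / s)) - s * t * fst (S (1 / s) (t / s))) (D v / i x)"
    unfolding Dv by (intro rep_intros c f g)
  ultimately have "realizes (chart_uv S) u v"
    unfolding realizes_def using uv by (simp add: chart_uv_def case_prod_beta Let_def)
  then show ?thesis by (simp only: u_def v_def)
qed

lemma realizes_chart_UV:
  assumes "realizes S Y Z"
  shows "realizes (chart_UV S) (Y / Z) (1 / Z)"
proof -
  have UV: "indep Y Z" and f: "rep Y Z (\<lambda>y z. fst (S y z)) (D Y / i x)"
    and g: "rep Y Z (\<lambda>y z. snd (S y z)) (D Z / i x)"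
    using assms by (auto simp: realizes_def)
  define u v where "u = Y / Z" and "v = 1 / Z"
  have Z: "Z \<noteq> 0" using indep_nonzero[OF UV] by simp
  then have v: "v \<noteq> 0" by (simp add: v_def)
  have pu: "rep Y Z (\<lambda>y z. y / z) u" and pv: "rep Y Z (\<lambda>y z. 1 / z) v"
    unfolding u_def v_def using UV Z rep_const[of _ _ 1] by (intro rep_intros rep_divide; simp)+
  have uv: "indep u v"
    by (rule indep_change[OF UV pu pv, of PZ PZ PY 1]) auto
  have Yu: "Y = u / v" and Zu: "Z = 1 / v" using Z by (auto simp: u_def v_def)
  have p: "rep u v (\<lambda>s t. s / t) Y" and r: "rep u v (\<lambda>s t. 1 / t) Z"
    unfolding Yu Zu using rep_const[of _ _ 1] uv v by (intro rep_intros rep_divide; simp)+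
  note c = rep_compose[OF UV uv p r]
  have Dv: "D v / i x = - (v\<^sup>2 * (D Z / i x))"
    by (simp add: v_def D_inverse[OF Z] power_divide)
  have Du: "D u / i x = v * (D Y / i x) - u * v * (D Z / i x)"
    using Z x_nonzero by (simp add: u_def v_def D_divide[OF Z, of Y] field_simps)
  have "rep u v (\<lambda>s t. - (t\<^sup>2 * snd (S (s / t) (1 / t)))) (D v / i x)"
    unfolding Dv by (intro rep_intros c g)
  moreover have "rep u v (\<lambda>s t. t * fst (S (s / t) (1 / t)) - s * t * snd (S (s / t) (1 / t))) (D u / i x)"
    unfolding Du by (intro rep_intros c f g)
  ultimately have "realizes (chart_UV S) u v"
    unfolding realizes_def using uv by (simp add: chart_UV_def case_prod_beta Let_def)
  then show ?thesis by (simp only: u_def v_def)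
qed

end

lemma cascades_regular_intro:
  assumes "\<And>c. base_point (blowup_UV d S a b) c 0 \<Longrightarrow> cascades_regular d (blowup_UV d S a b) c 0"
    "base_point (blowup_uv d S a b) 0 0 \<Longrightarrow> cascades_regular d (blowup_uv d S a b) 0 0"
    "(\<exists>c. base_point (blowup_UV d S a b) c 0) \<or> base_point (blowup_uv d S a b) 0 0 \<or>
      (\<forall>c. regular_system_at (blowup_uv d S a b) 0 c) \<or> (\<forall>c. regular_system_at (blowup_UV d S a b) c 0)"
  shows "cascades_regular d S a b"
  by (rule cascades_regular.intros) (use assms in blast)+

context function_field
begin

lemma D_quotient: "f = g * k \<Longrightarrow> D g * k = D f - g * D k"
  by (simp add: D_mult)

lemma val_scaled:
  "val U V (D f * k) a b c \<Longrightarrow> val U V (D f / i x * k) a b (c / x)"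
  using val_mult[OF val_const[of U V "1 / x" a b], of "D f * k" c]
  by (simp add: mult.assoc[symmetric])

lemma reg_scaled: "reg U V (D f / i x) a b \<longleftrightarrow> reg U V (D f) a b"
proof
  assume "reg U V (D f / i x) a b"
  from reg_mult[OF this regI[OF val_const[of U V x]]] show "reg U V (D f) a b"
    using x_nonzero by simp
next
  assume "reg U V (D f) a b"
  from reg_mult[OF this regI[OF val_const[of U V "1 / x"]]] show "reg U V (D f / i x) a b"
    by simp
qed

lemma no_base_fst:
  assumes "realizes S U V" "val U V (D U * k) a b c" "val U V k a b e" "k \<noteq> 0" "c \<noteq> 0 \<or> e \<noteq> 0"
  shows "\<not> indeterminate_at (\<lambda>y z. fst (S y z)) a b"
  by (rule not_indeterminate[OF _ _ val_scaled[OF assms(2)] assms(3,4)])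
    (use assms x_nonzero in \<open>auto simp: realizes_def\<close>)

lemma no_base_snd:
  assumes "realizes S U V" "val U V (D V * k) a b c" "val U V k a b e" "k \<noteq> 0" "c \<noteq> 0 \<or> e \<noteq> 0"
  shows "\<not> indeterminate_at (\<lambda>y z. snd (S y z)) a b"
  by (rule not_indeterminate[OF _ _ val_scaled[OF assms(2)] assms(3,4)])
    (use assms x_nonzero in \<open>auto simp: realizes_def\<close>)

lemma no_base_pointI:
  assumes "realizes S U V" "val U V (D U * k) a b c" "val U V k a b e" "k \<noteq> 0" "c \<noteq> 0 \<or> e \<noteq> 0"
    "val U V (D V * k') a b c'" "val U V k' a b e'" "k' \<noteq> 0" "c' \<noteq> 0 \<or> e' \<noteq> 0"
  shows "\<not> base_point S a b"
  using no_base_fst[OF assms(1-5)] no_base_snd[OF assms(1) assms(6-9)] by (simp add: base_point_def)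

lemma regular_system_at_iff:
  "realizes S U V \<Longrightarrow> regular_system_at S a b \<longleftrightarrow> reg U V (D U) a b \<and> reg U V (D V) a b"
  using regular_at_iff reg_scaled by (auto simp: realizes_def regular_system_at_def)

lemma regular_no_base_point:
  assumes "realizes S U V" "reg U V (D U) a b" "reg U V (D V) a b"
  shows "\<not> base_point S a b"
proof -
  obtain c c' where "val U V (D U) a b c" "val U V (D V) a b c'"
    using assms by (auto simp: reg_def)
  then show ?thesis
    using no_base_pointI[OF assms(1), of 1 a b c 1 1 c' 1] val_1 by simp
qed

lemma base_point_snd_pole:
  assumes "realizes S U V" "val U V (D U * V ^ k) a 0 0" "val U V (D U * V ^ k) a' 0 c" "c \<noteq> 0" "k > 0"
  shows "base_point S a 0"
  unfolding base_point_def
  using assms x_nonzero val_scaled[OF assms(2)] val_scaled[OF assms(3)]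
  by (intro disjI1 indeterminate[of U V _ "D U / i x" PZ a 0 a' 0 k "c / x"])
    (auto simp: realizes_def prime_elem_PZ)

lemma base_point_fst_pole:
  assumes "realizes S U V" "val U V (D V * U) 0 0 0" "val U V (D V * U) 0 a' c" "c \<noteq> 0"
  shows "base_point S 0 0"
  unfolding base_point_def
  using assms x_nonzero val_scaled[OF assms(2)] val_scaled[OF assms(3)]
  by (intro disjI2 indeterminate[of U V _ "D V / i x" PY 0 0 0 a' 1 "c / x"])
    (auto simp: realizes_def prime_elem_PY)

lemma not_reg_pole:
  assumes "indep U V" "val U V (f * k) a b c" "val U V k a b 0" "c \<noteq> 0"
  shows "\<not> reg U V f a b"
proof
  assume "reg U V f a b"
  then obtain e where "val U V f a b e" by (auto simp: reg_def)
  then have "val U V (f * k) a b (e * 0)" by (intro val_mult assms)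
  with assms show False using val_unique[OF assms(1)] by fastforce
qed

lemmas val_intros = val_const val_fst val_snd val_0 val_1 val_numeral val_add val_diff val_mult
  val_uminus val_power

lemma val_eq: "val U V f a b c \<Longrightarrow> c = c' \<Longrightarrow> val U V f a b c'"
  by simp

lemma blowup_UV_val:
  assumes "indep U V" "U = i a + u * v" "V = i b + v"
  shows "val u v U c 0 a" "val u v V c 0 b"
  unfolding assms(2,3) by (rule val_eq, (rule val_intros)+, simp_all)+

text \<open>Near the point \<open>(a,0)\<close> let \<open>V U' = \<nu> (U - a) + O(V)\<close> and \<open>V' = \<mu> + \<dots>\<close>.  A blow-up
  replaces \<open>\<nu>\<close> by \<open>\<nu> - \<mu>\<close>, so that a cascade ends with the resonant case \<open>\<nu> = \<mu>\<close>.\<close>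

lemma nonresonant_blowup:
  assumes S: "realizes S U V" and f: "\<And>c. val U V (D U * V) c 0 (\<nu> * (c - a))"
    and g: "val U V (D V) a 0 \<mu>" and ne: "\<nu> \<noteq> 0" "\<nu> \<noteq> \<mu>"
  shows "\<not> base_point (blowup_uv d S a 0) 0 0"
    "\<exists>e. \<forall>c. val ((U - i a) / V) V (D ((U - i a) / V) * V) c 0 ((\<nu> - \<mu>) * (c - e))"
    "\<forall>c. val ((U - i a) / V) V (D V) c 0 \<mu>"
proof -
  have UV: "indep U V" using S by (simp add: realizes_def)
  have V: "V \<noteq> 0" "U - i a \<noteq> 0" using indep_nonzero[OF UV] indep_diff_nonzero[OF UV] by auto
  have "val U V (D U * V - i \<nu> * (U - i a)) c 0 0" for c
    by (rule val_cong[OF val_diff[OF f val_mult[OF val_const val_diff[OF val_fst val_const]]]]) auto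
  then obtain r r0 where r: "val U V r a 0 r0" and "D U * V - i \<nu> * (U - i a) = V * r"
    using val_divide_snd[OF UV] regI by metis
  then have DU: "D U = i \<nu> * ((U - i a) / V) + r" using V by (simp add: field_simps)
  have Da: "D (U - i a) = D U - i (x * d a)" by (simp add: D_diff D_i)
  define u v where "u = (U - i a) / V" and "v = V"
  have S': "realizes (blowup_UV d S a 0) u v"
    using realizes_blowup_UV[OF S, of a 0] by (simp add: u_def v_def)
  have uv: "indep u v" using S' by (simp add: realizes_def)
  have e: "U = i a + u * v" "V = i 0 + v" using V by (auto simp: u_def v_def)
  note c = val_comp[OF uv blowup_UV_val[OF UV e]]
  have "D u * v = i \<nu> * u + r - i (x * d a) - u * D V"
    unfolding u_def v_def D_divide[OF V(1)] Da DU using V by simp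
  then have *: "val u v (D u * v) c 0 (\<nu> * c + r0 - x * d a - c * \<mu>)" for c
    by (simp only: val_intros c r g)
  show "\<exists>e. \<forall>c. val ((U - i a) / V) V (D ((U - i a) / V) * V) c 0 ((\<nu> - \<mu>) * (c - e))"
  proof (intro exI[of _ "(x * d a - r0) / (\<nu> - \<mu>)"] allI)
    fix c
    have "(\<nu> - \<mu>) * (c - (x * d a - r0) / (\<nu> - \<mu>)) = (\<nu> - \<mu>) * c - (x * d a - r0)"
      using ne by (simp add: right_diff_distrib)
    also have "\<dots> = \<nu> * c + r0 - x * d a - c * \<mu>" by (simp add: algebra_simps)
    finally show "val ((U - i a) / V) V (D ((U - i a) / V) * V) c 0
        ((\<nu> - \<mu>) * (c - (x * d a - r0) / (\<nu> - \<mu>)))"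
      using *[of c] by (simp only: u_def v_def)
  qed
  show "\<forall>c. val ((U - i a) / V) V (D V) c 0 \<mu>"
    unfolding u_def[symmetric] using c[OF g] by (simp add: v_def)
  define s t where "s = U - i a" and "t = V / (U - i a)"
  have S'': "realizes (blowup_uv d S a 0) s t"
    using realizes_blowup_uv[OF S, of a 0] by (simp add: s_def t_def)
  have st: "indep s t" using S'' by (simp add: realizes_def)
  have nz: "s \<noteq> 0" "t \<noteq> 0" using indep_nonzero[OF st] by auto
  have UVst: "U = i a + s" "V = s * t" using V by (simp_all add: s_def t_def)
  have sU: "val s t U 0 0 a" and sV: "val s t V 0 0 0"
    unfolding UVst by (rule val_eq, (rule val_intros)+, simp_all)+
  note c' = val_comp[OF st sU sV]
  have Ds: "D s * t = i \<nu> + (r - i (x * d a)) * t"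
    unfolding s_def Da DU using V by (simp add: t_def field_simps)
  have vs: "val s t (D s * t) 0 0 \<nu>"
    unfolding Ds by (rule val_cong[of _ _ _ _ _ "\<nu> + (r0 - x * d a) * 0"]) (simp_all only: val_intros c' r, simp)
  have Dt: "D t * s = D V - D s * t"
    using D_quotient[of V t s] V by (simp add: s_def t_def mult.commute)
  have vt: "val s t (D t * s) 0 0 (\<mu> - \<nu>)"
    unfolding Dt by (intro val_diff c' g vs)
  show "\<not> base_point (blowup_uv d S a 0) 0 0"
    by (rule no_base_pointI[OF S'' vs val_snd nz(2) _ vt val_fst nz(1)]) (use ne in auto)
qed

text \<open>For \<open>\<nu> = \<mu>\<close> the blown up system is regular unless a logarithm occurs; the last two
  assumptions exclude it.\<close>

lemma resonant_blowup:
  assumes S: "realizes S U V" and f: "reg U V (D U * V) a 0"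
    and g: "val U V (D V) a 0 \<mu>" and ne: "\<mu> \<noteq> 0"
    and r1: "\<And>c. reg ((U - i a) / V) V (D ((U - i a) / V)) c 0"
    and r2: "\<And>c. reg ((U - i a) / V) V (D V) c 0"
  shows "cascades_regular d S a 0" "val U V (D U * V) a 0 0"
proof -
  have UV: "indep U V" using S by (simp add: realizes_def)
  have V: "V \<noteq> 0" "U - i a \<noteq> 0" using indep_nonzero[OF UV] indep_diff_nonzero[OF UV] by auto
  define u v where "u = (U - i a) / V" and "v = V"
  have S': "realizes (blowup_UV d S a 0) u v"
    using realizes_blowup_UV[OF S, of a 0] by (simp add: u_def v_def)
  have uv: "indep u v" using S' by (simp add: realizes_def)
  have e: "U = i a + u * v" "V = i 0 + v" using V by (auto simp: u_def v_def)
  note c = val_comp[OF uv blowup_UV_val[OF UV e]]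
  have Da: "D (U - i a) = D U - i (x * d a)" by (simp add: D_diff D_i)
  obtain f0 where f0: "val U V (D U * V) a 0 f0" using f by (auto simp: reg_def)
  obtain r s where rs: "\<And>c. val u v (D u) c 0 (r c)" "\<And>c. val u v (D v) c 0 (s c)"
    using r1 r2 unfolding reg_def u_def v_def by metis
  have D1: "D U * V = D u * v * v + i (x * d a) * v + u * v * D v"
  proof -
    have "D u = (D U - i (x * d a) - u * D v) / v"
      unfolding u_def v_def D_divide[OF V(1)] Da by simp
    then have "D U = D u * v + i (x * d a) + u * D v" using V by (simp add: v_def field_simps)
    then show ?thesis by (simp add: v_def algebra_simps)
  qed
  have "val u v (D U * V) 0 0 (r 0 * 0 * 0 + x * d a * 0 + 0 * 0 * s 0)"
    unfolding D1 by (intro val_intros rs)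
  then have "f0 = 0" using val_unique[OF uv c[OF f0]] by simp
  then show f1: "val U V (D U * V) a 0 0" using f0 by simp
  obtain A H A0 H0 where A: "val U V A a 0 A0" and H: "val U V H a 0 H0"
    and AH: "D U * V = i 0 + (U - i a) * A + (V - i 0) * H"
    by (rule val_hadamard[OF UV f1])
  have DU: "D U = A * ((U - i a) / V) + H" using AH V by (simp add: field_simps)
  have D2: "D u * v = u * A + H - i (x * d a) - u * D V"
    unfolding u_def v_def D_divide[OF V(1)] Da DU using V by simp
  have "val u v (D u * v) c' 0 (c' * A0 + H0 - x * d a - c' * \<mu>)" for c'
    unfolding D2 by (intro val_intros c A H g)
  moreover have "val u v (D u * v) c' 0 (r c' * 0)" for c'
    by (intro val_intros rs)
  ultimately have z: "c' * A0 + H0 - x * d a - c' * \<mu> = 0" for c'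
    using val_unique[OF uv] by fastforce
  have H0: "H0 = x * d a" using z[of 0] by simp
  have A0: "A0 = \<mu>" using z[of 1] H0 by simp
  define s t where "s = U - i a" and "t = V / (U - i a)"
  have S'': "realizes (blowup_uv d S a 0) s t"
    using realizes_blowup_uv[OF S, of a 0] by (simp add: s_def t_def)
  have st: "indep s t" using S'' by (simp add: realizes_def)
  have nz: "s \<noteq> 0" "t \<noteq> 0" using indep_nonzero[OF st] by auto
  have UVst: "U = i a + s" "V = s * t" using V by (simp_all add: s_def t_def)
  have sU: "val s t U 0 0 a" and sV: "val s t V 0 0 0"
    unfolding UVst by (rule val_eq, (rule val_intros)+, simp_all)+
  note c' = val_comp[OF st sU sV]
  have Ds: "D s * t = A + (H - i (x * d a)) * t"
    unfolding s_def Da DU using V by (simp add: t_def field_simps)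
  have vs: "val s t (D s * t) 0 0 \<mu>"
    by (rule val_cong[of _ _ "A + (H - i (x * d a)) * t" _ _ "A0 + (H0 - x * d a) * 0"])
      (simp_all only: Ds, intro val_intros c' A H, simp add: A0)
  have "val U V (D V - A) a 0 0" "val U V (H - i (x * d a)) a 0 0"
    by (rule val_cong[OF val_diff[OF g A]], simp_all add: A0)
      (rule val_cong[OF val_diff[OF H val_const]], simp_all add: H0)
  then obtain B C B' C' B0 C0 B0' C0' where BC: "val U V B a 0 B0" "val U V C a 0 C0"
      "D V - A = i 0 + (U - i a) * B + (V - i 0) * C"
      "val U V B' a 0 B0'" "val U V C' a 0 C0'"
      "H - i (x * d a) = i 0 + (U - i a) * B' + (V - i 0) * C'"
    using val_hadamard[OF UV] by metis
  have "D t * s = D V - D s * t"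
    using D_quotient[of V t s] V by (simp add: s_def t_def mult.commute)
  also have "\<dots> = (D V - A) - (H - i (x * d a)) * t" unfolding Ds by simp
  also have "\<dots> = (B + t * C - t * (B' + t * C')) * s"
  proof -
    have e: "U - i a = s" "V - i 0 = t * s" using UVst by (simp_all add: mult.commute)
    show ?thesis unfolding BC(3,6) e by (simp add: algebra_simps)
  qed
  finally have Dt: "D t = B + t * C - t * (B' + t * C')" using nz by simp
  have "val s t (D t) 0 0 (B0 + 0 * C0 - 0 * (B0' + 0 * C0'))"
    unfolding Dt by (intro val_intros c' BC)
  then have vt: "val s t (D t * 1) 0 0 (B0 + 0 * C0 - 0 * (B0' + 0 * C0'))" by simp
  have n: "\<not> base_point (blowup_uv d S a 0) 0 0"
    by (rule no_base_pointI[OF S'' vs val_snd nz(2) _ vt val_1]) (use ne in auto)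
  have rr: "reg u v (D u) c 0" "reg u v (D v) c 0" for c
    using r1 r2 by (simp_all only: u_def v_def)
  have "regular_system_at (blowup_UV d S a 0) c 0" for c
    unfolding regular_system_at_iff[OF S'] by (intro conjI rr)
  moreover have "\<not> base_point (blowup_UV d S a 0) c 0" for c
    using regular_no_base_point[OF S', of c 0] rr[of c] by blast
  ultimately show "cascades_regular d S a 0"
    using n by - (rule cascades_regular_intro, blast+)
qed

end

definition okF :: "'a::field \<Rightarrow> 'a \<Rightarrow> 'a \<Rightarrow> 'a \<Rightarrow> 'a \<Rightarrow> 'a" where
  "okF k0 kt h y z = 2 * y * (y - 1)\<^sup>2 * z - (k0 * (y - 1)\<^sup>2 + kt * y * (y - 1) - h * y)"

definition okG :: "'a::field \<Rightarrow> 'a \<Rightarrow> 'a \<Rightarrow> 'a \<Rightarrow> 'a \<Rightarrow> 'a \<Rightarrow> 'a" where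
  "okG k0 kt h ka y z = - ((y - 1) * (3 * y - 1) * z\<^sup>2)
     + z * (2 * k0 * (y - 1) + kt * (2 * y - 1) - h) - ka"

locale okamoto_field = function_field +
  fixes S :: "'a system" and Y Z :: 'b and q p k0 kt h ka :: 'a
  assumes S: "realizes S Y Z"
    and q0: "q \<noteq> 0" and q1: "q \<noteq> 1" and h0: "h \<noteq> 0"
    and DZ: "D Z = okF (i k0) (i kt) (i h) (Z + i q) (Y * Z + i p) - i (okF k0 kt h q p)"
    and DT: "D (Y * Z) = okG (i k0) (i kt) (i h) (i ka) (Z + i q) (Y * Z + i p) - i (okG k0 kt h ka q p)"
    and DY: "\<And>a b. reg Y Z (D Y) a b"
    and dk0: "d k0 = 0" and dkt: "d kt = 0" and dh: "x * d h = h"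
    and dq: "x * d q = okF k0 kt h q p" and dp: "x * d p = okG k0 kt h ka q p"
begin

definition "r = 1 / Z"
definition "g0 = 1 + i q * r"
definition "g1 = 1 + i (q - 1) * r"
definition "b2 = i k0 * g1\<^sup>2 + i kt * g0 * g1 - i h * r * g0"
definition "b1 = 2 * i k0 * g1 + i kt * (2 * g0 - r) - i h * r"
definition "fq = okF k0 kt h q p"
definition "gq = okG k0 kt h ka q p"
definition "z5 = Y * Z + i p"
definition "k = k0 + kt"

lemma YZ_indep: "indep Y Z"
  using S by (simp add: realizes_def)

lemma YZ_nonzero: "Y \<noteq> 0" "Z \<noteq> 0" "r \<noteq> 0"
  using indep_nonzero[OF YZ_indep] by (auto simp: r_def)

lemma g1_eq: "g1 = g0 - r"
  by (simp add: g0_def g1_def algebra_simps)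

lemma Zr: "Z * r = 1"
  using YZ_nonzero by (simp add: r_def)

lemma DZ_r: "D Z * r ^ 3 = 2 * g0 * g1\<^sup>2 * z5 - r * b2 - r ^ 3 * i fq"
proof -
  have 1: "(Z + i q) * r = g0" "(Z + i q - 1) * r = g1"
    using Zr by (simp_all add: g0_def g1_def algebra_simps)
  have "okF (i k0) (i kt) (i h) (Z + i q) z5 * r ^ 3 =
     2 * ((Z + i q) * r) * ((Z + i q - 1) * r)\<^sup>2 * z5
     - r * (i k0 * ((Z + i q - 1) * r)\<^sup>2 + i kt * ((Z + i q) * r) * ((Z + i q - 1) * r) - i h * r * ((Z + i q) * r))"
    unfolding okF_def by (simp add: power2_eq_square power3_eq_cube algebra_simps)
  then show ?thesis
    unfolding 1 b2_def[symmetric] DZ fq_def z5_def by (simp add: algebra_simps)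
qed

lemma DT_r: "D z5 * r\<^sup>2 = - (g1 * (3 * g0 - r) * z5\<^sup>2) + r * b1 * z5 - r\<^sup>2 * i ka"
proof -
  have 1: "(Z + i q - 1) * r = g1" "(3 * (Z + i q) - 1) * r = 3 * g0 - r" "(2 * (Z + i q) - 1) * r = 2 * g0 - r"
    using Zr by (simp_all add: g0_def g1_def algebra_simps)
  have "D z5 = okG (i k0) (i kt) (i h) (i ka) (Z + i q) z5"
    unfolding z5_def D_add DT D_i dp by simp
  then have "D z5 * r\<^sup>2 = - (((Z + i q - 1) * r) * ((3 * (Z + i q) - 1) * r) * z5\<^sup>2)
    + r * (2 * i k0 * ((Z + i q - 1) * r) + i kt * ((2 * (Z + i q) - 1) * r) - i h * r) * z5 - r\<^sup>2 * i ka"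
    unfolding okG_def by algebra
  then show ?thesis unfolding 1 b1_def[symmetric] .
qed

lemma Dr: "D r = - r\<^sup>2 * D Z"
  unfolding r_def D_inverse[OF YZ_nonzero(2)] by (simp add: power_divide)

lemma Dr_r: "D r * r = - (2 * g0 * g1\<^sup>2 * z5 - r * b2 - r ^ 3 * i fq)"
  unfolding DZ_r[symmetric] Dr by (simp add: power2_eq_square power3_eq_cube)

lemma Dz5: "D z5 = D (Y * Z) + i gq"
  unfolding z5_def D_add D_i dp gq_def by simp

lemma r_vals:
  assumes "val U V r a b c"
  shows "val U V g0 a b (1 + q * c)" "val U V g1 a b (1 + (q - 1) * c)"
    "val U V b2 a b (k0 * (1 + (q - 1) * c)\<^sup>2 + kt * (1 + q * c) * (1 + (q - 1) * c) - h * c * (1 + q * c))"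
    "val U V b1 a b (2 * k0 * (1 + (q - 1) * c) + kt * (2 * (1 + q * c) - c) - h * c)"
proof -
  show g0: "val U V g0 a b (1 + q * c)" and g1: "val U V g1 a b (1 + (q - 1) * c)"
    unfolding g0_def g1_def by (intro val_intros assms)+
  show "val U V b2 a b (k0 * (1 + (q - 1) * c)\<^sup>2 + kt * (1 + q * c) * (1 + (q - 1) * c) - h * c * (1 + q * c))"
    "val U V b1 a b (2 * k0 * (1 + (q - 1) * c) + kt * (2 * (1 + q * c) - c) - h * c)"
    unfolding b1_def b2_def by (intro val_intros assms g0 g1)+
qed

lemma r_vals_0:
  assumes "val U V r a b 0"
  shows "val U V g0 a b 1" "val U V g1 a b 1" "val U V b2 a b k" "val U V b1 a b (2 * k)"
  using r_vals[OF assms] by (simp_all add: k_def algebra_simps)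

subsection \<open>The point at infinity of the fibre direction\<close>

lemma chart_UV_realizes: "realizes (chart_UV S) (Y / Z) r"
  using realizes_chart_UV[OF S] by (simp add: r_def)

lemma chart_UV_vals:
  defines "U \<equiv> Y / Z"
  shows "val U r (D U * r ^ 4) c 0 (- 7 * c\<^sup>2)" "val U r (D r * r ^ 3) c 0 (- 2 * c)"
proof -
  note rv = r_vals_0[OF val_snd[of U r c 0]]
  have z: "z5 * r\<^sup>2 = U + i p * r\<^sup>2"
    using YZ_nonzero by (simp add: z5_def U_def r_def power2_eq_square algebra_simps)
  have 1: "D r * r ^ 3 = - (2 * g0 * g1\<^sup>2 * (U + i p * r\<^sup>2) - r ^ 3 * b2 - r ^ 5 * i fq)"
    unfolding z[symmetric] using Dr_r by algebra
  show v1: "val U r (D r * r ^ 3) c 0 (- 2 * c)"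
    unfolding 1 by (rule val_eq, (rule rv val_intros)+, simp)
  have "U = z5 * r\<^sup>2 - i p * r\<^sup>2" using z by simp
  then have "D U = D z5 * r\<^sup>2 + z5 * (2 * r * D r) - (i (x * d p) * r\<^sup>2 + i p * (2 * r * D r))"
    by (simp only: D_diff D_mult D_power2 D_i)
  then have "D U * r ^ 4 = (D z5 * r\<^sup>2) * r ^ 4 + 2 * U * (D r * r ^ 3) - i gq * r ^ 6"
    unfolding dp gq_def[symmetric] using z by algebra
  also have "(D z5 * r\<^sup>2) * r ^ 4 = - (g1 * (3 * g0 - r) * (U + i p * r\<^sup>2)\<^sup>2) + r ^ 3 * b1 * (U + i p * r\<^sup>2) - r ^ 6 * i ka"
    unfolding DT_r z[symmetric] by algebra
  finally have 2: "D U * r ^ 4 = - (g1 * (3 * g0 - r) * (U + i p * r\<^sup>2)\<^sup>2) + r ^ 3 * b1 * (U + i p * r\<^sup>2)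
      - r ^ 6 * i ka + 2 * U * (D r * r ^ 3) - i gq * r ^ 6" .
  show "val U r (D U * r ^ 4) c 0 (- 7 * c\<^sup>2)"
    unfolding 2 by (rule val_eq, (rule rv v1 val_intros)+, simp add: power2_eq_square)
qed

lemma val_r_power: "val U r (r ^ n) c 0 (0 ^ n)"
  by (rule val_power[OF val_snd])

lemma chart_UV_base_points:
  "base_point (chart_UV S) 0 0" "c \<noteq> 0 \<Longrightarrow> \<not> base_point (chart_UV S) c 0"
proof -
  note v = chart_UV_vals
  show "base_point (chart_UV S) 0 0"
    by (rule base_point_snd_pole[OF chart_UV_realizes _ v(1)[of 1]]) (use v(1)[of 0] in auto)
  show "\<not> base_point (chart_UV S) c 0" if "c \<noteq> 0"
    by (rule no_base_pointI[OF chart_UV_realizes v(1) val_r_power _ _ v(2) val_r_power])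
      (use that YZ_nonzero in auto)
qed

abbreviation "SB1 \<equiv> blowup_UV d (chart_UV S) 0 0"
abbreviation "SB2 \<equiv> blowup_UV d SB1 0 0"
abbreviation "SB3 \<equiv> blowup_UV d SB2 (- p) 0"

definition "W = z5 / r"

lemma SB1_realizes: "realizes SB1 Y r"
  using realizes_blowup_UV[OF chart_UV_realizes, of 0 0] YZ_nonzero by (simp add: r_def)

lemma SB2_realizes: "realizes SB2 (Y * Z) r"
  using realizes_blowup_UV[OF SB1_realizes, of 0 0] YZ_nonzero by (simp add: r_def)

lemma SB3_realizes: "realizes SB3 W r"
  using realizes_blowup_UV[OF SB2_realizes, of "- p" 0] by (simp add: W_def z5_def)

lemma SB1_vals:
  "val Y r (D Y * r ^ 3) c 0 (- 5 * c\<^sup>2)" "val Y r (D r * r ^ 2) c 0 (- 2 * c)"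
proof -
  note rv = r_vals_0[OF val_snd[of Y r c 0]]
  have z: "z5 * r = Y + i p * r"
    using YZ_nonzero by (simp add: z5_def r_def algebra_simps)
  have 1: "D r * r ^ 2 = - (2 * g0 * g1\<^sup>2 * (Y + i p * r) - r ^ 2 * b2 - r ^ 4 * i fq)"
    unfolding z[symmetric] using Dr_r by algebra
  show v1: "val Y r (D r * r ^ 2) c 0 (- 2 * c)"
    unfolding 1 by (rule val_eq, (rule rv val_intros)+, simp)
  have "Y = z5 * r - i p * r" using z by simp
  then have "D Y = D z5 * r + z5 * D r - (i (x * d p) * r + i p * D r)"
    by (metis D_diff D_mult D_i)
  then have "D Y * r ^ 3 = (D z5 * r\<^sup>2) * r ^ 2 + Y * (D r * r ^ 2) - i gq * r ^ 4"
    unfolding dp gq_def[symmetric] using z by algebra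
  also have "(D z5 * r\<^sup>2) * r ^ 2 = - (g1 * (3 * g0 - r) * (Y + i p * r)\<^sup>2) + r ^ 2 * b1 * (Y + i p * r) - r ^ 4 * i ka"
    unfolding DT_r z[symmetric] by algebra
  finally have 2: "D Y * r ^ 3 = - (g1 * (3 * g0 - r) * (Y + i p * r)\<^sup>2) + r ^ 2 * b1 * (Y + i p * r)
      - r ^ 4 * i ka + Y * (D r * r ^ 2) - i gq * r ^ 4" .
  show "val Y r (D Y * r ^ 3) c 0 (- 5 * c\<^sup>2)"
    unfolding 2 by (rule val_eq, (rule rv v1 val_intros)+, simp add: power2_eq_square)
qed

lemma SB1_base_points:
  "base_point SB1 0 0" "c \<noteq> 0 \<Longrightarrow> \<not> base_point SB1 c 0"
proof -
  note v = SB1_vals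
  show "base_point SB1 0 0"
    by (rule base_point_snd_pole[OF SB1_realizes _ v(1)[of 1]]) (use v(1)[of 0] in auto)
  show "\<not> base_point SB1 c 0" if "c \<noteq> 0"
    by (rule no_base_pointI[OF SB1_realizes v(1) val_r_power _ _ v(2) val_r_power])
      (use that YZ_nonzero in auto)
qed

lemma SB1_uv: "\<not> base_point (blowup_uv d (chart_UV S) 0 0) 0 0"
proof -
  define u v where "u = Y / Z" and "v = 1 / Y"
  have R: "realizes (blowup_uv d (chart_UV S) 0 0) u v"
    using realizes_blowup_uv[OF chart_UV_realizes, of 0 0] YZ_nonzero by (simp add: u_def v_def r_def)
  have ind: "indep u v" using R by (simp add: realizes_def)
  have nz: "u \<noteq> 0" "v \<noteq> 0" using indep_nonzero[OF ind] by auto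
  have r: "r = u * v" using YZ_nonzero by (simp add: u_def v_def r_def)
  have z: "z5 * (u * v\<^sup>2) = 1 + i p * (u * v\<^sup>2)"
    using YZ_nonzero by (simp add: z5_def u_def v_def r_def power2_eq_square field_simps)
  have vr: "val u v r 0 0 0" unfolding r by (rule val_eq, (rule val_intros)+, simp)
  note rv = r_vals_0[OF vr]
  have 1: "D r * r * (u * v\<^sup>2) = - (2 * g0 * g1\<^sup>2 * (1 + i p * (u * v\<^sup>2)) - r * b2 * (u * v\<^sup>2) - r ^ 3 * i fq * (u * v\<^sup>2))"
    unfolding z[symmetric] Dr_r by algebra
  have v1: "val u v (D r * r * (u * v\<^sup>2)) 0 0 (- 2)"
    unfolding 1 by (rule val_eq, (rule vr rv val_intros)+, simp)
  have 2: "D z5 * r\<^sup>2 * (u * v\<^sup>2)\<^sup>2 = - (g1 * (3 * g0 - r) * (1 + i p * (u * v\<^sup>2))\<^sup>2)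
     + r * b1 * (1 + i p * (u * v\<^sup>2)) * (u * v\<^sup>2) - r\<^sup>2 * i ka * (u * v\<^sup>2)\<^sup>2"
    unfolding z[symmetric] DT_r by algebra
  have v2: "val u v (D z5 * r\<^sup>2 * (u * v\<^sup>2)\<^sup>2) 0 0 (- 3)"
    unfolding 2 by (rule val_eq, (rule vr rv val_intros)+, simp)
  have "(z5 - i p) * r * v = 1" using z nz unfolding r by (simp add: power2_eq_square algebra_simps)
  then have "D ((z5 - i p) * r * v) = 0" by simp
  then have Dv: "((D z5 - i gq) * r + (z5 - i p) * D r) * v + (z5 - i p) * r * D v = 0"
    by (simp add: D_mult D_diff D_i dp gq_def)
  have 3: "D v * (u ^ 3 * v ^ 3) = - (D z5 * r\<^sup>2 * (u * v\<^sup>2)\<^sup>2 - i gq * r\<^sup>2 * (u * v\<^sup>2)\<^sup>2 + D r * r * (u * v\<^sup>2))"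
  proof -
    have "u\<^sup>2 * v ^ 2 * (((D z5 - i gq) * r + (z5 - i p) * D r) * v + (z5 - i p) * r * D v) * (u * v\<^sup>2) = 0"
      unfolding Dv by simp
    then show ?thesis using z unfolding r by algebra
  qed
  have v3: "val u v (D v * (u ^ 3 * v ^ 3)) 0 0 5"
    unfolding 3 by (rule val_eq, (rule v1 v2 vr rv val_intros)+, simp)
  have "u = (z5 - i p) * r\<^sup>2" using z nz unfolding r by algebra
  then have "D u = (D z5 - i gq) * r\<^sup>2 + (z5 - i p) * (2 * r * D r)"
    by (metis D_diff D_mult D_i D_power2 dp gq_def)
  then have 4: "D u * (u * v\<^sup>2)\<^sup>2 = D z5 * r\<^sup>2 * (u * v\<^sup>2)\<^sup>2 - i gq * r\<^sup>2 * (u * v\<^sup>2)\<^sup>2 + 2 * (D r * r * (u * v\<^sup>2))"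
    using z by algebra
  have v4: "val u v (D u * (u * v\<^sup>2)\<^sup>2) 0 0 (- 7)"
    unfolding 4 by (rule val_eq, (rule v1 v2 vr rv val_intros)+, simp)
  have k: "val u v ((u * v\<^sup>2)\<^sup>2) 0 0 0" "val u v (u ^ 3 * v ^ 3) 0 0 0"
    by (rule val_eq, (rule val_intros)+, simp)+
  show ?thesis
    by (rule no_base_pointI[OF R v4 k(1) _ _ v3 k(2)]) (use nz in auto)
qed

lemma SB2_vals:
  "val (Y * Z) r (D (Y * Z) * r ^ 2) c 0 (- 3 * (c + p)\<^sup>2)" "val (Y * Z) r (D r * r ^ 1) c 0 (- 2 * (c + p))"
proof -
  define T where "T = Y * Z"
  note rv = r_vals_0[OF val_snd[of T r c 0]]
  have z: "z5 = T + i p" by (simp add: z5_def T_def)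
  show "val (Y * Z) r (D r * r ^ 1) c 0 (- 2 * (c + p))"
    unfolding T_def[symmetric] power_one_right Dr_r z by (rule val_eq, (rule rv val_intros)+, simp)
  have 2: "D T * r ^ 2 = - (g1 * (3 * g0 - r) * (T + i p)\<^sup>2) + r * b1 * (T + i p) - r\<^sup>2 * i ka - i gq * r\<^sup>2"
    unfolding z[symmetric] DT_r[symmetric] using Dz5 by (simp add: T_def algebra_simps)
  show "val (Y * Z) r (D (Y * Z) * r ^ 2) c 0 (- 3 * (c + p)\<^sup>2)"
    unfolding T_def[symmetric] 2 by (rule val_eq, (rule rv val_intros)+, simp)
qed

lemma SB2_base_points:
  "base_point SB2 (- p) 0" "c \<noteq> - p \<Longrightarrow> \<not> base_point SB2 c 0"
proof -
  note v = SB2_vals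
  show "base_point SB2 (- p) 0"
    by (rule base_point_snd_pole[OF SB2_realizes _ v(1)[of "1 - p"]]) (use v(1)[of "- p"] in auto)
  show "\<not> base_point SB2 c 0" if "c \<noteq> - p"
    by (rule no_base_pointI[OF SB2_realizes v(1) val_r_power _ _ v(2) val_r_power])
      (use that YZ_nonzero in \<open>auto simp: add_eq_0_iff2\<close>)
qed

lemma SB2_uv: "\<not> base_point (blowup_uv d SB1 0 0) 0 0"
proof -
  define u v where "u = Y" and "v = r / Y"
  have R: "realizes (blowup_uv d SB1 0 0) u v"
    using realizes_blowup_uv[OF SB1_realizes, of 0 0] by (simp add: u_def v_def)
  have ind: "indep u v" using R by (simp add: realizes_def)
  have nz: "u \<noteq> 0" "v \<noteq> 0" using indep_nonzero[OF ind] by auto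
  have r: "r = u * v" using YZ_nonzero by (simp add: u_def v_def)
  have z: "z5 * v = 1 + i p * v"
    using YZ_nonzero by (simp add: z5_def v_def r_def field_simps)
  have vr: "val u v r 0 0 0" unfolding r by (rule val_eq, (rule val_intros)+, simp)
  note rv = r_vals_0[OF vr]
  have 1: "D r * r * v = - (2 * g0 * g1\<^sup>2 * (1 + i p * v) - r * b2 * v - r ^ 3 * i fq * v)"
    unfolding z[symmetric] Dr_r by algebra
  have v1: "val u v (D r * r * v) 0 0 (- 2)"
    unfolding 1 by (rule val_eq, (rule vr rv val_intros)+, simp)
  have 2: "D z5 * r\<^sup>2 * v\<^sup>2 = - (g1 * (3 * g0 - r) * (1 + i p * v)\<^sup>2)
     + r * b1 * (1 + i p * v) * v - r\<^sup>2 * i ka * v\<^sup>2"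
    unfolding z[symmetric] DT_r by algebra
  have v2: "val u v (D z5 * r\<^sup>2 * v\<^sup>2) 0 0 (- 3)"
    unfolding 2 by (rule val_eq, (rule vr rv val_intros)+, simp)
  have "(z5 - i p) * v = 1" using z by (simp add: algebra_simps)
  then have "D ((z5 - i p) * v) = 0" by simp
  then have Dv: "(D z5 - i gq) * v + (z5 - i p) * D v = 0"
    by (simp add: D_mult D_diff D_i dp gq_def)
  have 3: "D v * (u\<^sup>2 * v\<^sup>2) = - (D z5 * r\<^sup>2 * v\<^sup>2 - i gq * r\<^sup>2 * v\<^sup>2)"
  proof -
    have "u\<^sup>2 * v\<^sup>2 * ((D z5 - i gq) * v + (z5 - i p) * D v) * v = 0"
      unfolding Dv by simp
    then show ?thesis using z unfolding r by algebra
  qed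
  have v3: "val u v (D v * (u\<^sup>2 * v\<^sup>2)) 0 0 3"
    unfolding 3 by (rule val_eq, (rule v1 v2 vr rv val_intros)+, simp)
  have "u = (z5 - i p) * r" using z nz unfolding r by algebra
  then have "D u = (D z5 - i gq) * r + (z5 - i p) * D r"
    by (metis D_diff D_mult D_i dp gq_def)
  then have 4: "D u * (u * v ^ 3) = D z5 * r\<^sup>2 * v\<^sup>2 - i gq * r\<^sup>2 * v\<^sup>2 + D r * r * v"
    using z r by algebra
  have v4: "val u v (D u * (u * v ^ 3)) 0 0 (- 5)"
    unfolding 4 by (rule val_eq, (rule v1 v2 vr rv val_intros)+, simp)
  have k: "val u v (u * v ^ 3) 0 0 0" "val u v (u\<^sup>2 * v\<^sup>2) 0 0 0"
    by (rule val_eq, (rule val_intros)+, simp)+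
  show ?thesis
    by (rule no_base_pointI[OF R v4 k(1) _ _ v3 k(2)]) (use nz in auto)
qed

lemma z5_W: "z5 = W * r"
  using YZ_nonzero by (simp add: W_def)

lemma Dr_W: "D r = - (2 * g0 * g1\<^sup>2 * W - b2 - r\<^sup>2 * i fq)"
proof -
  have "D r * r = - (2 * g0 * g1\<^sup>2 * W - b2 - r\<^sup>2 * i fq) * r"
    unfolding Dr_r z5_W by (simp add: power2_eq_square power3_eq_cube algebra_simps)
  then show ?thesis using YZ_nonzero by simp
qed

lemma Dz5_W: "D z5 = - (g1 * (3 * g0 - r) * W\<^sup>2) + b1 * W - i ka"
proof -
  have "D z5 * r\<^sup>2 = (- (g1 * (3 * g0 - r) * W\<^sup>2) + b1 * W - i ka) * r\<^sup>2"
    unfolding DT_r unfolding z5_W by (simp add: power2_eq_square algebra_simps)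
  then show ?thesis using YZ_nonzero by simp
qed

definition "R1 = (3 * (i (q - 1))\<^sup>2 + 2 * i (q - 1) + 2 * (i (q - 1))\<^sup>2 * i q * r) * W\<^sup>2
   + (- i k0 * (i (q - 1))\<^sup>2 - i kt * i q * i (q - 1) + i h * i q - i fq) * W"

definition "R2 = - 2 * (i q + 2 * i (q - 1) + r * (2 * i q * i (q - 1) + (i (q - 1))\<^sup>2) + r\<^sup>2 * i q * (i (q - 1))\<^sup>2) * W
   + (i k0 * (2 * i (q - 1) + (i (q - 1))\<^sup>2 * r) + i kt * (i q + i (q - 1) + i q * i (q - 1) * r) - i h * g0)
   + r * i fq"

lemma Dr_R2: "D r = - (2 * W - i k) + r * R2"
  unfolding Dr_W R2_def b2_def g0_def g1_def k_def i_simps by algebra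

lemma DW_R1: "D W * r = - (W\<^sup>2 - i k * W + i ka) + r\<^sup>2 * R1"
proof -
  have "D W * r = D z5 - W * D r" by (rule D_quotient[OF z5_W])
  also have "\<dots> = - (W\<^sup>2 - i k * W + i ka) + r\<^sup>2 * R1"
    unfolding Dz5_W Dr_W R1_def b1_def b2_def g0_def g1_def k_def i_simps by algebra
  finally show ?thesis .
qed

lemma R_reg:
  assumes "reg U V W a b" "reg U V r a b"
  shows "reg U V R1 a b" "reg U V R2 a b"
  unfolding R1_def R2_def g0_def by (intro reg_intros assms)+

lemma SB3_vals:
  "val W r (D W * r ^ 1) c 0 (- (c\<^sup>2 - k * c + ka))" "val W r (D r) c 0 (k - 2 * c)"
proof -
  obtain e f where ef: "val W r R1 c 0 e" "val W r R2 c 0 f"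
    using R_reg[OF reg_intros(2,3)] unfolding reg_def by metis
  show "val W r (D W * r ^ 1) c 0 (- (c\<^sup>2 - k * c + ka))"
    unfolding power_one_right DW_R1 by (rule val_eq, (rule ef val_intros)+, simp)
  show "val W r (D r) c 0 (k - 2 * c)"
    unfolding Dr_R2 by (rule val_eq, (rule ef val_intros)+, simp)
qed

lemma SB3_base_points:
  "ka = s * (k - s) \<Longrightarrow> base_point SB3 s 0" "base_point SB3 c 0 \<Longrightarrow> ka = c * (k - c)"
proof -
  note v = SB3_vals
  show "base_point SB3 s 0" if s: "ka = s * (k - s)"
  proof -
    obtain c where "c \<notin> {s, k - s}"
      using ex_new_if_finite[OF infinite_UNIV_char_0, of "{s, k - s}"] by auto
    then have "- (c\<^sup>2 - k * c + ka) \<noteq> 0"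
    proof -
      have "c\<^sup>2 - k * c + ka = (c - s) * (c - (k - s))"
        unfolding s by (simp add: power2_eq_square algebra_simps)
      then show ?thesis using \<open>c \<notin> {s, k - s}\<close> by simp
    qed
    then show ?thesis
      using v(1)[of s] by (intro base_point_snd_pole[OF SB3_realizes _ v(1)[of c]])
        (simp_all add: s power2_eq_square algebra_simps)
  qed
  show "ka = c * (k - c)" if "base_point SB3 c 0"
  proof (rule ccontr)
    assume *: "ka \<noteq> c * (k - c)"
    have v2: "val W r (D r * 1) c 0 (k - 2 * c)" using v(2) by simp
    have "- (c\<^sup>2 - k * c + ka) \<noteq> 0"
      using * by (auto simp: power2_eq_square algebra_simps)
    then have "\<not> base_point SB3 c 0"
      using YZ_nonzero by (intro no_base_pointI[OF SB3_realizes v(1) val_r_power _ _ v2 val_1]) auto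
    with that show False by simp
  qed
qed

lemma SB3_uv:
  "\<not> base_point (blowup_uv d SB2 (- p) 0) 0 0"
  "\<not> regular_system_at (blowup_uv d SB2 (- p) 0) 0 0"
proof -
  define u v where "u = z5" and "v = r / z5"
  have R: "realizes (blowup_uv d SB2 (- p) 0) u v"
    using realizes_blowup_uv[OF SB2_realizes, of "- p" 0] by (simp add: u_def v_def z5_def)
  have ind: "indep u v" using R by (simp add: realizes_def)
  have nz: "u \<noteq> 0" "v \<noteq> 0" using indep_nonzero[OF ind] by auto
  have r: "r = u * v" using nz by (simp add: u_def v_def)
  have vr: "val u v r 0 0 0" unfolding r by (rule val_eq, (rule val_intros)+, simp)
  note rv = r_vals_0[OF vr]
  have 1: "D r * v = - (2 * g0 * g1\<^sup>2 - v * b2 - r\<^sup>2 * v * i fq)"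
  proof -
    have "(D r * v) * u = - (2 * g0 * g1\<^sup>2 - v * b2 - r\<^sup>2 * v * i fq) * u"
      using Dr_r unfolding u_def[symmetric] r by algebra
    then show ?thesis using nz by simp
  qed
  have v1: "val u v (D r * v) 0 0 (- 2)"
    unfolding 1 by (rule val_eq, (rule vr rv val_intros)+, simp)
  have 2: "D u * v\<^sup>2 = - (g1 * (3 * g0 - r)) + v * b1 - v\<^sup>2 * i ka"
  proof -
    have "(D u * v\<^sup>2) * u\<^sup>2 = (- (g1 * (3 * g0 - r)) + v * b1 - v\<^sup>2 * i ka) * u\<^sup>2"
      using DT_r unfolding u_def[symmetric] r by algebra
    then show ?thesis using nz by simp
  qed
  have v2: "val u v (D u * v\<^sup>2) 0 0 (- 3)"
    unfolding 2 by (rule val_eq, (rule vr rv val_intros)+, simp)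
  have "D v * u = D r - v * D u" by (rule D_quotient) (simp add: r)
  then have 3: "D v * (u * v) = D r * v - D u * v\<^sup>2" by algebra
  have v3: "val u v (D v * (u * v)) 0 0 1"
    unfolding 3 by (rule val_eq, (rule v1 v2 val_intros)+, simp)
  have k: "val u v (v\<^sup>2) 0 0 0" "val u v (u * v) 0 0 0"
    by (rule val_eq, (rule val_intros)+, simp)+
  show "\<not> base_point (blowup_uv d SB2 (- p) 0) 0 0"
    by (rule no_base_pointI[OF R v2 k(1) _ _ v3 k(2)]) (use nz in auto)
  show "\<not> regular_system_at (blowup_uv d SB2 (- p) 0) 0 0"
    unfolding regular_system_at_iff[OF R] using not_reg_pole[OF ind v3 k(2)] by simp
qed

end

lemma cascades_regular_cases:
  assumes "cascades_regular d S a b"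
  shows "base_point (blowup_UV d S a b) c 0 \<Longrightarrow> cascades_regular d (blowup_UV d S a b) c 0"
    "base_point (blowup_uv d S a b) 0 0 \<Longrightarrow> cascades_regular d (blowup_uv d S a b) 0 0"
    "\<lbrakk>\<forall>c. \<not> base_point (blowup_UV d S a b) c 0; \<not> base_point (blowup_uv d S a b) 0 0\<rbrakk> \<Longrightarrow>
      (\<forall>c. regular_system_at (blowup_uv d S a b) 0 c) \<or> (\<forall>c. regular_system_at (blowup_UV d S a b) c 0)"
  using assms by (auto elim: cascades_regular.cases)

context okamoto_field
begin

context
  fixes s :: 'a
  assumes s: "ka = s * (k - s)"
begin

private definition "s' = x * d s"

lemma SB3_root_uv:
  defines "u \<equiv> W - i s" and "v \<equiv> r / (W - i s)"
  shows "realizes (blowup_uv d SB3 s 0) u v" "r = u * v"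
    "D u * v = - (i (2 * s - k) + u) + u * v\<^sup>2 * R1 - v * i s'"
    "D v * u = u * (- 1 + v * R2 - v\<^sup>2 * R1) + v * i s'"
proof -
  show R: "realizes (blowup_uv d SB3 s 0) u v"
    using realizes_blowup_uv[OF SB3_realizes, of s 0] by (simp add: u_def v_def)
  have nz: "u \<noteq> 0" "v \<noteq> 0" using indep_nonzero R by (auto simp: realizes_def)
  show r: "r = u * v" using nz by (simp add: u_def v_def)
  have W: "W = i s + u" by (simp add: u_def)
  have Du: "D u = D W - i s'" unfolding u_def D_diff D_i s'_def by simp
  have "D u * v * u = (- (i (2 * s - k) + u) + u * v\<^sup>2 * R1 - v * i s') * u"
    using DW_R1 unfolding Du s W r i_simps i_numeral by algebra
  then show 1: "D u * v = - (i (2 * s - k) + u) + u * v\<^sup>2 * R1 - v * i s'"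
    using nz by simp
  have "D v * u = D r - v * D u" by (rule D_quotient) (simp add: r)
  then show "D v * u = u * (- 1 + v * R2 - v\<^sup>2 * R1) + v * i s'"
    using 1 unfolding Dr_R2 W unfolding r i_simps i_numeral by algebra
qed

lemma SB3_root_UV:
  defines "u \<equiv> (W - i s) / r"
  shows "realizes (blowup_UV d SB3 s 0) u r" "W = i s + u * r"
    "D u * r = (u\<^sup>2 + R1 - u * R2) * r - i s'"
proof -
  show R: "realizes (blowup_UV d SB3 s 0) u r"
    using realizes_blowup_UV[OF SB3_realizes, of s 0] by (simp add: u_def)
  have r: "r \<noteq> 0" by (rule YZ_nonzero)
  show W: "W = i s + u * r" using r by (simp add: u_def)
  have "D W = i s' + (D u * r + u * D r)"
    unfolding W D_add D_mult D_i s'_def by simp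
  then have "D u * r * r = ((u\<^sup>2 + R1 - u * R2) * r - i s') * r"
    using DW_R1 Dr_R2 unfolding s W i_simps by algebra
  then show "D u * r = (u\<^sup>2 + R1 - u * R2) * r - i s'"
    using r by simp
qed

lemma SB3_root_regular:
  assumes "d s = 0"
  shows "cascades_regular d SB3 s 0"
proof -
  have s0: "s' = 0" using assms by (simp add: s'_def)
  define w where "w = (W - i s) / r"
  note UV = SB3_root_UV[folded w_def]
  have r: "r \<noteq> 0" by (rule YZ_nonzero)
  have Wreg: "reg w r W c 0" for c
    unfolding UV(2) by (intro reg_intros)
  note Rr = R_reg[OF Wreg reg_intros(3)]
  have Dw: "D w = w\<^sup>2 + R1 - w * R2" using UV(3) r by (simp add: s0)
  have rw: "reg w r (D w) c 0" for c
    unfolding Dw by (intro reg_intros Rr)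
  have rr: "reg w r (D r) c 0" for c
    unfolding Dr_R2 by (intro reg_intros Rr Wreg)
  have 1: "regular_system_at (blowup_UV d SB3 s 0) c 0" for c
    unfolding regular_system_at_iff[OF UV(1)] by (intro conjI rw rr)
  have 2: "\<not> base_point (blowup_UV d SB3 s 0) c 0" for c
    by (rule regular_no_base_point[OF UV(1) rw[of c] rr[of c]])
  have 3: "cascades_regular d (blowup_uv d SB3 s 0) 0 0" if base: "base_point (blowup_uv d SB3 s 0) 0 0"
  proof -
    define u v where "u = W - i s" and "v = r / (W - i s)"
    note uv = SB3_root_uv[folded u_def v_def]
    have ind: "indep u v" using uv(1) by (simp add: realizes_def)
    have nz: "u \<noteq> 0" "v \<noteq> 0" using indep_nonzero[OF ind] by auto
    have W: "W = i s + u" by (simp add: u_def)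
    have Dv: "D v = - 1 + v * R2 - v\<^sup>2 * R1" using uv(4) nz by (simp add: s0)
    have eq: "2 * s - k = 0"
    proof (rule ccontr)
      assume ne: "2 * s - k \<noteq> 0"
      have Wr: "reg u v W 0 0" "reg u v r 0 0" unfolding W uv(2) by (intro reg_intros)+
      obtain e f where ef: "val u v R1 0 0 e" "val u v R2 0 0 f"
        using R_reg[OF Wr] unfolding reg_def by metis
      have v1: "val u v (D u * v) 0 0 (- (2 * s - k))"
        unfolding uv(3) s0 by (rule val_eq, (rule ef val_intros)+, simp)
      have v2: "val u v (D v * 1) 0 0 (- 1)"
        unfolding Dv mult_1_right by (rule val_eq, (rule ef val_intros)+, simp)
      have "\<not> base_point (blowup_uv d SB3 s 0) 0 0"
        by (rule no_base_pointI[OF uv(1) v1 val_snd nz(2) _ v2 val_1]) (use ne in auto)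
      with base show False by simp
    qed
    have Duv: "D u * v = u * (- 1 + v\<^sup>2 * R1)"
      unfolding uv(3) eq s0 by (simp add: algebra_simps)
    define a where "a = u / v"
    have A: "realizes (blowup_UV d (blowup_uv d SB3 s 0) 0 0) a v"
      using realizes_blowup_UV[OF uv(1), of 0 0] by (simp add: a_def)
    have u: "u = a * v" using nz by (simp add: a_def)
    have Ar: "reg a v W c 0" "reg a v r c 0" for c
      unfolding W uv(2) unfolding u by (intro reg_intros)+
    note AR = R_reg[OF Ar]
    have "D a * v = D u - a * D v" by (rule D_quotient[OF u])
    then have "D a * v * v = a * (2 * v * R1 - R2) * v * v"
      using Duv Dv u by algebra
    then have Da: "D a = a * (2 * v * R1 - R2)" using nz by simp
    have rA: "reg a v (D a) c 0" "reg a v (D v) c 0" for c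
      unfolding Da Dv by (intro reg_intros AR)+
    have A1: "regular_system_at (blowup_UV d (blowup_uv d SB3 s 0) 0 0) c 0" for c
      unfolding regular_system_at_iff[OF A] by (intro conjI rA)
    have A2: "\<not> base_point (blowup_UV d (blowup_uv d SB3 s 0) 0 0) c 0" for c
      by (rule regular_no_base_point[OF A rA(1)[of c] rA(2)[of c]])
    define t where "t = v / u"
    have B: "realizes (blowup_uv d (blowup_uv d SB3 s 0) 0 0) u t"
      using realizes_blowup_uv[OF uv(1), of 0 0] by (simp add: t_def)
    have t0: "t \<noteq> 0" using nz by (simp add: t_def)
    have v: "v = t * u" using nz by (simp add: t_def)
    have Br: "reg u t W 0 0" "reg u t r 0 0"
      unfolding W uv(2) unfolding v by (intro reg_intros)+
    obtain e f where ef: "val u t R1 0 0 e" "val u t R2 0 0 f"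
      using R_reg[OF Br] unfolding reg_def by metis
    have vv: "val u t v 0 0 0" unfolding v by (rule val_eq, (rule val_intros)+, simp)
    have Dut: "D u * t = - 1 + v\<^sup>2 * R1"
    proof -
      have "D u * t * u = (- 1 + v\<^sup>2 * R1) * u" using Duv v by algebra
      then show ?thesis using nz by simp
    qed
    have v1: "val u t (D u * t) 0 0 (- 1)"
      unfolding Dut by (rule val_eq, (rule ef vv val_intros)+, simp)
    have "D t * u = D v - t * D u" by (rule D_quotient[OF v])
    then have "D t * u = t * (R2 - 2 * v * R1) * u" using Dut Dv v by algebra
    then have Dt: "D t = t * (R2 - 2 * v * R1)" using nz by simp
    have v2: "val u t (D t * 1) 0 0 0"
      unfolding Dt mult_1_right by (rule val_eq, (rule ef vv val_intros)+, simp)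
    have B1: "\<not> base_point (blowup_uv d (blowup_uv d SB3 s 0) 0 0) 0 0"
      by (rule no_base_pointI[OF B v1 val_snd t0 _ v2 val_1]) auto
    show ?thesis
      by (rule cascades_regular_intro) (use A1 A2 B1 in blast)+
  qed
  show ?thesis
    by (rule cascades_regular_intro) (use 1 2 3 in blast)+
qed

lemma SB3_root_irregular:
  assumes "cascades_regular d SB3 s 0"
  shows "d s = 0"
proof (rule ccontr)
  assume "d s \<noteq> 0"
  then have s0: "s' \<noteq> 0" using x_nonzero by (simp add: s'_def)
  have mu: "2 * s - k \<noteq> 0"
  proof
    assume "2 * s - k = 0"
    then have "k = 2 * s" by simp
    then have "D (i k) = 2 * D (i s)" by (simp add: D_mult)
    moreover have "D (i k) = 0" unfolding k_def i_simps(3) D_add D_i dk0 dkt by simp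
    ultimately have "D (i s) = 0" by simp
    with s0 show False by (simp add: D_i s'_def)
  qed
  define u v where "u = W - i s" and "v = r / (W - i s)"
  note uv = SB3_root_uv[folded u_def v_def]
  have ind: "indep u v" using uv(1) by (simp add: realizes_def)
  have nz: "u \<noteq> 0" "v \<noteq> 0" using indep_nonzero[OF ind] by auto
  have W: "W = i s + u" by (simp add: u_def)
  have vD: "val u v (D v * u) 0 c (c * s')" for c
  proof -
    have Wr: "reg u v W 0 c" "reg u v r 0 c" unfolding W uv(2) by (intro reg_intros)+
    obtain e f where ef: "val u v R1 0 c e" "val u v R2 0 c f"
      using R_reg[OF Wr] unfolding reg_def by metis
    show ?thesis unfolding uv(4) by (rule val_eq, (rule ef val_intros)+, simp)
  qed
  have "base_point (blowup_uv d SB3 s 0) 0 0"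
    by (rule base_point_fst_pole[OF uv(1) _ vD[of 1]]) (use vD[of 0] s0 in auto)
  with cascades_regular_cases(2)[OF assms] have cas: "cascades_regular d (blowup_uv d SB3 s 0) 0 0" by blast
  define a where "a = u / v"
  have A: "realizes (blowup_UV d (blowup_uv d SB3 s 0) 0 0) a v"
    using realizes_blowup_UV[OF uv(1), of 0 0] by (simp add: a_def)
  have indA: "indep a v" using A by (simp add: realizes_def)
  have a0: "a \<noteq> 0" using indep_nonzero[OF indA] by simp
  have u: "u = a * v" using nz by (simp add: a_def)
  have Dva: "D v * a = a * (- 1 + v * R2 - v\<^sup>2 * R1) + i s'"
  proof -
    have "D v * a * v = (a * (- 1 + v * R2 - v\<^sup>2 * R1) + i s') * v" using uv(4) unfolding u by algebra
    then show ?thesis using nz by simp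
  qed
  have "D a * v = D u - a * D v" by (rule D_quotient[OF u])
  then have Dav: "D a * v\<^sup>2 = - (i (2 * s - k) + u) + u * v\<^sup>2 * R1 - v * i s' - v * (D v * a)"
    using uv(3) by algebra
  have vA: "val a v (D v * a) c 0 (s' - c)" "val a v (D a * v\<^sup>2) c 0 (- (2 * s - k))" for c
  proof -
    have Ar: "reg a v W c 0" "reg a v r c 0"
      unfolding W uv(2) unfolding u by (intro reg_intros)+
    obtain e f where ef: "val a v R1 c 0 e" "val a v R2 c 0 f"
      using R_reg[OF Ar] unfolding reg_def by metis
    show 1: "val a v (D v * a) c 0 (s' - c)"
      unfolding Dva by (rule val_eq, (rule ef val_intros)+, simp)
    have "val a v u c 0 0" unfolding u by (rule val_eq, (rule val_intros)+, simp)
    then show "val a v (D a * v\<^sup>2) c 0 (- (2 * s - k))"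
      unfolding Dav by - (rule val_eq, (rule 1 ef val_intros | assumption)+, simp)
  qed
  have k2: "val a v (v\<^sup>2) c 0 0" for c by (rule val_eq, (rule val_intros)+, simp)
  have A1: "\<not> base_point (blowup_UV d (blowup_uv d SB3 s 0) 0 0) c 0" for c
    by (rule no_base_pointI[OF A vA(2) k2 _ _ vA(1) val_fst]) (use nz a0 mu s0 in auto)
  have A2: "\<not> regular_system_at (blowup_UV d (blowup_uv d SB3 s 0) 0 0) 0 0"
    unfolding regular_system_at_iff[OF A] using not_reg_pole[OF indA vA(2)[of 0] k2[of 0]] mu by simp
  define t where "t = v / u"
  have B: "realizes (blowup_uv d (blowup_uv d SB3 s 0) 0 0) u t"
    using realizes_blowup_uv[OF uv(1), of 0 0] by (simp add: t_def)
  have indB: "indep u t" using B by (simp add: realizes_def)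
  have t0: "t \<noteq> 0" using nz by (simp add: t_def)
  have v: "v = t * u" using nz by (simp add: t_def)
  have Br: "reg u t W 0 0" "reg u t r 0 0"
    unfolding W uv(2) unfolding v by (intro reg_intros)+
  obtain e f where ef: "val u t R1 0 0 e" "val u t R2 0 0 f"
    using R_reg[OF Br] unfolding reg_def by metis
  have vv: "val u t v 0 0 0" unfolding v by (rule val_eq, (rule val_intros)+, simp)
  have v1: "val u t (D u * v) 0 0 (- (2 * s - k))"
    unfolding uv(3) by (rule val_eq, (rule ef vv val_intros)+, simp)
  have "D t * u = D v - t * D u" by (rule D_quotient[OF v])
  then have Dt: "D t * u\<^sup>2 = u * (- 1 + v * R2 - v\<^sup>2 * R1) + v * i s' - D u * v"
    using uv(4) v by algebra
  have v2: "val u t (D t * u\<^sup>2) 0 0 (2 * s - k)"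
    unfolding Dt by (rule val_eq, (rule ef vv v1 val_intros)+, simp)
  have k3: "val u t (u\<^sup>2) 0 0 0" by (rule val_eq, (rule val_intros)+, simp)
  have B1: "\<not> base_point (blowup_uv d (blowup_uv d SB3 s 0) 0 0) 0 0"
    by (rule no_base_pointI[OF B v1 vv nz(2) _ v2 k3]) (use nz mu in auto)
  have B2: "\<not> regular_system_at (blowup_uv d (blowup_uv d SB3 s 0) 0 0) 0 0"
    unfolding regular_system_at_iff[OF B] using not_reg_pole[OF indB v2 k3] mu by simp
  show False
    using cascades_regular_cases(3)[OF cas] A1 A2 B1 B2 by blast
qed

end

lemma infinity_regular:
  assumes s: "ka = s * (k - s)" and ds: "d s = 0"
  shows "cascades_regular d (chart_UV S) 0 0"
proof -
  have "D (i (k - s)) = 0"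
    unfolding k_def i_simps D_diff D_add D_i dk0 dkt ds by simp
  then have ds': "d (k - s) = 0" using x_nonzero by (simp add: D_i del: i_simps)
  have 1: "cascades_regular d SB3 c 0" if "base_point SB3 c 0" for c
  proof -
    have "ka = c * (k - c)" by (rule SB3_base_points(2)[OF that])
    moreover have "(c - s) * (c - (k - s)) = 0"
      using s \<open>ka = c * (k - c)\<close> by (simp add: algebra_simps)
    then have "d c = 0" using ds ds' by auto
    ultimately show ?thesis by (rule SB3_root_regular)
  qed
  have 2: "cascades_regular d SB2 (- p) 0"
    by (rule cascades_regular_intro) (use 1 SB3_uv(1) SB3_base_points(1)[OF s] in blast)+
  have 3: "cascades_regular d SB1 0 0"
    by (rule cascades_regular_intro) (metis 2 SB2_uv SB2_base_points)+
  show ?thesis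
    by (rule cascades_regular_intro) (metis 3 SB1_uv SB1_base_points chart_UV_base_points)+
qed

lemma infinity_irregular:
  assumes "cascades_regular d (chart_UV S) 0 0"
  shows "d ka = 0"
proof -
  have "cascades_regular d SB1 0 0"
    using cascades_regular_cases(1)[OF assms] SB1_base_points by blast
  from cascades_regular_cases(1)[OF this SB2_base_points(1)]
  have c2: "cascades_regular d SB2 (- p) 0" .
  have "\<exists>s. ka = s * (k - s)"
  proof (rule ccontr)
    assume no: "\<nexists>s. ka = s * (k - s)"
    have 1: "\<forall>c. \<not> base_point SB3 c 0" using SB3_base_points(2) no by blast
    have "- (0\<^sup>2 - k * 0 + ka) \<noteq> 0" using no[unfolded not_ex, rule_format, of 0] by simp
    moreover have "indep W r" using SB3_realizes by (simp add: realizes_def)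
    ultimately have "\<not> reg W r (D W) 0 0"
      using not_reg_pole[OF _ SB3_vals(1)[of 0]] val_r_power[of W 1 0] by simp
    then have 2: "\<not> regular_system_at SB3 0 0"
      unfolding regular_system_at_iff[OF SB3_realizes] by simp
    show False
      using cascades_regular_cases(3)[OF c2] 1 2 SB3_uv by blast
  qed
  then obtain s where s: "ka = s * (k - s)" by blast
  from cascades_regular_cases(1)[OF c2 SB3_base_points(1)[OF s]]
  have "d s = 0" by (rule SB3_root_irregular[OF s])
  then have "D (i ka) = 0"
    unfolding s k_def i_simps D_mult D_diff D_add D_i dk0 dkt by simp
  then show ?thesis using x_nonzero by (simp add: D_i del: i_simps)
qed


subsection \<open>The points at infinity of the lines \<open>z = const\<close>\<close>

definition "vA = Z / Y"
definition "zv = Z\<^sup>2 + i p * vA"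

abbreviation "SA \<equiv> blowup_UV d (chart_uv S) 0 0"
abbreviation "SAz \<equiv> blowup_uv d (chart_uv S) 0 0"

lemma DZ_eq: "D Z = okF (i k0) (i kt) (i h) (Z + i q) z5 - i fq"
  by (simp add: DZ fq_def z5_def)

lemma DT_eq: "D (Y * Z) = okG (i k0) (i kt) (i h) (i ka) (Z + i q) z5 - i gq"
  by (simp only: DT gq_def z5_def)

lemma vA_nonzero: "vA \<noteq> 0"
  using YZ_nonzero by (simp add: vA_def)

lemma z5_vA: "z5 * vA = zv"
  using YZ_nonzero by (simp add: z5_def zv_def vA_def power2_eq_square algebra_simps)

lemma SA_realizes: "realizes SA r vA"
  using realizes_blowup_UV[OF realizes_chart_uv[OF S], of 0 0] YZ_nonzero
  by (simp add: r_def vA_def)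

lemma SAz_realizes: "realizes SAz (1 / Y) Z"
  using realizes_blowup_uv[OF realizes_chart_uv[OF S], of 0 0] YZ_nonzero
  by simp

lemma Dr_A: "D r * vA * r = - (2 * g0 * g1\<^sup>2 * zv - r * b2 * vA - r ^ 3 * i fq * vA)"
proof -
  have "D r * vA * r = (D r * r) * vA" by simp
  also have "\<dots> = - (2 * g0 * g1\<^sup>2 * (z5 * vA) - r * b2 * vA - r ^ 3 * i fq * vA)"
    unfolding Dr_r by (simp add: algebra_simps)
  finally show ?thesis unfolding z5_vA .
qed

lemma DvA: "D vA = - 2 * vA * Z * D r + g1 * (3 * g0 - r) * zv\<^sup>2 - r * b1 * zv * vA
   + r\<^sup>2 * vA\<^sup>2 * i (ka + gq)"
proof -
  have e: "vA * r\<^sup>2 * (z5 - i p) = 1"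
    using YZ_nonzero by (simp add: vA_def r_def z5_def power2_eq_square)
  then have "D (vA * r\<^sup>2 * (z5 - i p)) = 0" by simp
  then have "(D vA * r\<^sup>2 + vA * (2 * r * D r)) * (z5 - i p) + vA * r\<^sup>2 * (D z5 - i gq) = 0"
    by (simp only: D_mult D_diff D_power2 D_i dp gq_def)
  then have "D vA = - 2 * vA * Z * D r - vA\<^sup>2 * r\<^sup>2 * (D z5 - i gq)"
    using e Zr by algebra
  also have "vA\<^sup>2 * r\<^sup>2 * (D z5 - i gq) = (D z5 * r\<^sup>2) * vA\<^sup>2 - vA\<^sup>2 * r\<^sup>2 * i gq"
    by (simp add: algebra_simps)
  finally show ?thesis
    unfolding DT_r z5_vA[symmetric] by (simp add: power2_eq_square algebra_simps)
qed

lemma Z_val: "indep U V \<Longrightarrow> val U V r a b c \<Longrightarrow> c \<noteq> 0 \<Longrightarrow> val U V Z a b (1 / c)"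
  using val_divide[OF val_1, of U V r a b c] by (simp add: r_def)

lemma SA_base_points:
  assumes "1 + q * c \<noteq> 0" "1 + (q - 1) * c \<noteq> 0"
  shows "\<not> base_point SA c 0"
proof -
  have ind: "indep r vA" using SA_realizes by (simp add: realizes_def)
  note rv = r_vals[OF val_fst[of r vA c 0]]
  have z: "zv * r\<^sup>2 = 1 + i p * r\<^sup>2 * vA"
    using Zr unfolding zv_def by algebra
  have 1: "D r * (r ^ 3 * vA) = - (2 * g0 * g1\<^sup>2 * (1 + i p * r\<^sup>2 * vA) - r ^ 3 * b2 * vA - r ^ 5 * i fq * vA)"
    unfolding z[symmetric] using Dr_A by algebra
  have v1: "val r vA (D r * (r ^ 3 * vA)) c 0 (- (2 * (1 + q * c) * (1 + (q - 1) * c)\<^sup>2))"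
    unfolding 1 by (rule val_eq, (rule rv val_intros)+, simp)
  have 2: "D vA * r ^ 4 = - 2 * (D r * (r ^ 3 * vA)) + g1 * (3 * g0 - r) * (1 + i p * r\<^sup>2 * vA)\<^sup>2
     - r ^ 3 * b1 * (1 + i p * r\<^sup>2 * vA) * vA + r ^ 6 * vA\<^sup>2 * i (ka + gq)"
    unfolding z[symmetric] DvA using Zr by algebra
  have v2: "val r vA (D vA * r ^ 4) c 0 (4 * (1 + q * c) * (1 + (q - 1) * c)\<^sup>2
      + (1 + (q - 1) * c) * (3 * (1 + q * c) - c))"
    unfolding 2 by (rule val_eq, (rule rv v1 val_intros)+, simp)
  have k: "val r vA (r ^ 3 * vA) c 0 0" "val r vA (r ^ 4) c 0 (c ^ 4)"
    by (rule val_eq, (rule val_intros)+, simp)+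
  have nz: "- (2 * (1 + q * c) * (1 + (q - 1) * c)\<^sup>2) \<noteq> 0"
    using assms by (simp only: mult_eq_0_iff neg_equal_0_iff_equal power_eq_0_iff) simp
  show ?thesis
    by (rule no_base_pointI[OF SA_realizes v1 k(1) _ disjI1[OF nz] v2 k(2)])
      (use YZ_nonzero vA_nonzero in auto)
qed

lemma SAz_base_point: "base_point SAz 0 0"
proof -
  define u where "u = 1 / Y"
  have zu: "z5 * u = Z + i p * u" using YZ_nonzero by (simp add: z5_def u_def field_simps)
  have 1: "D Z * u = 2 * (Z + i q) * (Z + i q - 1)\<^sup>2 * (Z + i p * u)
     - u * (i k0 * (Z + i q - 1)\<^sup>2 + i kt * (Z + i q) * (Z + i q - 1) - i h * (Z + i q)) - u * i fq"
    unfolding zu[symmetric] DZ_eq okF_def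
    by (simp add: algebra_simps)
  have v: "val u Z (D Z * u) 0 c (2 * (c + q) * (c + q - 1)\<^sup>2 * c)" for c
    unfolding 1 by (rule val_eq, (rule val_intros)+, simp)
  obtain c where c: "c \<notin> {0, - q, 1 - q}"
    using ex_new_if_finite[OF infinite_UNIV_char_0, of "{0, - q, 1 - q}"] by auto
  have "c + q \<noteq> 0" "c - (1 - q) \<noteq> 0" "c \<noteq> 0" using c by (simp_all add: add_eq_0_iff2)
  moreover have "c + q - 1 = c - (1 - q)" by simp
  ultimately have "2 * (c + q) * (c + q - 1)\<^sup>2 * c \<noteq> 0"
    by (simp only: mult_eq_0_iff power_eq_0_iff) simp
  then show ?thesis
    using base_point_fst_pole[OF SAz_realizes[folded u_def], of c] v[of 0] v[of c] by auto
qed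

lemma SAz_regular: "cascades_regular d SAz 0 0"
proof -
  have T0: "Y * Z \<noteq> 0" using YZ_nonzero by simp
  define u where "u = 1 / (Y * Z)"
  have A: "realizes (blowup_UV d SAz 0 0) u Z"
    using realizes_blowup_UV[OF SAz_realizes, of 0 0] by (simp add: u_def)
  have u0: "u \<noteq> 0" using T0 by (simp add: u_def)
  have zu: "z5 * u = 1 + i p * u" using YZ_nonzero by (simp add: z5_def u_def field_simps)
  have "D u = - u\<^sup>2 * D (Y * Z)"
    unfolding u_def D_inverse[OF T0] by (simp add: power_divide)
  then have Du: "D u = (Z + i q - 1) * (3 * (Z + i q) - 1) * (1 + i p * u)\<^sup>2
     - (1 + i p * u) * u * (2 * i k0 * (Z + i q - 1) + i kt * (2 * (Z + i q) - 1) - i h)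
     + u\<^sup>2 * i (ka + gq)"
    unfolding zu[symmetric] DT_eq okG_def
    by (simp add: power2_eq_square algebra_simps)
  have DZu: "D Z * u = 2 * (Z + i q) * (Z + i q - 1)\<^sup>2 * (1 + i p * u)
     - u * (i k0 * (Z + i q - 1)\<^sup>2 + i kt * (Z + i q) * (Z + i q - 1) - i h * (Z + i q)) - u * i fq"
    unfolding zu[symmetric] DZ_eq okF_def
    by (simp add: algebra_simps)
  have A1: "\<not> base_point (blowup_UV d SAz 0 0) c 0" for c
  proof -
    have "reg u Z (D u) c 0" unfolding Du by (intro reg_intros)
    then obtain e where "val u Z (D u * 1) c 0 e" by (auto simp: reg_def)
    moreover have "val u Z (D Z * u) c 0 (2 * q * (q - 1)\<^sup>2)"
      unfolding DZu
      by (rule val_eq, (rule val_intros)+) (simp add: fq_def okF_def, algebra)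
    ultimately show ?thesis
      using no_base_pointI[OF A, of 1 c 0 e 1 u "2 * q * (q - 1)\<^sup>2" c] val_1 val_fst u0 q0 q1 by simp
  qed
  define s t where "s = 1 / Y" and "t = Y * Z"
  have B: "realizes (blowup_uv d SAz 0 0) s t"
    using realizes_blowup_uv[OF SAz_realizes, of 0 0] by (simp add: s_def t_def mult.commute)
  have t0: "t \<noteq> 0" using T0 by (simp add: t_def)
  have Z: "Z = s * t" using YZ_nonzero by (simp add: s_def t_def)
  define E1 where "E1 = - ((Z + i q - 1) * (3 * (Z + i q) - 1) * (2 * i p + t))
     - s * (i p)\<^sup>2 * (3 * (2 * i q + Z) - 4)
     + (2 * i k0 * (Z + i q - 1) + i kt * (2 * (Z + i q) - 1) - i h) + s * i p * (2 * i k0 + 2 * i kt)"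
  define E2 where "E2 = 2 * (Z + i q) * (Z + i q - 1)\<^sup>2
     + s * (2 * i p * (3 * (i q)\<^sup>2 + 3 * i q * Z + Z\<^sup>2 - 2 * (2 * i q + Z) + 1)
       - (i k0 * (2 * (i q - 1) + Z) + i kt * (2 * i q + Z - 1) - i h))"
  have "D t = okG (i k0) (i kt) (i h) (i ka) (Z + i q) (t + i p) - i gq"
    by (simp only: t_def DT_eq z5_def)
  also have "\<dots> = t * E1"
    unfolding okG_def gq_def E1_def i_simps i_numeral i_power unfolding Z by algebra
  finally have Dt: "D t = t * E1" .
  have "D Z = okF (i k0) (i kt) (i h) (Z + i q) (t + i p) - i fq"
    by (simp only: t_def DZ_eq z5_def)
  also have "\<dots> = t * E2"
    unfolding okF_def fq_def E2_def i_simps i_numeral i_power unfolding Z by algebra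
  finally have DZ': "D Z = t * E2" .
  have "D s * t = D Z - s * D t" by (rule D_quotient[OF Z])
  then have "D s * t = (E2 - s * E1) * t" unfolding Dt DZ' by (simp add: algebra_simps)
  then have Ds: "D s = E2 - s * E1" using t0 by simp
  have r: "reg s t E1 0 c" "reg s t E2 0 c" for c
    unfolding E1_def E2_def unfolding Z by (intro reg_intros)+
  have rr: "reg s t (D s) 0 c" "reg s t (D t) 0 c" for c
    unfolding Ds Dt by (intro reg_intros r)+
  have "regular_system_at (blowup_uv d SAz 0 0) 0 c" for c
    unfolding regular_system_at_iff[OF B] by (intro conjI rr)
  moreover have "\<not> base_point (blowup_uv d SAz 0 0) 0 0"
    by (rule regular_no_base_point[OF B rr(1)[of 0] rr(2)[of 0]])
  ultimately show ?thesis
    using A1 by - (rule cascades_regular_intro, blast+)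
qed

subsection \<open>The point \<open>y5 = 0\<close>\<close>

definition "c0 = - 1 / q"
definition "U1 = (r - i c0) / vA"
abbreviation "S0 \<equiv> blowup_UV d SA c0 0"

lemma c0: "c0 \<noteq> 0" "1 + q * c0 = 0" "D (i c0) = i (fq / q\<^sup>2)"
proof -
  show "c0 \<noteq> 0" "1 + q * c0 = 0" using q0 by (auto simp: c0_def)
  have "i q * i c0 = - 1" using q0 by (simp add: c0_def)
  then have "D (i q * i c0) = D (- 1)" by simp
  then have "i fq * i c0 + i q * D (i c0) = 0"
    by (simp only: D_mult D_i[of q] D_uminus D_1 dq fq_def) simp
  then have "i q * D (i c0) = i (fq / q)" using q0 by (simp add: c0_def add_eq_0_iff)
  then show "D (i c0) = i (fq / q\<^sup>2)" using q0 by (simp add: field_simps power2_eq_square)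
qed

lemma S0_realizes: "realizes S0 U1 vA"
  using realizes_blowup_UV[OF SA_realizes, of c0 0] by (simp add: U1_def)

lemma r_U1: "r = i c0 + U1 * vA"
  using vA_nonzero by (simp add: U1_def)

lemma g0_U1: "g0 = i q * U1 * vA"
proof -
  have "1 + i q * i c0 = i (1 + q * c0)" by simp
  then have "1 + i q * i c0 = 0" unfolding c0(2) by simp
  then show ?thesis unfolding g0_def r_U1 by algebra
qed

lemma S0_vals:
  shows "val U1 vA (D U1 * vA ^ 1) c 0 (q\<^sup>2 * (c + k0 / q ^ 4))" "val U1 vA (D vA) c 0 (q\<^sup>2)"
proof -
  have ind: "indep U1 vA" using S0_realizes by (simp add: realizes_def)
  have vr: "val U1 vA r c 0 c0"
    unfolding r_U1 by (rule val_eq, (rule val_intros)+, simp)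
  have vZ: "val U1 vA Z c 0 (- q)"
    using Z_val[OF ind vr c0(1)] by (simp add: c0_def)
  have vz: "val U1 vA zv c 0 (q\<^sup>2)"
    unfolding zv_def by (rule val_eq, (rule vZ val_intros)+, simp)
  have vg0: "val U1 vA g0 c 0 0" using r_vals(1)[OF vr] c0 by simp
  have vg1: "val U1 vA g1 c 0 (1 / q)" unfolding g1_eq
    by (rule val_eq, (rule vg0 vr val_intros)+, simp add: c0_def)
  have vb2: "val U1 vA b2 c 0 (k0 / q\<^sup>2)" unfolding b2_def
    by (rule val_eq, (rule vg0 vg1 vr val_intros)+, simp add: power_divide)
  note vb1 = r_vals(4)[OF vr]
  have "D r * r * vA = - (2 * (i q * U1) * g1\<^sup>2 * zv - r * b2 - r ^ 3 * i fq) * vA"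
    using Dr_A unfolding g0_U1 by algebra
  then have "D r * r = - (2 * (i q * U1) * g1\<^sup>2 * zv - r * b2 - r ^ 3 * i fq)"
    using vA_nonzero by simp
  then have 1: "D r = - Z * (2 * (i q * U1) * g1\<^sup>2 * zv - r * b2 - r ^ 3 * i fq)"
    using Zr by algebra
  have v1: "val U1 vA (D r) c 0 (2 * q\<^sup>2 * c + k0 / q\<^sup>2 + fq / q\<^sup>2)"
    unfolding 1
    by (rule val_eq, (rule vr vZ vz vg1 vb2 val_intros)+)
      (use q0 in \<open>simp add: c0_def field_simps power2_eq_square power3_eq_cube\<close>)
  show v2: "val U1 vA (D vA) c 0 (q\<^sup>2)"
    unfolding DvA
    by (rule val_eq, (rule vr vZ vz vg0 vg1 vb1 v1 val_intros)+)
      (use q0 in \<open>simp add: c0_def field_simps power2_eq_square\<close>)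
  have "D U1 * vA = D (r - i c0) - U1 * D vA"
    by (rule D_quotient) (simp add: r_U1)
  then have 3: "D U1 * vA = D r - i (fq / q\<^sup>2) - U1 * D vA"
    unfolding D_diff c0(3) .
  have e: "q\<^sup>2 * (k0 / q ^ 4) = k0 / q\<^sup>2"
    using q0 by (simp add: power4_eq_xxxx power2_eq_square)
  show "val U1 vA (D U1 * vA ^ 1) c 0 (q\<^sup>2 * (c + k0 / q ^ 4))"
    unfolding power_one_right 3 distrib_left e
    by (rule val_eq, (rule v1 v2 val_intros)+) (simp add: mult.commute)
qed

lemma S0_uv: "\<not> base_point (blowup_uv d SA c0 0) 0 0"
proof -
  define u v where "u = r - i c0" and "v = vA / (r - i c0)"
  have R: "realizes (blowup_uv d SA c0 0) u v"
    using realizes_blowup_uv[OF SA_realizes, of c0 0] by (simp add: u_def v_def)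
  have ind: "indep u v" using R by (simp add: realizes_def)
  have nz: "u \<noteq> 0" "v \<noteq> 0" using indep_nonzero[OF ind] by auto
  have V: "vA = v * u" using nz by (simp add: u_def v_def)
  have r: "r = i c0 + u" by (simp add: u_def)
  have g0: "g0 = i q * u"
  proof -
    have "1 + i q * i c0 = i (1 + q * c0)" by simp
    then have "1 + i q * i c0 = 0" unfolding c0(2) by simp
    then show ?thesis unfolding g0_def r by algebra
  qed
  have vV: "val u v vA 0 0 0" unfolding V by (rule val_eq, (rule val_intros)+, simp)
  have vr: "val u v r 0 0 c0" unfolding r by (rule val_eq, (rule val_intros)+, simp)
  have vZ: "val u v Z 0 0 (- q)"
    using Z_val[OF ind vr c0(1)] by (simp add: c0_def)
  have vz: "val u v zv 0 0 (q\<^sup>2)"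
    unfolding zv_def by (rule val_eq, (rule vZ vV val_intros)+, simp)
  have vg0: "val u v g0 0 0 0" using r_vals(1)[OF vr] c0 by simp
  have vg1: "val u v g1 0 0 (1 / q)" unfolding g1_eq
    by (rule val_eq, (rule vg0 vr val_intros)+, simp add: c0_def)
  note vb = r_vals(3,4)[OF vr]
  have "D r * v * r * u = - (2 * i q * g1\<^sup>2 * zv - r * b2 * v - r ^ 3 * i fq * v) * u"
    using Dr_A unfolding g0 V by algebra
  then have "D r * v * r = - (2 * i q * g1\<^sup>2 * zv - r * b2 * v - r ^ 3 * i fq * v)"
    using nz by simp
  then have 1: "D r * v = - Z * (2 * i q * g1\<^sup>2 * zv - r * b2 * v - r ^ 3 * i fq * v)"
    using Zr by algebra
  have v1: "val u v (D r * v) 0 0 (2 * q\<^sup>2)"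
    unfolding 1
    by (rule val_eq, (rule vr vZ vz vg1 vb val_intros)+) (use q0 in \<open>simp add: power2_eq_square\<close>)
  have Du: "D u = D r - i (fq / q\<^sup>2)" unfolding u_def D_diff c0(3) ..
  have 2: "D u * v = D r * v - i (fq / q\<^sup>2) * v" unfolding Du by (rule left_diff_distrib)
  have v2: "val u v (D u * v) 0 0 (2 * q\<^sup>2)"
    unfolding 2 by (rule val_eq, (rule v1 val_intros)+, simp)
  have 3: "D vA = - 2 * u * Z * (D r * v) + g1 * (3 * g0 - r) * zv\<^sup>2 - r * b1 * zv * vA
   + r\<^sup>2 * vA\<^sup>2 * i (ka + gq)"
    unfolding DvA unfolding V by (simp add: algebra_simps)
  have v3: "val u v (D vA) 0 0 (q\<^sup>2)"
    unfolding 3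
    by (rule val_eq, (rule vr vV vZ vz vg0 vg1 vb v1 val_intros)+)
      (use q0 in \<open>simp add: c0_def field_simps power2_eq_square\<close>)
  have "D v * u = D vA - v * D u" by (rule D_quotient[OF V])
  then have 4: "D v * u = D vA - D u * v" by simp
  have v4: "val u v (D v * u) 0 0 (- (q\<^sup>2))"
    unfolding 4 by (rule val_eq, (rule v2 v3 val_intros)+, simp)
  show ?thesis
    by (rule no_base_pointI[OF R v2 val_snd _ _ v4 val_fst]) (use nz q0 in auto)
qed


definition "c1 = - k0 / q ^ 4"
definition "U2 = (U1 - i c1) / vA"

lemma D_y5: "D (Z + i q) = okF (i k0) (i kt) (i h) (Z + i q) z5"
  unfolding D_add DZ_eq D_i dq fq_def by simp

lemma D_z5: "D z5 = okG (i k0) (i kt) (i h) (i ka) (Z + i q) z5"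
  unfolding Dz5 DT_eq by simp

lemma U2_realizes: "realizes (blowup_UV d S0 c1 0) U2 vA"
  using realizes_blowup_UV[OF S0_realizes, of c1 0] by (simp add: U2_def)

text \<open>\<open>z5 = 1 / w\<close>, \<open>y5 = w (\<kappa>0 + t w)\<close> makes the Okamoto system polynomial in \<open>(w,t)\<close>, and \<open>w = 0\<close>
  is the last exceptional curve.\<close>

lemma S0_root_regular: "cascades_regular d S0 c1 0"
proof -
  have ind: "indep U2 vA" using U2_realizes by (simp add: realizes_def)
  have U1: "U1 = i c1 + U2 * vA" using vA_nonzero by (simp add: U2_def)
  have y5: "Z + i q = Z * i q * U1 * vA" using Zr g0_U1 unfolding g0_def by algebra
  define K where "K = i (k0 / q ^ 3)"
  have K: "K * i q ^ 3 = i k0" "i q * i c1 = - K"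
    using q0 by (simp_all add: K_def c1_def field_simps power_numeral_reduce)
  have vals: "val U2 vA r c 0 c0" "val U2 vA Z c 0 (- q)" "val U2 vA zv c 0 (q\<^sup>2)"
    "val U2 vA U1 c 0 c1" for c
  proof -
    show u: "val U2 vA U1 c 0 c1" unfolding U1 by (rule val_eq, (rule val_intros)+, simp)
    show vr: "val U2 vA r c 0 c0" unfolding r_U1 by (rule val_eq, (rule u val_intros)+, simp)
    show vZ: "val U2 vA Z c 0 (- q)" using Z_val[OF ind vr c0(1)] by (simp add: c0_def)
    show "val U2 vA zv c 0 (q\<^sup>2)" unfolding zv_def by (rule val_eq, (rule vZ val_intros)+, simp)
  qed
  have zv0: "zv \<noteq> 0" using val_nonzero[OF ind vals(3)] q0 by simp
  then have z50: "z5 \<noteq> 0" using z5_vA by auto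
  define w t where "w = 1 / z5" and "t = (Z + i q - i k0 * w) / w\<^sup>2"
  have w0: "w \<noteq> 0" using z50 by (simp add: w_def)
  have wz: "w * z5 = 1" using z50 by (simp add: w_def)
  have wv: "w * zv = vA" unfolding z5_vA[symmetric] using wz by algebra
  define s where "s = i k0 + t * w"
  have ys: "Z + i q = w * s" using w0 by (simp add: s_def t_def power2_eq_square field_simps)
  have tw: "t * w\<^sup>2 = Z + i q - i k0 * w" using w0 by (simp add: t_def)
  have vw: "val U2 vA w c 0 0" for c
  proof -
    have "w = vA / zv" using wv zv0 by (simp add: field_simps)
    then show ?thesis using val_divide[OF val_snd vals(3) _ ind] q0 by simp
  qed
  define X where "X = zv * (i q * U1 * i p * Z + i q * U2 * Z ^ 3
     - K * Z * i q * U1 * (Z\<^sup>2 - Z * i q + (i q)\<^sup>2))"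
  have tX: "t = X"
  proof -
    have 1: "i q * U1 = - K + i q * U2 * vA" unfolding U1 using K(2) by algebra
    have "K * (Z ^ 3 + i q ^ 3) = K * (Z + i q) * (Z\<^sup>2 - Z * i q + (i q)\<^sup>2)" by algebra
    then have 2: "K * (Z ^ 3 + i q ^ 3) = K * (Z * i q * U1 * vA) * (Z\<^sup>2 - Z * i q + (i q)\<^sup>2)"
      unfolding y5 .
    have 3: "Z * i q * U1 * zv - i k0 = i q * U1 * Z ^ 3 + i q * U1 * i p * Z * vA - K * i q ^ 3"
      unfolding zv_def K(1) by algebra
    have "i q * U1 * Z ^ 3 = (- K + i q * U2 * vA) * Z ^ 3" unfolding 1 ..
    with 2 3 have "(Z * i q * U1 * zv - i k0) * zv = vA * X" unfolding X_def by algebra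
    moreover have "t * vA\<^sup>2 = (Z * i q * U1 * vA) * zv\<^sup>2 - i k0 * vA * zv"
      using tw wv unfolding y5 by algebra
    ultimately have "t * vA\<^sup>2 = X * vA\<^sup>2" by algebra
    then show ?thesis using vA_nonzero by simp
  qed
  have vt: "\<exists>b. val U2 vA t c 0 b" for c
    unfolding tX X_def K_def
    by (rule exI, (rule vals val_intros)+)
  have Dw: "D w = (w * s - 1) * (3 * (w * s) - 1)
      - w * (2 * i k0 * (w * s - 1) + i kt * (2 * (w * s) - 1) - i h) + i ka * w\<^sup>2"
  proof -
    have "D w = - w\<^sup>2 * D z5"
      unfolding w_def D_inverse[OF z50] by (simp add: power_divide)
    then show ?thesis
      unfolding D_z5 ys okG_def using wz by algebra
  qed
  have Dt: "D t = (2 * s - i k0) * (- 2 * t * (w * s - 1) + 2 * i kt * s - i ka) - (i kt + i h) * t - i kt * s\<^sup>2"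
  proof -
    have "D (t * w\<^sup>2) = D (Z + i q) - i k0 * D w"
      unfolding tw D_diff D_mult D_i dk0 by simp
    then have "D t * w\<^sup>2 = 2 * (w * s) * (w * s - 1)\<^sup>2 * z5 - (i k0 * (w * s - 1)\<^sup>2 + i kt * (w * s) * (w * s - 1) - i h * (w * s))
        - i k0 * D w - t * (2 * w * D w)"
      unfolding D_y5 unfolding D_mult D_power2 ys okF_def by (simp add: algebra_simps)
    also have "\<dots> = ((2 * s - i k0) * (- 2 * t * (w * s - 1) + 2 * i kt * s - i ka) - (i kt + i h) * t - i kt * s\<^sup>2) * w\<^sup>2"
      unfolding Dw using wz s_def by algebra
    finally show ?thesis using w0 by simp
  qed
  have rw: "reg U2 vA w c 0" and rt: "reg U2 vA t c 0" for c
    using vw vt unfolding reg_def by blast+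
  have rs: "reg U2 vA s c 0" for c unfolding s_def by (intro reg_intros rw rt)
  have rD: "reg U2 vA (D w) c 0" "reg U2 vA (D t) c 0" for c
    unfolding Dw Dt by (intro reg_intros rw rt rs)+
  have vs: "val w t s 0 b k0" for b
    unfolding s_def by (rule val_eq, (rule val_intros)+, simp)
  have vZ: "val w t Z 0 b (- q)" for b
  proof -
    have Z: "Z = w * s - i q" using ys by (simp add: algebra_simps)
    show ?thesis unfolding Z by (rule val_eq, (rule vs val_intros)+, simp)
  qed
  have d0: "1 - i p * w \<noteq> 0"
  proof
    assume "1 - i p * w = 0"
    then have "z5 - i p = 0" using wz by algebra
    then show False using YZ_nonzero by (simp add: z5_def)
  qed
  have vd: "val w t (1 - i p * w) 0 b 1" for b
    by (rule val_eq, (rule val_intros)+, simp)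
  have vAw: "vA * (1 - i p * w) = w * Z\<^sup>2"
    using wv unfolding zv_def by (simp add: algebra_simps)
  have rV: "reg w t vA 0 b" for b
  proof -
    have v: "vA = w * Z\<^sup>2 / (1 - i p * w)" using vAw d0 by (simp add: field_simps)
    have "val w t (w * Z\<^sup>2) 0 b 0" by (rule val_eq, (rule vZ val_intros)+, simp)
    from val_divide_nonzero[OF this vd _ d0] show ?thesis unfolding v[symmetric] by (auto intro: regI)
  qed
  have rU: "reg w t U2 0 b" for b
  proof -
    define N where "N = (i q ^ 3 * (t - i p * s) + i k0 * (3 * (i q)\<^sup>2 * s - 3 * i q * w * s\<^sup>2 + w\<^sup>2 * s ^ 3)) * (1 - i p * w)"
    have "U1 * i q * Z ^ 3 * w = s * (1 - i p * w) * w"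
      using vAw y5 ys by algebra
    then have 1: "U1 * i q * Z ^ 3 = s * (1 - i p * w)" using w0 by simp
    have 2: "U2 * (w * Z\<^sup>2) = (U1 - i c1) * (1 - i p * w)"
      unfolding vAw[symmetric] U1 by simp
    have 3: "i q ^ 4 * i c1 = - i k0" using q0 by (simp add: c1_def)
    have "U2 * (i q ^ 4 * Z ^ 5) * w = N * w"
      using 1 2 3 ys s_def unfolding N_def by algebra
    then have U2: "U2 = N / (i q ^ 4 * Z ^ 5)" using w0 q0 YZ_nonzero by (simp add: field_simps)
    have "val w t (i q ^ 4 * Z ^ 5) 0 b (q ^ 4 * (- q) ^ 5)"
      by (intro val_intros vZ val_mult val_power)
    moreover have "\<exists>e. val w t N 0 b e"
      unfolding N_def by (rule exI, (rule vs val_intros)+)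
    ultimately show ?thesis
      unfolding U2 reg_def using val_divide_nonzero[of w t N 0 b _ "i q ^ 4 * Z ^ 5"] q0 YZ_nonzero by fastforce
  qed
  have r1: "reg U2 vA (D U2) c 0" and r2: "reg U2 vA (D vA) c 0" for c
  proof -
    obtain b where b: "val U2 vA t c 0 b" using vt by blast
    show "reg U2 vA (D U2) c 0" "reg U2 vA (D vA) c 0"
      using reg_deriv[OF ind vw b _ rD] rU rV by blast+
  qed
  show ?thesis
    by (rule resonant_blowup(1)[OF S0_realizes _ S0_vals(2) _ r1[unfolded U2_def] r2[unfolded U2_def]])
      (use regI[OF S0_vals(1)] q0 in auto)
qed

lemma SA_c0_regular: "cascades_regular d SA c0 0"
proof -
  have V: "val U1 vA (vA ^ 1) c 0 0" for c by (rule val_eq, (rule val_intros)+, simp)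
  have "base_point S0 c1 0"
    by (rule base_point_snd_pole[OF S0_realizes _ S0_vals(1)[of "c1 + 1"]])
      (use S0_vals(1)[of c1] q0 in \<open>auto simp: c1_def\<close>)
  moreover have "c = c1" if "base_point S0 c 0" for c
  proof (rule ccontr)
    assume "c \<noteq> c1"
    then have "c + k0 / q ^ 4 \<noteq> 0" by (simp add: c1_def add_eq_0_iff2)
    then have 1: "q\<^sup>2 * (c + k0 / q ^ 4) \<noteq> 0" using q0 by simp
    have "val U1 vA (D vA * 1) c 0 (q\<^sup>2)" using S0_vals(2) by simp
    from no_base_pointI[OF S0_realizes S0_vals(1) V _ disjI1[OF 1] this val_1] that vA_nonzero
    show False by simp
  qed
  ultimately show ?thesis
    using S0_root_regular S0_uv by - (rule cascades_regular_intro, blast+)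
qed


subsection \<open>The point \<open>y5 = 1\<close>\<close>

definition "ee = q - 1"
definition "e1 = - 1 / ee"
definition "n = 1 + kt"
definition "c2 = - h / ee ^ 6"
definition "c3 = (n * ee - 4 * h) * h / ee ^ 11"

abbreviation "SN \<equiv> blowup_uv d SA e1 0"

definition "u1 = r - i e1"
definition "v1 = vA / u1"

lemma ee: "ee \<noteq> 0" "1 + ee * e1 = 0" "e1 \<noteq> 0" "D (i e1) = i (fq / ee\<^sup>2)"
proof -
  show e: "ee \<noteq> 0" "1 + ee * e1 = 0" "e1 \<noteq> 0" using q1 by (auto simp: ee_def e1_def)
  have "i ee * i e1 = - 1" using e by (simp add: e1_def)
  then have "D (i ee * i e1) = D (- 1)" by simp
  moreover have "D (i ee) = i fq" unfolding ee_def i_simps D_diff D_i dq fq_def by simp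
  ultimately have "i fq * i e1 + i ee * D (i e1) = 0"
    by (simp only: D_mult D_uminus D_1) simp
  then have "i ee * D (i e1) = i (fq / ee)" using e by (simp add: e1_def add_eq_0_iff)
  then show "D (i e1) = i (fq / ee\<^sup>2)" using e by (simp add: field_simps power2_eq_square)
qed

lemma g1_ee: "g1 = 1 + i ee * r"
  by (simp add: g1_def ee_def)

lemma g1_factor: "r = i e1 + u \<Longrightarrow> g1 = i ee * u"
proof -
  assume r: "r = i e1 + u"
  have "1 + i ee * i e1 = i (1 + ee * e1)" by simp
  then have "1 + i ee * i e1 = 0" unfolding ee(2) by simp
  then show ?thesis unfolding g1_ee r by algebra
qed

lemma e1_vals:
  assumes "indep U V" "val U V r a b e1" "val U V vA a b 0"
  shows "val U V g1 a b 0" "val U V g0 a b e1" "val U V b2 a b (- h * e1\<^sup>2)"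
    "val U V Z a b (- ee)" "val U V zv a b (ee\<^sup>2)"
proof -
  show g1: "val U V g1 a b 0" unfolding g1_ee
    by (rule val_eq, (rule assms val_intros)+, simp add: ee)
  have g0: "g0 = g1 + r" by (simp add: g1_eq)
  show vg0: "val U V g0 a b e1" unfolding g0
    by (rule val_eq, (rule g1 assms val_intros)+, simp)
  show "val U V b2 a b (- h * e1\<^sup>2)" unfolding b2_def
    by (rule val_eq, (rule g1 vg0 assms val_intros)+, simp add: power2_eq_square)
  show Z: "val U V Z a b (- ee)" using Z_val[OF assms(1,2) ee(3)] by (simp add: e1_def)
  show "val U V zv a b (ee\<^sup>2)" unfolding zv_def
    by (rule val_eq, (rule Z assms val_intros)+, simp)
qed

lemma SN_UV: "\<not> base_point (blowup_UV d SA e1 0) c 0"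
proof -
  define u where "u = (r - i e1) / vA"
  have R: "realizes (blowup_UV d SA e1 0) u vA"
    using realizes_blowup_UV[OF SA_realizes, of e1 0] by (simp add: u_def)
  have ind: "indep u vA" using R by (simp add: realizes_def)
  have r: "r = i e1 + u * vA" using vA_nonzero by (simp add: u_def)
  have vr: "val u vA r c 0 e1" unfolding r by (rule val_eq, (rule val_intros)+, simp)
  note v = e1_vals[OF ind vr val_snd]
  note vb1 = r_vals(4)[OF vr]
  have "D r * r * vA = - (2 * g0 * (i ee)\<^sup>2 * u\<^sup>2 * vA * zv - r * b2 - r ^ 3 * i fq) * vA"
    using Dr_A unfolding g1_factor[OF r] by algebra
  then have "D r * r = - (2 * g0 * (i ee)\<^sup>2 * u\<^sup>2 * vA * zv - r * b2 - r ^ 3 * i fq)"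
    using vA_nonzero by simp
  then have 1: "D r = - Z * (2 * g0 * (i ee)\<^sup>2 * u\<^sup>2 * vA * zv - r * b2 - r ^ 3 * i fq)"
    using Zr by algebra
  have v1: "val u vA (D r) c 0 ((fq - h) / ee\<^sup>2)"
    unfolding 1
    by (rule val_eq, (rule vr v val_intros)+)
      (use ee in \<open>simp add: e1_def field_simps power2_eq_square power3_eq_cube\<close>)
  have v2: "val u vA (D vA) c 0 0"
    unfolding DvA by (rule val_eq, (rule vr v vb1 v1 val_intros)+, simp)
  have "D u * vA = D (r - i e1) - u * D vA" by (rule D_quotient) (simp add: r)
  then have 3: "D u * vA = D r - i (fq / ee\<^sup>2) - u * D vA" unfolding D_diff ee(4) .
  have v3: "val u vA (D u * vA) c 0 (- h / ee\<^sup>2)"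
    unfolding 3 by (rule val_eq, (rule v1 v2 val_intros)+, simp add: diff_divide_distrib)
  have v2': "val u vA (D vA * 1) c 0 0" using v2 by simp
  show ?thesis
    by (rule no_base_pointI[OF R v3 val_snd _ _ v2' val_1]) (use vA_nonzero h0 ee in auto)
qed

lemma SN_realizes: "realizes SN u1 v1"
  using realizes_blowup_uv[OF SA_realizes, of e1 0] by (simp add: u1_def v1_def)

lemma SN_nonzero: "u1 \<noteq> 0" "v1 \<noteq> 0"
  using indep_nonzero SN_realizes by (auto simp: realizes_def)

lemma r_u1: "r = i e1 + u1"
  by (simp add: u1_def)

lemma vA_u1: "vA = v1 * u1"
  using SN_nonzero by (simp add: v1_def)

lemmas g1_u1 = g1_factor[OF r_u1]

lemma Du1: "D u1 = D r - i (fq / ee\<^sup>2)"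
  unfolding u1_def D_diff ee(4) ..

lemma Dv1: "D v1 * u1 = D vA - v1 * D u1"
  by (rule D_quotient[OF vA_u1])

lemma Dr_u1: "D r * v1 = - Z * (2 * g0 * (i ee)\<^sup>2 * u1 * zv - r * b2 * v1 - r ^ 3 * i fq * v1)"
proof -
  have "D r * v1 * r * u1 = - (2 * g0 * (i ee)\<^sup>2 * u1 * zv - r * b2 * v1 - r ^ 3 * i fq * v1) * u1"
    using Dr_A unfolding g1_u1 vA_u1 by algebra
  then have "D r * v1 * r = - (2 * g0 * (i ee)\<^sup>2 * u1 * zv - r * b2 * v1 - r ^ 3 * i fq * v1)"
    using SN_nonzero by simp
  then show ?thesis using Zr by algebra
qed

lemma SN_base_point: "base_point SN 0 0"
proof -
  have ind: "indep u1 v1" using SN_realizes by (simp add: realizes_def)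
  have v: "val u1 v1 (D v1 * u1) 0 c (h * c / ee\<^sup>2)" for c
  proof -
    have vr: "val u1 v1 r 0 c e1" unfolding r_u1 by (rule val_eq, (rule val_intros)+, simp)
    have vV: "val u1 v1 vA 0 c 0" unfolding vA_u1 by (rule val_eq, (rule val_intros)+, simp)
    note v = e1_vals[OF ind vr vV]
    note vb1 = r_vals(4)[OF vr]
    have v1: "val u1 v1 (D r * v1) 0 c ((fq - h) * c / ee\<^sup>2)"
      unfolding Dr_u1
      by (rule val_eq, (rule vr v val_intros)+)
        (use ee in \<open>simp add: e1_def field_simps power2_eq_square power3_eq_cube\<close>)
    have 1: "D vA = - 2 * u1 * Z * (D r * v1) + g1 * (3 * g0 - r) * zv\<^sup>2 - r * b1 * zv * vA
       + r\<^sup>2 * vA\<^sup>2 * i (ka + gq)"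
      unfolding DvA unfolding vA_u1 by (simp add: algebra_simps)
    have v2: "val u1 v1 (D vA) 0 c 0"
      unfolding 1 by (rule val_eq, (rule vr vV v vb1 v1 val_intros)+, simp)
    have 2: "D v1 * u1 = D vA - (D r * v1 - i (fq / ee\<^sup>2) * v1)"
      unfolding Dv1 Du1 by (simp add: right_diff_distrib mult.commute)
    show ?thesis
      unfolding 2 by (rule val_eq, (rule v1 v2 val_intros)+) (simp add: diff_divide_distrib left_diff_distrib)
  qed
  show ?thesis
    by (rule base_point_fst_pole[OF SN_realizes _ v[of 1]]) (use v[of 0] h0 ee in auto)
qed

definition "A2 = u1 / v1"
abbreviation "SN2 \<equiv> blowup_UV d SN 0 0"

lemma SN2_realizes: "realizes SN2 A2 v1"
  using realizes_blowup_UV[OF SN_realizes, of 0 0] by (simp add: A2_def)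

lemma u1_A2: "u1 = A2 * v1"
  using SN_nonzero by (simp add: A2_def)

lemma SN2_vals:
  "val A2 v1 (D A2 * v1) c 0 (- 2 * ee ^ 4 * (c - c2))" "val A2 v1 (D v1 * A2) c 0 (h / ee\<^sup>2)"
proof -
  have ind: "indep A2 v1" using SN2_realizes by (simp add: realizes_def)
  have vu: "val A2 v1 u1 c 0 0" unfolding u1_A2 by (rule val_eq, (rule val_intros)+, simp)
  have vr: "val A2 v1 r c 0 e1" unfolding r_u1 by (rule val_eq, (rule vu val_intros)+, simp)
  have vV: "val A2 v1 vA c 0 0" unfolding vA_u1 by (rule val_eq, (rule vu val_intros)+, simp)
  note v = e1_vals[OF ind vr vV]
  note vb1 = r_vals(4)[OF vr]
  have "D r * v1 = - Z * (2 * g0 * (i ee)\<^sup>2 * A2 * zv - r * b2 - r ^ 3 * i fq) * v1"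
    unfolding Dr_u1 u1_A2 by (simp add: algebra_simps)
  then have 1: "D r = - Z * (2 * g0 * (i ee)\<^sup>2 * A2 * zv - r * b2 - r ^ 3 * i fq)"
    using SN_nonzero mult_right_cancel by blast
  have v1: "val A2 v1 (D r) c 0 (- 2 * ee ^ 4 * c + (fq - h) / ee\<^sup>2)"
    unfolding 1
    by (rule val_eq, (rule vr v val_intros)+)
      (use ee in \<open>simp add: e1_def field_simps power2_eq_square power3_eq_cube power4_eq_xxxx\<close>)
  have v2: "val A2 v1 (D u1) c 0 (- 2 * ee ^ 4 * c - h / ee\<^sup>2)"
    unfolding Du1 by (rule val_eq, (rule v1 val_intros)+) (simp add: diff_divide_distrib)
  define E where "E = - 2 * A2 * v1 * Z * D r + i ee * A2 * (3 * g0 - r) * zv\<^sup>2 - r * b1 * zv * A2 * v1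
       + r\<^sup>2 * A2 * v1 * vA * i (ka + gq)"
  have E: "D vA = E * v1"
    unfolding DvA E_def g1_u1 unfolding vA_u1 u1_A2 by (simp add: power2_eq_square algebra_simps)
  have vE: "val A2 v1 E c 0 (- 2 * ee ^ 4 * c)"
    unfolding E_def
    by (rule val_eq, (rule vr vV v vb1 v1 val_intros)+)
      (use ee in \<open>simp add: e1_def field_simps power2_eq_square power4_eq_xxxx\<close>)
  have "D v1 * A2 * v1 = (E - D u1) * v1"
    using Dv1 unfolding E u1_A2 by (simp add: algebra_simps)
  then have 2: "D v1 * A2 = E - D u1" using SN_nonzero by simp
  show v3: "val A2 v1 (D v1 * A2) c 0 (h / ee\<^sup>2)"
    unfolding 2 by (rule val_eq, (rule vE v2 val_intros)+, simp)
  have "D A2 * v1 = D u1 - A2 * D v1" by (rule D_quotient[OF u1_A2])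
  then have 3: "D A2 * v1 = D u1 - D v1 * A2" by simp
  have e: "ee ^ 4 * c2 = - h / ee\<^sup>2"
    using ee by (simp add: c2_def field_simps power_numeral_reduce)
  show "val A2 v1 (D A2 * v1) c 0 (- 2 * ee ^ 4 * (c - c2))"
    unfolding 3
    by (rule val_eq, (rule v2 v3 val_intros)+) (use e in \<open>simp add: algebra_simps\<close>)
qed

lemma c2_nonzero: "c2 \<noteq> 0"
  using h0 ee by (simp add: c2_def)

lemma SN2_val_snd: "val A2 v1 (D v1) c2 0 (- (ee ^ 4))"
proof -
  have ind: "indep A2 v1" using SN2_realizes by (simp add: realizes_def)
  have "A2 \<noteq> 0" using indep_nonzero[OF ind] by simp
  then have e: "D v1 = (D v1 * A2) / A2" by simp
  have "val A2 v1 ((D v1 * A2) / A2) c2 0 (h / ee\<^sup>2 / c2)"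
    by (rule val_divide[OF SN2_vals(2) val_fst c2_nonzero ind])
  moreover have "h / ee\<^sup>2 / c2 = - (ee ^ 4)"
    using h0 ee by (simp add: c2_def field_simps power_numeral_reduce)
  ultimately show ?thesis using e by simp
qed

lemma SN2_base_points: "base_point SN2 c2 0" "base_point SN2 c 0 \<Longrightarrow> c = c2"
proof -
  have v: "val A2 v1 (D A2 * v1 ^ 1) c 0 (- 2 * ee ^ 4 * (c - c2))" for c
    using SN2_vals(1) by simp
  show "base_point SN2 c2 0"
    by (rule base_point_snd_pole[OF SN2_realizes _ v[of "c2 + 1"]]) (use v[of c2] ee in auto)
  show "c = c2" if "base_point SN2 c 0"
  proof (rule ccontr)
    assume "c \<noteq> c2"
    then have 1: "- 2 * ee ^ 4 * (c - c2) \<noteq> 0" using ee by simp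
    have 2: "h / ee\<^sup>2 \<noteq> 0" using h0 ee by simp
    have "A2 \<noteq> 0" using SN_nonzero by (simp add: A2_def)
    with no_base_pointI[OF SN2_realizes SN2_vals(1) val_snd _ disjI1[OF 1] SN2_vals(2) val_fst _ disjI1[OF 2]]
      that SN_nonzero show False by simp
  qed
qed

lemma SN2_uv: "\<not> base_point (blowup_uv d SN 0 0) 0 0"
proof -
  define t where "t = v1 / u1"
  have R: "realizes (blowup_uv d SN 0 0) u1 t"
    using realizes_blowup_uv[OF SN_realizes, of 0 0] by (simp add: t_def)
  have ind: "indep u1 t" using R by (simp add: realizes_def)
  have t0: "t \<noteq> 0" using indep_nonzero[OF ind] by simp
  have v1: "v1 = t * u1" using SN_nonzero by (simp add: t_def)
  have vr: "val u1 t r 0 0 e1" unfolding r_u1 by (rule val_eq, (rule val_intros)+, simp)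
  have vV: "val u1 t vA 0 0 0" unfolding vA_u1 v1 by (rule val_eq, (rule val_intros)+, simp)
  note v = e1_vals[OF ind vr vV]
  note vb1 = r_vals(4)[OF vr]
  have "D r * t * u1 = - Z * (2 * g0 * (i ee)\<^sup>2 * zv - r * b2 * t - r ^ 3 * i fq * t) * u1"
    using Dr_u1 unfolding v1 by (simp add: algebra_simps)
  then have 1: "D r * t = - Z * (2 * g0 * (i ee)\<^sup>2 * zv - r * b2 * t - r ^ 3 * i fq * t)"
    using SN_nonzero mult_right_cancel by blast
  have w1: "val u1 t (D r * t) 0 0 (- 2 * ee ^ 4)"
    unfolding 1
    by (rule val_eq, (rule vr v val_intros)+)
      (use ee in \<open>simp add: e1_def field_simps power2_eq_square power4_eq_xxxx\<close>)
  have 2: "D u1 * t = D r * t - i (fq / ee\<^sup>2) * t" unfolding Du1 by (rule left_diff_distrib)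
  have w2: "val u1 t (D u1 * t) 0 0 (- 2 * ee ^ 4)"
    unfolding 2 by (rule val_eq, (rule w1 val_intros)+, simp)
  define E where "E = - 2 * u1 * Z * (D r * t) + i ee * (3 * g0 - r) * zv\<^sup>2 - r * b1 * zv * u1 * t
       + r\<^sup>2 * u1 * t * vA * i (ka + gq)"
  have E: "D vA = E * u1"
    unfolding DvA E_def g1_u1 unfolding vA_u1 v1 by (simp add: power2_eq_square algebra_simps)
  have vE: "val u1 t E 0 0 (- 2 * ee ^ 4)"
    unfolding E_def
    by (rule val_eq, (rule vr vV v vb1 w1 val_intros)+)
      (use ee in \<open>simp add: e1_def field_simps power2_eq_square power4_eq_xxxx\<close>)
  have "D t * u1 = D v1 - t * D u1" by (rule D_quotient[OF v1])
  moreover have "D v1 * u1 = D vA - (t * u1) * D u1" using Dv1 by (simp only: v1[symmetric])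
  ultimately have "D t * u1 * u1 = (E - 2 * (D u1 * t)) * u1"
    unfolding E by algebra
  then have 3: "D t * u1 = E - 2 * (D u1 * t)" using SN_nonzero by simp
  have w3: "val u1 t (D t * u1) 0 0 (2 * ee ^ 4)"
    unfolding 3 by (rule val_eq, (rule vE w2 val_intros)+, simp)
  show ?thesis
    by (rule no_base_pointI[OF R w2 val_snd t0 _ w3 val_fst]) (use SN_nonzero ee in auto)
qed


definition "A3 = (A2 - i c2) / v1"
definition "A4 = (A3 - i c3) / v1"
abbreviation "SN3 \<equiv> blowup_UV d SN2 c2 0"

lemma SN3_realizes: "realizes SN3 A3 v1"
  using realizes_blowup_UV[OF SN2_realizes, of c2 0] by (simp add: A3_def)

lemma A4_realizes: "realizes (blowup_UV d SN3 c3 0) A4 v1"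
  using realizes_blowup_UV[OF SN3_realizes, of c3 0] by (simp add: A4_def)

text \<open>\<open>y5 = 1 + a\<close>, \<open>z5 = - h / a\<^sup>2 + n / a + b\<close> makes the Okamoto system polynomial in \<open>(a,b)\<close>, and
  \<open>a = 0\<close> is the last exceptional curve.\<close>

lemma A4_regular: "reg A4 v1 (D A4) c 0" "reg A4 v1 (D v1) c 0"
proof -
  have ind: "indep A4 v1" using A4_realizes by (simp add: realizes_def)
  have v0: "v1 \<noteq> 0" by (rule SN_nonzero)
  have A20: "A2 \<noteq> 0" using SN_nonzero by (simp add: A2_def)
  have A3: "A3 = i c3 + A4 * v1" and A2: "A2 = i c2 + A3 * v1"
    using v0 by (simp_all add: A3_def A4_def)
  have vA: "vA = A2 * v1\<^sup>2" unfolding vA_u1 u1_A2 by (simp add: power2_eq_square)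
  have r: "r = i e1 + A2 * v1" unfolding r_u1 u1_A2 ..
  have v3: "val A4 v1 A3 c 0 c3" unfolding A3 by (rule val_eq, (rule val_intros)+, simp)
  have v2: "val A4 v1 A2 c 0 c2" unfolding A2 by (rule val_eq, (rule v3 val_intros)+, simp)
  have vr: "val A4 v1 r c 0 e1" unfolding r by (rule val_eq, (rule v2 val_intros)+, simp)
  have vZ: "val A4 v1 Z c 0 (- ee)" using Z_val[OF ind vr ee(3)] by (simp add: e1_def)
  define a where "a = Z + i ee"
  have a: "a = Z * i ee * A2 * v1"
    using Zr g1_u1 unfolding g1_ee u1_A2 a_def by algebra
  have a0: "a \<noteq> 0" unfolding a using YZ_nonzero ee A20 v0 by simp
  define b where "b = z5 + i h / a\<^sup>2 - i n / a"
  have ba: "z5 * a\<^sup>2 = - i h + i n * a + b * a\<^sup>2"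
    using a0 by (simp add: b_def field_simps power2_eq_square)
  have va: "val A4 v1 a c 0 0" unfolding a by (rule val_eq, (rule vZ v2 val_intros)+, simp)
  define W where "W = - i h + i n * a + (b - i p) * a\<^sup>2"
  have Wz: "W = (z5 - i p) * a\<^sup>2" unfolding W_def using ba by algebra
  have "(z5 - i p) * vA = Z\<^sup>2" using z5_vA unfolding zv_def by algebra
  then have "W * vA = Z ^ 4 * (i ee)\<^sup>2 * A2 * vA"
    unfolding Wz vA a by algebra
  then have WA: "W = Z ^ 4 * (i ee)\<^sup>2 * A2" using vA_nonzero by simp
  have W0: "W \<noteq> 0" unfolding WA using YZ_nonzero ee A20 by simp
  have cc: "ee\<^sup>2 * c2 + h * e1 ^ 4 = 0" "ee\<^sup>2 * c3 = (n * ee - 4 * h) * e1 ^ 3 * c2"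
    "c2 * ee ^ 6 = - h" "c3 * ee ^ 10 = h * n + 4 * h * c2 * ee ^ 5"
    using ee(1) by (simp_all add: c2_def c3_def e1_def field_simps power_numeral_reduce)
  have ci: "(i ee)\<^sup>2 * i c2 + i h * i e1 ^ 4 = 0" "(i ee)\<^sup>2 * i c3 = (i n * i ee - 4 * i h) * i e1 ^ 3 * i c2"
    "i c2 * i ee ^ 6 = - i h" "i c3 * i ee ^ 10 = i h * i n + 4 * i h * i c2 * i ee ^ 5"
    using cc[THEN arg_cong[of _ _ i]] by simp_all
  define R where "R = (i ee)\<^sup>2 * A4 - (i n * i ee - 4 * i h) * i e1 ^ 3 * A3
     + i h * A2\<^sup>2 * (6 * (i e1)\<^sup>2 + 4 * i e1 * A2 * v1 + A2\<^sup>2 * v1\<^sup>2)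
     - i n * i ee * A2\<^sup>2 * (3 * (i e1)\<^sup>2 + 3 * i e1 * A2 * v1 + A2\<^sup>2 * v1\<^sup>2)"
  have "(i ee)\<^sup>2 * A2 + i h * r ^ 4 - i n * i ee * A2 * v1 * r ^ 3 = v1\<^sup>2 * R"
  proof -
    have 1: "(i ee)\<^sup>2 * A2 = (i ee)\<^sup>2 * i c2 + (i ee)\<^sup>2 * i c3 * v1 + (i ee)\<^sup>2 * A4 * v1\<^sup>2"
      unfolding A2 A3 by algebra
    have 2: "(i n * i ee - 4 * i h) * i e1 ^ 3 * (A2 * v1)
       = (i n * i ee - 4 * i h) * i e1 ^ 3 * (i c2 * v1 + A3 * v1\<^sup>2)"
      unfolding A2 by algebra
    show ?thesis
      using 1 2 ci(1,2) unfolding r R_def by algebra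
  qed
  then have Rr: "((i ee)\<^sup>2 * A2 + i h * r ^ 4 - i n * i ee * A2 * v1 * r ^ 3) * Z ^ 4 = v1\<^sup>2 * R * Z ^ 4"
    by simp
  have "b * a\<^sup>2 = (i p + Z\<^sup>2 * R / ((i ee)\<^sup>2 * A2\<^sup>2)) * a\<^sup>2"
  proof -
    have rZ: "r ^ 4 * Z ^ 4 = 1" "r ^ 3 * Z ^ 4 = Z" using Zr by algebra+
    have "b * a\<^sup>2 - i p * a\<^sup>2 = W + i h - i n * a" unfolding W_def by algebra
    also have "\<dots> = v1\<^sup>2 * R * Z ^ 4"
      unfolding WA a Rr[symmetric] using rZ by algebra
    also have "\<dots> = Z\<^sup>2 * R / ((i ee)\<^sup>2 * A2\<^sup>2) * a\<^sup>2"
      unfolding a using ee A20 by (simp add: field_simps power_numeral_reduce)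
    finally show ?thesis by (simp add: algebra_simps)
  qed
  then have b: "b = i p + Z\<^sup>2 * R / ((i ee)\<^sup>2 * A2\<^sup>2)" using a0 by simp
  obtain b0 where vb: "val A4 v1 b c 0 b0"
  proof -
    have "val A4 v1 ((i ee)\<^sup>2 * A2\<^sup>2) c 0 (ee\<^sup>2 * c2\<^sup>2)" by (intro val_intros v2 val_mult val_power)
    moreover have "\<exists>e. val A4 v1 (Z\<^sup>2 * R) c 0 e"
      unfolding R_def by (rule exI, (rule v2 v3 vZ val_intros)+)
    ultimately have "\<exists>e. val A4 v1 (Z\<^sup>2 * R / ((i ee)\<^sup>2 * A2\<^sup>2)) c 0 e"
      using val_divide[OF _ _ _ ind] ee c2_nonzero by fastforce
    then show ?thesis using that val_add[OF val_const] unfolding b by blast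
  qed
  have y5: "Z + i q = 1 + a" by (simp add: a_def ee_def)
  have "D a = D (Z + i q)" unfolding y5 D_add D_1 by simp
  then have Da: "D a = - i h + a * (2 * i n - i h - i kt) + a\<^sup>2 * (2 * b + 2 * i n - i k0 - i kt) + 2 * b * a ^ 3"
    unfolding D_y5 unfolding y5 okF_def using ba by algebra
  have Dn: "D (i n) = 0" unfolding n_def i_simps D_add D_i dkt by simp
  have ni: "i n = 1 + i kt" by (simp add: n_def)
  have Db: "D b = b * (- 2 * i n + i h + i kt) - (i n)\<^sup>2 + i n * (i k0 + i kt) - i ka
     + a * (- 2 * b\<^sup>2 - 4 * i n * b + 2 * (i k0 + i kt) * b) - 3 * a\<^sup>2 * b\<^sup>2" (is "_ = ?B")
  proof -
    have "D (z5 * a\<^sup>2) = D (- i h + i n * a + b * a\<^sup>2)" unfolding ba ..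
    then have "D z5 * a\<^sup>2 + z5 * (2 * a * D a) = - i h + i n * D a + (D b * a\<^sup>2 + b * (2 * a * D a))"
      unfolding D_add D_mult D_power2 D_uminus Dn unfolding D_i dh by simp
    then have 1: "D b * a ^ 3 = (D z5 * a\<^sup>2) * a + 2 * (z5 * a\<^sup>2) * D a + i h * a - i n * a * D a - 2 * b * a\<^sup>2 * D a"
      by algebra
    have "(D z5 * a\<^sup>2) * a = - (3 * a + 2) * (z5 * a\<^sup>2)\<^sup>2
        + (z5 * a\<^sup>2) * a * (2 * i k0 * a + i kt * (2 * a + 1) - i h) - i ka * a ^ 3"
      unfolding D_z5 y5 okG_def by algebra
    with 1 have "D b * a ^ 3 = - (3 * a + 2) * (- i h + i n * a + b * a\<^sup>2)\<^sup>2
        + (- i h + i n * a + b * a\<^sup>2) * a * (2 * i k0 * a + i kt * (2 * a + 1) - i h) - i ka * a ^ 3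
        + 2 * (- i h + i n * a + b * a\<^sup>2) * D a + i h * a - i n * a * D a - 2 * b * a\<^sup>2 * D a"
      unfolding ba by simp
    also have "\<dots> = ?B * a ^ 3"
      unfolding Da unfolding ni by algebra
    finally show ?thesis using a0 by simp
  qed
  have ra: "reg A4 v1 a c 0" and rb: "reg A4 v1 b c 0" using va vb by (auto intro: regI)
  have rD: "reg A4 v1 (D a) c 0" "reg A4 v1 (D b) c 0"
    unfolding Da Db by (intro reg_intros ra rb)+
  have Z: "Z = a - i ee" by (simp add: a_def)
  have wZ: "val a b Z 0 b0 (- ee)" unfolding Z by (rule val_eq, (rule val_intros)+, simp)
  have wW: "val a b W 0 b0 (- h)" unfolding W_def by (rule val_eq, (rule val_intros)+, simp)
  have vW: "v1 * W = a * i ee * Z ^ 3" unfolding WA a by algebra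
  have rv: "reg a b v1 0 b0"
  proof -
    have v: "v1 = a * i ee * Z ^ 3 / W" using vW W0 by (simp add: field_simps)
    have "val a b (a * i ee * Z ^ 3) 0 b0 0" by (rule val_eq, (rule wZ val_intros)+, simp)
    from val_divide_nonzero[OF this wW _ W0] h0 show ?thesis unfolding v[symmetric] by (auto intro: regI)
  qed
  have rA: "reg a b A4 0 b0"
  proof -
    define T where "T = b - i p"
    define E4 where "E4 = 6 * (i ee)\<^sup>2 - 4 * i ee * a + a\<^sup>2"
    define E7 where "E7 = 7 * i ee ^ 6 - 21 * i ee ^ 5 * a + 35 * i ee ^ 4 * a\<^sup>2 - 35 * i ee ^ 3 * a ^ 3
      + 21 * (i ee)\<^sup>2 * a ^ 4 - 7 * i ee * a ^ 5 + a ^ 6"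
    define F where "F = (i n)\<^sup>2 - 2 * i h * T + 2 * i n * T * a + T\<^sup>2 * a\<^sup>2
      - i c2 * (i ee)\<^sup>2 * (E4 * W + (i ee ^ 4 - 4 * i ee ^ 3 * a) * T - 4 * i ee ^ 3 * i n)
      - i c3 * i ee ^ 3 * E7"
    have F: "(W - i c2 * (i ee)\<^sup>2 * Z ^ 4) * W - i c3 * a * i ee ^ 3 * Z ^ 7 = a\<^sup>2 * F"
    proof -
      have Z4: "Z ^ 4 = i ee ^ 4 - 4 * i ee ^ 3 * a + a\<^sup>2 * E4" unfolding Z E4_def by algebra
      have Z7: "Z ^ 7 = - (i ee ^ 7) + a * E7" unfolding Z E7_def by algebra
      have W: "W = - i h + i n * a + T * a\<^sup>2" by (simp add: W_def T_def)
      have c2: "i c2 * (i ee)\<^sup>2 * i ee ^ 4 = - i h" using ci(3) by algebra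
      have c3: "i c3 * i ee ^ 3 * i ee ^ 7 = i h * i n + 4 * i h * (i c2 * (i ee)\<^sup>2 * i ee ^ 3)"
        using ci(4) by algebra
      define P where "P = i c2 * (i ee)\<^sup>2"
      define Q where "Q = i c3 * i ee ^ 3"
      have q: "i c3 * a * i ee ^ 3 = Q * a" by (simp add: Q_def)
      show ?thesis
        using c2 c3 unfolding F_def Z4 Z7 q unfolding W P_def[symmetric] Q_def[symmetric] by algebra
    qed
    have "A4 * v1\<^sup>2 = A2 - i c2 - i c3 * v1" unfolding A2 A3 by algebra
    then have "A4 * (v1 * W)\<^sup>2 * ((i ee)\<^sup>2 * Z ^ 4)
       = W * ((i ee)\<^sup>2 * Z ^ 4 * A2 * W - i c2 * (i ee)\<^sup>2 * Z ^ 4 * W - i c3 * (v1 * W) * (i ee)\<^sup>2 * Z ^ 4)"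
      by algebra
    also have "(i ee)\<^sup>2 * Z ^ 4 * A2 = W" unfolding WA by simp
    finally have "A4 * (a * i ee * Z ^ 3)\<^sup>2 * ((i ee)\<^sup>2 * Z ^ 4) = W * (a\<^sup>2 * F)"
      unfolding vW using F by algebra
    then have "A4 * (i ee ^ 4 * Z ^ 10) * a\<^sup>2 = (W * F) * a\<^sup>2" by algebra
    then have "A4 * (i ee ^ 4 * Z ^ 10) = W * F" using a0 by simp
    then have A4: "A4 = W * F / (i ee ^ 4 * Z ^ 10)" using ee YZ_nonzero by (simp add: field_simps)
    have 1: "val a b (i ee ^ 4 * Z ^ 10) 0 b0 (ee ^ 4 * (- ee) ^ 10)"
      by (intro wZ val_mult val_power val_const)
    obtain e where 2: "val a b (W * F) 0 b0 e"
    proof -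
      have "\<exists>e. val a b (W * F) 0 b0 e"
        unfolding F_def E4_def E7_def T_def by (rule exI, (rule wW val_intros)+)
      then show ?thesis using that by blast
    qed
    show ?thesis
      unfolding A4 by (rule regI, rule val_divide_nonzero[OF 2 1]) (use ee YZ_nonzero in auto)
  qed
  show "reg A4 v1 (D A4) c 0" "reg A4 v1 (D v1) c 0"
    using reg_deriv[OF ind va vb _ rD] rA rv by blast+
qed

lemma SN3_vals:
  obtains e where "\<And>c. val A3 v1 (D A3 * v1) c 0 (- (ee ^ 4) * (c - e))"
    "\<And>c. val A3 v1 (D v1) c 0 (- (ee ^ 4))" "\<not> base_point (blowup_uv d SN2 c2 0) 0 0"
proof -
  have ne: "- 2 * ee ^ 4 \<noteq> 0" "- 2 * ee ^ 4 \<noteq> - (ee ^ 4)" using ee(1) by auto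
  note nb = nonresonant_blowup[OF SN2_realizes SN2_vals(1) SN2_val_snd ne, folded A3_def]
  have e: "- 2 * ee ^ 4 - - (ee ^ 4) = - (ee ^ 4)" by simp
  show ?thesis using nb that unfolding e by blast
qed

lemma SN3_regular: "cascades_regular d SN2 c2 0"
proof -
  obtain e where v: "\<And>c. val A3 v1 (D A3 * v1) c 0 (- (ee ^ 4) * (c - e))"
    "\<And>c. val A3 v1 (D v1) c 0 (- (ee ^ 4))" and uv: "\<not> base_point (blowup_uv d SN2 c2 0) 0 0"
    using SN3_vals by metis
  have ind: "indep A3 v1" using SN3_realizes by (simp add: realizes_def)
  have ne: "- (ee ^ 4) \<noteq> 0" using ee by simp
  note res = resonant_blowup[OF SN3_realizes regI[OF v(1)] v(2) ne A4_regular[of _, unfolded A4_def]]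
  have "- (ee ^ 4) * (c3 - e) = 0" using val_unique[OF ind v(1) res(2)] .
  then have e: "e = c3" using ee by simp
  have base: "base_point SN3 c 0 \<longleftrightarrow> c = c3" for c
  proof
    have v': "val A3 v1 (D A3 * v1 ^ 1) c 0 (- (ee ^ 4) * (c - e))" for c using v(1) by simp
    show "base_point SN3 c 0" if "c = c3"
      unfolding that
      by (rule base_point_snd_pole[OF SN3_realizes _ v'[of "c3 + 1"]]) (use v'[of c3] e ee in auto)
    show "c = c3" if b: "base_point SN3 c 0"
    proof (rule ccontr)
      assume "c \<noteq> c3"
      then have 1: "- (ee ^ 4) * (c - e) \<noteq> 0" using e ee by simp
      have 2: "val A3 v1 (D v1 * 1) c 0 (- (ee ^ 4))" using v(2) by simp
      from no_base_pointI[OF SN3_realizes v(1) val_snd _ disjI1[OF 1] 2 val_1] b SN_nonzero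
      show False by simp
    qed
  qed
  show ?thesis
    using base res(1) uv by - (rule cascades_regular_intro, metis+)
qed

lemma SA_e1_regular: "cascades_regular d SA e1 0"
proof -
  have "cascades_regular d SN 0 0"
    using SN3_regular SN2_base_points SN2_uv by - (rule cascades_regular_intro, metis+)
  then show ?thesis
    using SN_UV SN_base_point by - (rule cascades_regular_intro, blast+)
qed

lemma chart_uv_regular: "cascades_regular d (chart_uv S) 0 0"
proof -
  have "cascades_regular d SA c 0" if "base_point SA c 0" for c
  proof -
    have "1 + q * c = 0 \<or> 1 + (q - 1) * c = 0" using SA_base_points that by blast
    then have "c = c0 \<or> c = e1"
      using q0 ee(1) by (auto simp: c0_def e1_def ee_def[symmetric] field_simps add_eq_0_iff)
    then show ?thesis using SA_c0_regular SA_e1_regular by blast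
  qed
  then show ?thesis
    using SAz_regular SAz_base_point by - (rule cascades_regular_intro, blast+)
qed

theorem regularised_iff:
  assumes "d ka = 0 \<Longrightarrow> \<exists>s. ka = s * (k - s) \<and> d s = 0"
  shows "regularised d S \<longleftrightarrow> d ka = 0"
proof
  assume "regularised d S"
  then show "d ka = 0"
    using chart_UV_base_points(1) infinity_irregular unfolding regularised_def by blast
next
  assume "d ka = 0"
  then have UV: "cascades_regular d (chart_UV S) 0 0" using assms infinity_regular by blast
  have "reg Y Z (D Z) a b" for a b
    unfolding DZ_eq okF_def z5_def by (intro reg_intros)
  then have "\<not> base_point S a b" for a b
    using regular_no_base_point[OF S] DY by blast
  then show "regularised d S"
    unfolding regularised_def using UV chart_UV_base_points(2) chart_uv_regular by metis
qed

end

section \<open>The function field of the plane\<close>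

definition derivation :: "('a::comm_ring_1 \<Rightarrow> 'a) \<Rightarrow> bool" where
  "derivation f \<longleftrightarrow> (\<forall>a b. f (a + b) = f a + f b) \<and> (\<forall>a b. f (a * b) = f a * b + a * f b)"

lemma derivation_0: "derivation f \<Longrightarrow> f 0 = 0"
  unfolding derivation_def by (metis add_cancel_right_right add_0)

lemma derivation_1: "derivation f \<Longrightarrow> f 1 = 0"
  unfolding derivation_def by (metis add_cancel_right_right mult_1 mult.right_neutral)

lemma derivation_sum: "derivation f \<Longrightarrow> f (sum g A) = (\<Sum>a\<in>A. f (g a))"
  by (induction A rule: infinite_finite_induct) (auto simp: derivation_0 derivation_def)

lemma derivation_plus: "derivation f \<Longrightarrow> derivation g \<Longrightarrow> derivation (\<lambda>a. f a + g a)"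
  unfolding derivation_def by (simp add: algebra_simps)

lemma derivation_times: "derivation f \<Longrightarrow> derivation (\<lambda>a. f a * c)"
  unfolding derivation_def by (simp add: algebra_simps)

lemma derivation_map_poly:
  assumes "derivation f"
  shows "derivation (map_poly f)"
proof -
  note f0 = derivation_0[OF assms]
  have f: "f (a + b) = f a + f b" "f (a * b) = f a * b + a * f b" for a b
    using assms by (auto simp: derivation_def)
  show ?thesis
    unfolding derivation_def
    by (auto intro!: poly_eqI simp: coeff_map_poly f0 f coeff_mult derivation_sum[OF assms] sum.distrib)
qed

lemma derivation_pderiv: "derivation pderiv"
  unfolding derivation_def by (simp add: pderiv_add pderiv_mult algebra_simps)

lemma fract_derivation_exists:
  fixes f :: "'a::idom \<Rightarrow> 'a"
  assumes "derivation f"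
  shows "\<exists>D :: 'a fract \<Rightarrow> 'a fract. derivation D \<and> (\<forall>a. D (Fract a 1) = Fract (f a) 1)"
proof -
  have f: "f (a + b) = f a + f b" "f (a * b) = f a * b + a * f b" for a b
    using assms by (auto simp: derivation_def)
  define P where "P = (\<lambda>(w :: 'a fract) ab. snd ab \<noteq> 0 \<and> w = Fract (fst ab) (snd ab))"
  define D where "D = (\<lambda>w. let (a, b) = (SOME ab. P w ab) in Fract (f a * b - a * f b) (b * b))"
  have D: "D (Fract a b) = Fract (f a * b - a * f b) (b * b)" if "b \<noteq> 0" for a b
  proof -
    obtain a' b' where ab: "(SOME ab. P (Fract a b) ab) = (a', b')" by fastforce
    have "P (Fract a b) (a, b)" using that by (simp add: P_def)
    then have "P (Fract a b) (a', b')" unfolding ab[symmetric] by (rule someI)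
    then have b': "b' \<noteq> 0" and "Fract a b = Fract a' b'" by (auto simp: P_def)
    then have e: "a * b' = a' * b" using that by (simp add: eq_fract)
    then have "f (a * b') = f (a' * b)" by simp
    then have e': "f a * b' + a * f b' = f a' * b + a' * f b" by (simp add: f)
    have "(f a * b - a * f b) * (b' * b') = (f a * b' + a * f b') * (b * b') - (a * b') * (f b' * b + f b * b')"
      by (simp add: algebra_simps)
    also have "\<dots> = (f a' * b' - a' * f b') * (b * b)"
      unfolding e e' by (simp add: algebra_simps)
    finally show ?thesis unfolding D_def ab using that b' by (simp add: eq_fract)
  qed
  have "D (u + w) = D u + D w \<and> D (u * w) = D u * w + u * D w" for u w
  proof -
    obtain a b where u: "u = Fract a b" "b \<noteq> 0" by (cases u) auto
    obtain a' b' where w: "w = Fract a' b'" "b' \<noteq> 0" by (cases w) auto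
    show ?thesis
      unfolding u(1) w(1) using u(2) w(2)
      by (simp add: D eq_fract f) (simp add: algebra_simps)
  qed
  moreover have "D (Fract a 1) = Fract (f a) 1" for a
    by (simp add: D derivation_1[OF assms])
  ultimately show ?thesis unfolding derivation_def by blast
qed

instance fract :: ("{idom, ring_char_0}") field_char_0
proof
  show "inj (of_nat :: nat \<Rightarrow> 'a fract)"
    by (rule injI) (simp add: of_nat_fract eq_fract)
qed

section \<open>The Okamoto system in the new coordinates\<close>

definition bgP :: "'a::field \<Rightarrow> 'a \<Rightarrow> 'a \<Rightarrow> 'a \<Rightarrow> 'a \<Rightarrow> 'a \<Rightarrow> 'a \<Rightarrow> 'a" where
  "bgP k0 kt h q p y z =
     - 2 * (q * (q - 1)\<^sup>2) * y\<^sup>2 - 3 * (3 * q\<^sup>2 - 4 * q + 1) * y\<^sup>2 * z - 4 * (3 * q - 2) * y\<^sup>2 * z\<^sup>2 - 5 * y\<^sup>2 * z ^ 3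
     + (2 * (2 * (k0 + kt) * q - (2 * k0 + kt + h)) - 4 * p * (3 * q\<^sup>2 - 4 * q + 1)) * y
     + (3 * (k0 + kt) - 6 * p * (3 * q - 2)) * y * z - 8 * p * y * z\<^sup>2
     + (2 * (k0 + kt) * p - 2 * p\<^sup>2 * (3 * q - 2)) - 3 * p\<^sup>2 * z"

definition bgQ :: "'a::field \<Rightarrow> 'a \<Rightarrow> 'a \<Rightarrow> 'a \<Rightarrow> 'a \<Rightarrow> 'a \<Rightarrow> 'a \<Rightarrow> 'a" where
  "bgQ k0 kt h q p y z =
     2 * (q * (q - 1)\<^sup>2) * y * z + 2 * (3 * q\<^sup>2 - 4 * q + 1) * y * z\<^sup>2 + 2 * (3 * q - 2) * y * z ^ 3 + 2 * y * z ^ 4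
     + (2 * p * (3 * q\<^sup>2 - 4 * q + 1) - (2 * (k0 + kt) * q - (2 * k0 + kt + h))) * z
     + (2 * p * (3 * q - 2) - (k0 + kt)) * z\<^sup>2 + 2 * p * z ^ 3"

lemma bgQ_eq: "bgQ k0 kt h q p y z = okF k0 kt h (z + q) (y * z + p) - okF k0 kt h q p"
  unfolding bgQ_def okF_def by (simp add: power2_eq_square power3_eq_cube power4_eq_xxxx algebra_simps)

lemma bgP_eq: "bgP k0 kt h q p y z * z + y * bgQ k0 kt h q p y z
    = okG k0 kt h ka (z + q) (y * z + p) - okG k0 kt h ka q p"
  unfolding bgP_def bgQ_def okG_def
  by (simp add: power2_eq_square power3_eq_cube power4_eq_xxxx algebra_simps)

theorem regularised_okamoto:
  fixes d :: "'k::{field_char_0,field_gcd} \<Rightarrow> 'k" and S :: "'k system"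
  assumes d: "derivation d" and x: "x \<noteq> 0" and q: "q \<noteq> 0" "q \<noteq> 1" and h: "h \<noteq> 0"
    and S: "\<And>y z. S y z = (bgP k0 kt h q p y z / x, bgQ k0 kt h q p y z / x)"
    and dk: "d k0 = 0" "d kt = 0" "x * d h = h"
    and dq: "x * d q = okF k0 kt h q p" and dp: "x * d p = okG k0 kt h ka q p"
    and root: "d ka = 0 \<Longrightarrow> \<exists>s. ka = s * (k0 + kt - s) \<and> d s = 0"
  shows "regularised d S \<longleftrightarrow> d ka = 0"
proof -
  define P where "P = - 2 * (PC q * (PC q - 1)\<^sup>2) * PY\<^sup>2 - 3 * (3 * (PC q)\<^sup>2 - 4 * PC q + 1) * PY\<^sup>2 * PZ
     - 4 * (3 * PC q - 2) * PY\<^sup>2 * PZ\<^sup>2 - 5 * PY\<^sup>2 * PZ ^ 3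
     + (2 * (2 * (PC k0 + PC kt) * PC q - (2 * PC k0 + PC kt + PC h)) - 4 * PC p * (3 * (PC q)\<^sup>2 - 4 * PC q + 1)) * PY
     + (3 * (PC k0 + PC kt) - 6 * PC p * (3 * PC q - 2)) * PY * PZ - 8 * PC p * PY * PZ\<^sup>2
     + (2 * (PC k0 + PC kt) * PC p - 2 * (PC p)\<^sup>2 * (3 * PC q - 2)) - 3 * (PC p)\<^sup>2 * PZ"
  define Q where "Q = 2 * (PC q * (PC q - 1)\<^sup>2) * PY * PZ + 2 * (3 * (PC q)\<^sup>2 - 4 * PC q + 1) * PY * PZ\<^sup>2
     + 2 * (3 * PC q - 2) * PY * PZ ^ 3 + 2 * PY * PZ ^ 4
     + (2 * PC p * (3 * (PC q)\<^sup>2 - 4 * PC q + 1) - (2 * (PC k0 + PC kt) * PC q - (2 * PC k0 + PC kt + PC h))) * PZ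
     + (2 * PC p * (3 * PC q - 2) - (PC k0 + PC kt)) * PZ\<^sup>2 + 2 * PC p * PZ ^ 3"
  define dx where "dx = (\<lambda>a. d a * x)"
  have dx: "derivation dx" unfolding dx_def by (rule derivation_times[OF d])
  define D0 where "D0 = (\<lambda>N. map_poly (map_poly dx) N + pderiv N * P + map_poly pderiv N * Q)"
  have "derivation D0"
    unfolding D0_def
    by (intro derivation_plus derivation_times derivation_map_poly derivation_pderiv dx)
  then obtain D :: "'k poly poly fract \<Rightarrow> 'k poly poly fract"
    where D: "derivation D" and DF: "\<And>a. D (Fract a 1) = Fract (D0 a) 1"
    using fract_derivation_exists by blast
  have aux: "map_poly dx 1 = 0" "smult [:1:] Q = Q"
    by (simp_all add: one_pCons map_poly_pCons derivation_1[OF dx] derivation_0[OF dx])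
      (simp flip: one_pCons)
  have D0_gens: "D0 (PC c) = PC (x * d c)" "D0 PY = P" "D0 PZ = Q" for c
    unfolding D0_def PC_def PY_def PZ_def
    by (simp_all add: map_poly_pCons derivation_0[OF dx] derivation_1[OF dx] pderiv_pCons aux)
      (simp add: dx_def mult.commute)
  define i where "i = (\<lambda>c. Fract (PC c) (1 :: 'k poly poly))"
  define Y Z where "Y = Fract PY (1 :: 'k poly poly)" and "Z = Fract PZ (1 :: 'k poly poly)"
  interpret function_field i D d x
  proof
    show "ring_hom1 i"
      unfolding ring_hom1_def i_def PC_def by (simp add: Zero_fract_def One_fract_def one_pCons)
    show "D (f + g) = D f + D g" "D (f * g) = D f * g + f * D g" for f g
      using D by (auto simp: derivation_def)
    show "D (i c) = i (x * d c)" for c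
      unfolding i_def DF D0_gens ..
    show "x \<noteq> 0" by (rule x)
  qed
  have ev: "ev i N Y Z = Fract N 1" for N
    by (induction N rule: poly2_induct, simp_all only: ev_i) (simp_all add: i_def Y_def Z_def)
  have ind: "indep Y Z"
    unfolding indep_def ev by (simp add: Zero_fract_def eq_fract)
  have DY: "D Y = ev i P Y Z" and DZ: "D Z = ev i Q Y Z"
    unfolding ev unfolding Y_def Z_def DF D0_gens by simp_all
  have num: "ev i (numeral w) Y Z = numeral w" for w
    using ev_i(1)[of "numeral w" Y Z] by (simp add: PC_def numeral_poly del: ev_i(1))
  have num2: "eval2 (numeral w) y z = numeral w" for w and y z :: 'k
    using eval2_gens'(1)[of "numeral w" y z] by (simp add: PC_def numeral_poly del: eval2_gens'(1))
  have evP: "ev i P Y Z = bgP (i k0) (i kt) (i h) (i q) (i p) Y Z"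
    and evQ: "ev i Q Y Z = bgQ (i k0) (i kt) (i h) (i q) (i p) Y Z"
    unfolding P_def Q_def bgP_def bgQ_def by (simp_all only: ev_i num)
  have eP: "eval2 P y z = bgP k0 kt h q p y z" and eQ: "eval2 Q y z = bgQ k0 kt h q p y z" for y z
    unfolding P_def Q_def bgP_def bgQ_def by (simp_all only: eval2_simps eval2_gens' num2)
  have x0: "PC x \<noteq> 0" using x by (simp add: PC_def)
  have rP: "rep Y Z (\<lambda>y z. fst (S y z)) (D Y / i x)"
    by (rule rep_quotient[of _ "PC x" _ _ P])
      (use x x0 in \<open>auto simp: DY S eP generically_def intro: exI[of _ 1]\<close>)
  have rQ: "rep Y Z (\<lambda>y z. snd (S y z)) (D Z / i x)"
    by (rule rep_quotient[of _ "PC x" _ _ Q])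
      (use x x0 in \<open>auto simp: DZ S eQ generically_def intro: exI[of _ 1]\<close>)
  interpret okamoto_field i D d x S Y Z q p k0 kt h ka
  proof
    show "realizes S Y Z" unfolding realizes_def using ind rP rQ by simp
    show "D Z = okF (i k0) (i kt) (i h) (Z + i q) (Y * Z + i p) - i (okF k0 kt h q p)"
      unfolding DZ evQ bgQ_eq by (simp add: okF_def)
    have "D (Y * Z) = bgP (i k0) (i kt) (i h) (i q) (i p) Y Z * Z + Y * bgQ (i k0) (i kt) (i h) (i q) (i p) Y Z"
      unfolding D_mult DY DZ evP evQ ..
    then show "D (Y * Z) = okG (i k0) (i kt) (i h) (i ka) (Z + i q) (Y * Z + i p) - i (okG k0 kt h ka q p)"
      unfolding bgP_eq[of _ _ _ _ _ _ _ "i ka"] by (simp add: okG_def)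
    show "reg Y Z (D Y) a b" for a b
      unfolding DY by (rule regI[OF val_poly])
  qed (use q h dk dq dp in auto)
  show ?thesis
    using regularised_iff root unfolding k_def by blast
qed

section \<open>Germs of differential expressions\<close>

primrec dexp_deriv :: "dexp \<Rightarrow> dexp" where
  "dexp_deriv (Const c) = Const 0"
| "dexp_deriv Indep = Const 1"
| "dexp_deriv (Deriv m) = Deriv (Suc m)"
| "dexp_deriv (Plus a b) = Plus (dexp_deriv a) (dexp_deriv b)"
| "dexp_deriv (Times a b) = Plus (Times (dexp_deriv a) b) (Times a (dexp_deriv b))"
| "dexp_deriv (Recip a) = Times (Times (Const (- 1)) (dexp_deriv a)) (Times (Recip a) (Recip a))"

lemma fls_deriv_inverse:
  fixes f :: "'a::field fls"
  assumes "f \<noteq> 0"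
  shows "fls_deriv (inverse f) = - fls_deriv f * (inverse f * inverse f)"
proof -
  have "fls_deriv (f * inverse f) = 0" using assms by simp
  then have "f * fls_deriv (inverse f) = - fls_deriv f * inverse f"
    by (simp add: add_eq_0_iff2)
  moreover have "fls_deriv (inverse f) = inverse f * (f * fls_deriv (inverse f))"
    unfolding mult.assoc[symmetric] using assms by simp
  ultimately have "fls_deriv (inverse f) = inverse f * (- fls_deriv f * inverse f)" by metis
  then show ?thesis by (simp only: mult_ac)
qed

lemma dexp_germ_simps [simp]:
  "dexp_germ x0 q (Const c) = fls_const c"
  "dexp_germ x0 q Indep = x_germ x0"
  "dexp_germ x0 q (Deriv m) = (fls_deriv ^^ m) q"
  "dexp_germ x0 q (Plus a b) = dexp_germ x0 q a + dexp_germ x0 q b"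
  "dexp_germ x0 q (Times a b) = dexp_germ x0 q a * dexp_germ x0 q b"
  "dexp_germ x0 q (Recip a) = inverse (dexp_germ x0 q a)"
  by (simp_all add: dexp_germ_def)

lemma dexp_germ_defined_simps [simp]:
  "dexp_germ_defined x0 q (Const c)" "dexp_germ_defined x0 q Indep" "dexp_germ_defined x0 q (Deriv m)"
  "dexp_germ_defined x0 q (Plus a b) \<longleftrightarrow> dexp_germ_defined x0 q a \<and> dexp_germ_defined x0 q b"
  "dexp_germ_defined x0 q (Times a b) \<longleftrightarrow> dexp_germ_defined x0 q a \<and> dexp_germ_defined x0 q b"
  "dexp_germ_defined x0 q (Recip a) \<longleftrightarrow> dexp_germ_defined x0 q a \<and> dexp_germ x0 q a \<noteq> 0"
  by (simp_all add: dexp_germ_defined_def dexp_germ_def)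

lemma fls_deriv_x_germ [simp]: "fls_deriv (x_germ x0) = 1"
  by (simp add: x_germ_def)

lemma x_germ_nonzero [simp]: "x_germ x0 \<noteq> 0"
  using fls_deriv_x_germ[of x0] by (metis fls_deriv_zero zero_neq_one)

lemma dexp_deriv:
  assumes "dexp_germ_defined x0 q e"
  shows "dexp_germ_defined x0 q (dexp_deriv e)" "dexp_germ x0 q (dexp_deriv e) = fls_deriv (dexp_germ x0 q e)"
  using assms by (induction e) (simp_all add: fls_deriv_inverse algebra_simps)

lemma has_laurent_expansion_dexp:
  assumes "q meromorphic_on {x0}"
  shows "(\<lambda>w. dexp_fun q e (x0 + w)) has_laurent_expansion dexp_germ x0 (laurent_expansion q x0) e"
proof (induction e)
  case (Const c)
  then show ?case by (simp add: dexp_fun_def)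
next
  case Indep
  have "(\<lambda>w. x0 + w) has_laurent_expansion fls_const x0 + fls_X"
    by (intro laurent_expansion_intros)
  then show ?case by (simp add: dexp_fun_def x_germ_def)
next
  case (Deriv m)
  have "(\<lambda>w. (deriv ^^ m) q (x0 + w)) has_laurent_expansion (fls_deriv ^^ m) (laurent_expansion q x0)"
  proof (induction m)
    case 0
    then show ?case using meromorphic_on_imp_has_laurent_expansion[OF assms] by simp
  next
    case (Suc m)
    have "deriv (\<lambda>w. (deriv ^^ m) q (x0 + w)) = (\<lambda>w. deriv ((deriv ^^ m) q) (x0 + w))"
      by (intro ext) (simp add: deriv_def DERIV_shift add.commute)
    then show ?case using has_laurent_expansion_deriv[OF Suc] by simp
  qed
  then show ?case by (simp add: dexp_fun_def)
next
  case (Plus a b)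
  then show ?case using has_laurent_expansion_add by (simp add: dexp_fun_def)
next
  case (Times a b)
  then show ?case using has_laurent_expansion_mult by (simp add: dexp_fun_def)
next
  case (Recip a)
  then show ?case using has_laurent_expansion_inverse by (simp add: dexp_fun_def)
qed

lemma dexp_fun_meromorphic: "q meromorphic_on A \<Longrightarrow> dexp_fun q e meromorphic_on A"
  unfolding meromorphic_on_def[of "dexp_fun q e"]
  by (metis has_laurent_expansion_dexp meromorphic_on_subset empty_subsetI insert_subset)

lemma laurent_expansion_dexp_fun:
  "q meromorphic_on {x0} \<Longrightarrow> laurent_expansion (dexp_fun q e) x0 = dexp_germ x0 (laurent_expansion q x0) e"
  by (intro laurent_expansion_eqI has_laurent_expansion_dexp)

lemma dexp_germ_eq_0_iff:
  "q meromorphic_on {x0} \<Longrightarrow>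
   dexp_germ x0 (laurent_expansion q x0) e = 0 \<longleftrightarrow> eventually (\<lambda>x. dexp_fun q e x = 0) (at x0)"
  using has_laurent_expansion_eventually_zero_iff[OF has_laurent_expansion_dexp] by blast

section \<open>The fifth Painleve equation and the Okamoto system\<close>

lemma painleve_V_imp_okamoto:
  fixes x q p q1 p1 q2 k0 kt h \<eta> ka \<kappa> :: "'a::field_char_0"
  assumes nz: "x \<noteq> 0" "q \<noteq> 0" "q \<noteq> 1" and h: "h = \<eta> * x"
    and q1: "x * q1 = okF k0 kt h q p" and p1: "x * p1 = okG k0 kt h ka q p"
    and q2: "q1 + x * q2 = 2 * (q - 1) * (3 * q - 1) * q1 * p + 2 * q * (q - 1)\<^sup>2 * p1
       - (2 * k0 * (q - 1) * q1 + kt * (2 * q - 1) * q1 - \<eta> * q - h * q1)"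
    and PV: "q2 = (1 / (2 * q) + 1 / (q - 1)) * q1\<^sup>2 - q1 / x
     + (q - 1)\<^sup>2 / x\<^sup>2 * (((k0 + kt)\<^sup>2 / 2 - 2 * \<kappa>) * q + (- k0\<^sup>2 / 2) / q)
     + \<eta> * (kt + 1) * q / x + (- \<eta>\<^sup>2 / 2) * q * (q + 1) / (q - 1)"
  shows "ka = \<kappa>"
proof -
  define w where "w = q - 1"
  have w: "w \<noteq> 0" "q = w + 1" using nz by (auto simp: w_def)
  have Q1: "q1 = (2 * q * w\<^sup>2 * p - (k0 * w\<^sup>2 + kt * q * w - \<eta> * x * q)) / x"
    using q1 nz by (simp add: w_def h okF_def field_simps)
  have P1: "p1 = (- (w * (3 * q - 1) * p\<^sup>2) + p * (2 * k0 * w + kt * (2 * q - 1) - \<eta> * x) - ka) / x"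
    using p1 nz by (simp add: w_def h okG_def field_simps)
  have Q2: "q2 = (2 * w * (3 * q - 1) * q1 * p + 2 * q * w\<^sup>2 * p1
       - (2 * k0 * w * q1 + kt * (2 * q - 1) * q1 - \<eta> * q - \<eta> * x * q1) - q1) / x"
    using q2 nz by (simp add: w_def h field_simps)
  have "q2 = (1 / (2 * q) + 1 / (q - 1)) * q1\<^sup>2 - q1 / x
     + (q - 1)\<^sup>2 / x\<^sup>2 * (((k0 + kt)\<^sup>2 / 2 - 2 * ka) * q + (- k0\<^sup>2 / 2) / q)
     + \<eta> * (kt + 1) * q / x + (- \<eta>\<^sup>2 / 2) * q * (q + 1) / (q - 1)"
    unfolding Q2 P1 Q1 w_def[symmetric]
    using nz w(1) unfolding w(2) by (simp add: divide_simps) algebra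
  then show ?thesis using nz unfolding PV by auto
qed

definition dminus :: "dexp \<Rightarrow> dexp \<Rightarrow> dexp" where
  "dminus a b = Plus a (Times (Const (- 1)) b)"

definition dA :: dexp where
  "dA = Times (Deriv 0) (Times (dminus (Deriv 0) (Const 1)) (dminus (Deriv 0) (Const 1)))"

definition dA1 :: dexp where
  "dA1 = Plus (Times (Const 3) (Times (Deriv 0) (Deriv 0))) (Plus (Times (Const (- 4)) (Deriv 0)) (Const 1))"

definition dA2 :: dexp where
  "dA2 = Plus (Times (Const 3) (Deriv 0)) (Const (- 2))"

definition dB1 :: "complex \<Rightarrow> complex \<Rightarrow> complex \<Rightarrow> dexp" where
  "dB1 \<kappa>0 \<kappa>t \<eta> = dminus (Times (Const (2 * (\<kappa>0 + \<kappa>t))) (Deriv 0))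
     (Plus (Const (2 * \<kappa>0 + \<kappa>t)) (Times (Const \<eta>) Indep))"

definition dp :: "complex \<Rightarrow> complex \<Rightarrow> complex \<Rightarrow> dexp" where
  "dp \<kappa>0 \<kappa>t \<eta> = Times
     (Plus (dminus (Times Indep (Deriv 1)) (Times (Deriv 0) (Plus (Times Indep (Const \<eta>)) (Const (2 * \<kappa>0 + \<kappa>t)))))
       (Plus (Times (Times (Deriv 0) (Deriv 0)) (Const (\<kappa>0 + \<kappa>t))) (Const \<kappa>0)))
     (Recip (Times (Const 2) dA))"

text \<open>The value of the parameter \<open>\<kappa>\<close> that the second Okamoto equation would need to hold for
  \<open>(q, p)\<close>.\<close>

definition dka :: "complex \<Rightarrow> complex \<Rightarrow> complex \<Rightarrow> dexp" where
  "dka \<kappa>0 \<kappa>t \<eta> = dminus (dminus (Times (dp \<kappa>0 \<kappa>t \<eta>) (dB1 \<kappa>0 \<kappa>t \<eta>))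
       (Times dA1 (Times (dp \<kappa>0 \<kappa>t \<eta>) (dp \<kappa>0 \<kappa>t \<eta>))))
     (Times Indep (dexp_deriv (dp \<kappa>0 \<kappa>t \<eta>)))"

definition bg_system :: "complex \<Rightarrow> complex \<Rightarrow> complex \<Rightarrow> dexp pair" where
  "bg_system \<kappa>0 \<kappa>t \<eta> =
     (let p = dp \<kappa>0 \<kappa>t \<eta>; b = dB1 \<kappa>0 \<kappa>t \<eta>; ox = (\<lambda>e. Times e (Recip Indep)) in
       (([(ox (Times (Const (- 2)) dA), 2, 0), (ox (Times (Const (- 3)) dA1), 2, 1),
          (ox (Times (Const (- 4)) dA2), 2, 2), (ox (Const (- 5)), 2, 3),
          (ox (Plus (Times (Const 2) b) (Times (Const (- 4)) (Times p dA1))), 1, 0),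
          (ox (Plus (Const (3 * (\<kappa>0 + \<kappa>t))) (Times (Const (- 6)) (Times p dA2))), 1, 1),
          (ox (Times (Const (- 8)) p), 1, 2),
          (ox (Plus (Times (Const (2 * (\<kappa>0 + \<kappa>t))) p) (Times (Const (- 2)) (Times (Times p p) dA2))), 0, 0),
          (ox (Times (Const (- 3)) (Times p p)), 0, 1)],
         [(Const 1, 0, 0)]),
        ([(ox (Times (Const 2) dA), 1, 1), (ox (Times (Const 2) dA1), 1, 2),
          (ox (Times (Const 2) dA2), 1, 3), (ox (Const 2), 1, 4),
          (ox (Plus (Times (Const 2) (Times p dA1)) (Times (Const (- 1)) b)), 0, 1),
          (ox (Plus (Times (Const 2) (Times p dA2)) (Const (- (\<kappa>0 + \<kappa>t)))), 0, 2),
          (ox (Times (Const 2) p), 0, 3)],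
         [(Const 1, 0, 0)])))"

definition bg_map :: "complex \<Rightarrow> complex \<Rightarrow> complex \<Rightarrow> dexp pair" where
  "bg_map \<kappa>0 \<kappa>t \<eta> = (([(Const 1, 0, 1), (Deriv 0, 0, 0)], [(Const 1, 0, 0)]),
     ([(Const 1, 1, 1), (dp \<kappa>0 \<kappa>t \<eta>, 0, 0)], [(Const 1, 0, 0)]))"

declare fls_const_mult_const [simp del]

lemma fls_const_norm:
  "fls_const (a + b :: complex) = fls_const a + fls_const b"
  "fls_const (a - b :: complex) = fls_const a - fls_const b"
  "fls_const (a * b :: complex) = fls_const a * fls_const b"
  by (simp_all add: fls_plus_const fls_minus_const fls_const_mult_const)

locale bg_germ =
  fixes \<kappa>0 \<kappa>t \<eta> x0 :: complex and L :: "complex fls"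
  assumes \<eta>: "\<eta> \<noteq> 0" and L0: "L \<noteq> 0" and L1: "L \<noteq> 1"
begin

abbreviation "x \<equiv> x_germ x0"
abbreviation "k0 \<equiv> fls_const \<kappa>0"
abbreviation "kt \<equiv> fls_const \<kappa>t"
abbreviation "h \<equiv> fls_const \<eta> * x"
abbreviation "p \<equiv> dexp_germ x0 L (dp \<kappa>0 \<kappa>t \<eta>)"
abbreviation "ka \<equiv> dexp_germ x0 L (dka \<kappa>0 \<kappa>t \<eta>)"

lemma germ_simps:
  "dexp_germ x0 L dA = L * (L - 1)\<^sup>2" "dexp_germ x0 L dA1 = 3 * L\<^sup>2 - 4 * L + 1"
  "dexp_germ x0 L dA2 = 3 * L - 2"
  "dexp_germ x0 L (dB1 \<kappa>0 \<kappa>t \<eta>) = 2 * (k0 + kt) * L - (2 * k0 + kt + h)"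
  unfolding dA_def dA1_def dA2_def dB1_def dminus_def
  by (simp_all add: fls_const_norm power2_eq_square algebra_simps)

lemma p_eq: "p = (x * fls_deriv L - L * (x * fls_const \<eta> + 2 * k0 + kt) + L\<^sup>2 * (k0 + kt) + k0) / (2 * L * (L - 1)\<^sup>2)"
  unfolding dp_def dminus_def
  by (simp add: germ_simps fls_const_norm divide_inverse power2_eq_square algebra_simps)

lemma dp_defined: "dexp_germ_defined x0 L (dp \<kappa>0 \<kappa>t \<eta>)"
  using L0 L1 unfolding dp_def dminus_def
  by (simp add: germ_simps fls_const_norm) (simp add: dA_def dminus_def)

lemma xL: "x * fls_deriv L = okF k0 kt h L p"
proof -
  have "2 * L * (L - 1)\<^sup>2 * p = x * fls_deriv L - L * (x * fls_const \<eta> + 2 * k0 + kt) + L\<^sup>2 * (k0 + kt) + k0"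
    unfolding p_eq using L0 L1 by simp
  then show ?thesis
    unfolding okF_def by (simp add: power2_eq_square algebra_simps)
qed

lemma xp: "x * fls_deriv p = okG k0 kt h ka L p"
  unfolding dka_def dminus_def okG_def
  by (simp add: germ_simps dexp_deriv[OF dp_defined] fls_const_norm power2_eq_square algebra_simps)

lemma dka_defined: "dexp_germ_defined x0 L (dka \<kappa>0 \<kappa>t \<eta>)"
  unfolding dka_def dminus_def using dp_defined dexp_deriv(1)[OF dp_defined]
  by (simp add: dA1_def dB1_def dminus_def)

lemma eval2_monom: "eval2 (monom (monom c j) m) y z = c * y ^ m * z ^ j"
  for c y z :: "complex fls"
  by (simp add: eval2_def poly_monom ac_simps)

lemma system_at_bg: "system_at x0 L (bg_system \<kappa>0 \<kappa>t \<eta>) y z =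
    (bgP k0 kt h L p y z / x, bgQ k0 kt h L p y z / x)"
proof -
  have c: "eval2 (monom (monom 1 0) 0) y z = (1 :: complex fls)" by (simp add: eval2_monom)
  show ?thesis
    unfolding system_at_def bg_system_def Let_def map_eval_def
    by (simp add: terms_poly_def eval2_monom fls_const_norm germ_simps del: monom_0)
      (simp add: bgP_def bgQ_def divide_inverse power2_eq_square algebra_simps)
qed

lemma bg_system_defined: "system_defined x0 L (bg_system \<kappa>0 \<kappa>t \<eta>)"
proof -
  have "dexp_germ_defined x0 L dA" "dexp_germ_defined x0 L dA1" "dexp_germ_defined x0 L dA2"
    "dexp_germ_defined x0 L (dB1 \<kappa>0 \<kappa>t \<eta>)"
    by (simp_all add: dA_def dA1_def dA2_def dB1_def dminus_def)
  then show ?thesis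
    unfolding system_defined_def bg_system_def Let_def ratmap_ok_def
    using dp_defined by (simp add: terms_poly_def)
qed

lemma bg_map_eq: "pair_map (dexp_germ x0 L) (bg_map \<kappa>0 \<kappa>t \<eta>) = bg_transformation \<kappa>0 \<kappa>t \<eta> x0 L"
  unfolding bg_map_def bg_transformation_def Let_def p_eq[symmetric]
  by (simp add: terms_poly_def monom_altdef one_pCons)

lemma regularised_bg:
  "regularised fls_deriv (system_at x0 L (bg_system \<kappa>0 \<kappa>t \<eta>)) \<longleftrightarrow> fls_deriv ka = 0"
proof (rule regularised_okamoto[OF _ _ L0 L1 _ system_at_bg _ _ _ xL xp])
  show "derivation (fls_deriv :: complex fls \<Rightarrow> _)" by (simp add: derivation_def algebra_simps)
  show "x \<noteq> 0" "h \<noteq> 0" using \<eta> by (simp_all add: fls_const_nonzero)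
  show "fls_deriv k0 = 0" "fls_deriv kt = 0" "x * fls_deriv h = h" by simp_all
  assume "fls_deriv ka = 0"
  then obtain c where c: "ka = fls_const c" unfolding fls_deriv_eq_0_iff by blast
  define s where "s = (\<kappa>0 + \<kappa>t + csqrt ((\<kappa>0 + \<kappa>t)\<^sup>2 - 4 * c)) / 2"
  have "4 * (s * (\<kappa>0 + \<kappa>t - s)) = (\<kappa>0 + \<kappa>t)\<^sup>2 - (csqrt ((\<kappa>0 + \<kappa>t)\<^sup>2 - 4 * c))\<^sup>2"
    by (simp add: s_def power2_eq_square field_simps)
  then have "c = s * (\<kappa>0 + \<kappa>t + - s)" by simp
  then have "ka = fls_const s * (k0 + kt - fls_const s)"
    unfolding c by (simp add: fls_const_norm)
  then show "\<exists>s. ka = s * (k0 + kt - s) \<and> fls_deriv s = 0" by (intro exI[of _ "fls_const s"]) simp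
qed

end

lemma derivation_diff: "derivation f \<Longrightarrow> f (a - b) = f a - f b"
  unfolding derivation_def by (metis add_diff_cancel diff_add_cancel)

lemma derivation_arith:
  assumes "derivation f"
  shows "f (a + b) = f a + f b" "f (a * b) = f a * b + a * f b" "f (a - b) = f a - f b"
    "f (a\<^sup>2) = 2 * a * f a" "f 1 = 0"
  using assms derivation_diff[OF assms] derivation_1[OF assms]
  by (auto simp: derivation_def power2_eq_square algebra_simps)

lemma partial_derivatives:
  "derivation (d_dy :: 'k::idom poly poly \<Rightarrow> _)" "derivation (d_dz :: 'k::idom poly poly \<Rightarrow> _)"
  "d_dy (PC c) = 0" "d_dy PY = 1" "d_dy PZ = 0" "d_dz (PC c) = 0" "d_dz PY = 0" "d_dz PZ = 1"
proof -
  have e: "(d_dy :: 'k poly poly \<Rightarrow> _) = pderiv" "(d_dz :: 'k poly poly \<Rightarrow> _) = map_poly pderiv"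
    by (auto simp: d_dy_def d_dz_def)
  show "derivation (d_dy :: 'k poly poly \<Rightarrow> _)" unfolding e by (rule derivation_pderiv)
  show "derivation (d_dz :: 'k poly poly \<Rightarrow> _)"
    unfolding e by (rule derivation_map_poly[OF derivation_pderiv])
  show "d_dy (PC c) = 0" "d_dy PY = 1" "d_dy PZ = 0" "d_dz (PC c) = 0" "d_dz PY = 0" "d_dz PZ = 1"
    by (simp_all add: d_dy_def d_dz_def PC_def PY_def PZ_def pderiv_pCons map_poly_pCons one_pCons)
qed

lemma eval2_numeral [simp]: "eval2 (numeral w) y z = (numeral w :: 'k::comm_ring_1)"
  using eval2_gens'(1)[of "numeral w" y z] by (simp add: PC_def numeral_poly del: eval2_gens'(1))

lemma okamoto_system_eq:
  "okamoto_system \<kappa>0 \<kappa>t \<kappa> \<eta> x0 y z =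
     (okF (fls_const \<kappa>0) (fls_const \<kappa>t) (fls_const \<eta> * x_germ x0) y z / x_germ x0,
      okG (fls_const \<kappa>0) (fls_const \<kappa>t) (fls_const \<eta> * x_germ x0) (fls_const \<kappa>) y z / x_germ x0)"
  unfolding okamoto_system_def hamiltonian_system_def okamoto_hamiltonian_def
    PC_def[symmetric] PZ_def[symmetric] PY_def[symmetric] okF_def okG_def
  by (simp only: partial_derivatives derivation_arith[OF partial_derivatives(1)]
      derivation_arith[OF partial_derivatives(2)] eval2_simps eval2_gens' eval2_numeral prod.inject)
    (simp add: divide_inverse power2_eq_square algebra_simps)

context bg_germ
begin

lemma poly_along_gens:
  "poly_along fls_deriv T (Zpol + Cpol a) y z = fls_deriv a + snd (T y z)"
  "poly_along fls_deriv T (Ypol * Zpol + Cpol a) y z =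
     fls_deriv a + z * fst (T y z) + y * snd (T y z)"
  "poly_along fls_deriv T 1 y z = 0" for a y z :: "complex fls"
proof -
  define M where "M = map_poly (map_poly (fls_deriv :: complex fls \<Rightarrow> _))"
  have M: "derivation M"
    unfolding M_def by (intro derivation_map_poly) (simp add: derivation_def algebra_simps)
  have g: "M (PC a) = PC (fls_deriv a)" "M PY = 0" "M PZ = 0" for a
    by (simp_all add: M_def PC_def PY_def PZ_def map_poly_pCons one_pCons)
  note s = M_def[symmetric] PC_def[symmetric] PZ_def[symmetric] PY_def[symmetric]
    derivation_arith[OF M] partial_derivatives derivation_arith[OF partial_derivatives(1)]
    derivation_arith[OF partial_derivatives(2)] eval2_simps eval2_gens' g
  show "poly_along fls_deriv T (Zpol + Cpol a) y z = fls_deriv a + snd (T y z)"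
    "poly_along fls_deriv T (Ypol * Zpol + Cpol a) y z = fls_deriv a + z * fst (T y z) + y * snd (T y z)"
    "poly_along fls_deriv T 1 y z = 0"
    unfolding poly_along_def by (simp_all only: s) simp_all
qed

lemma bg_transforms:
  assumes ka: "ka = fls_const \<kappa>"
  shows "transforms_to fls_deriv (okamoto_system \<kappa>0 \<kappa>t \<kappa> \<eta> x0) (bg_transformation \<kappa>0 \<kappa>t \<eta> x0 L)
    (system_at x0 L (bg_system \<kappa>0 \<kappa>t \<eta>))"
proof -
  have T: "bg_transformation \<kappa>0 \<kappa>t \<eta> x0 L = ((Zpol + Cpol L, 1), (Ypol * Zpol + Cpol p, 1))"
    unfolding bg_transformation_def Let_def p_eq[symmetric] ..
  have 1: "okF k0 kt h (z + L) (y * z + p) / x = fls_deriv L + bgQ k0 kt h L p y z / x" for y z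
    unfolding bgQ_eq xL[symmetric] by (simp add: diff_divide_distrib)
  have G: "okG k0 kt h ka (z + L) (y * z + p) = x * fls_deriv p + (bgP k0 kt h L p y z * z + y * bgQ k0 kt h L p y z)" for y z
    unfolding bgP_eq[of _ _ _ _ _ _ _ ka] xp by simp
  have 2: "okG k0 kt h (fls_const \<kappa>) (z + L) (y * z + p) / x
      = fls_deriv p + z * (bgP k0 kt h L p y z / x) + y * (bgQ k0 kt h L p y z / x)" for y z
    unfolding G[unfolded ka] by (simp add: add_divide_distrib)
  have "(rat_along fls_deriv (system_at x0 L (bg_system \<kappa>0 \<kappa>t \<eta>)) (Zpol + Cpol L, 1) y z,
         rat_along fls_deriv (system_at x0 L (bg_system \<kappa>0 \<kappa>t \<eta>)) (Ypol * Zpol + Cpol p, 1) y z)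
      = case_prod (okamoto_system \<kappa>0 \<kappa>t \<kappa> \<eta> x0)
         (map_eval ((Zpol + Cpol L, 1), (Ypol * Zpol + Cpol p, 1)) y z)" for y z
    unfolding map_eval_def fst_conv snd_conv rat_along.simps rat_eval.simps poly_along_gens
      system_at_bg eval2_simps case_prod_conv okamoto_system_eq
    by (simp add: 1 2)
  then show ?thesis
    unfolding transforms_to_def T ratmap_ok_def generically_def
    by (auto simp only: fst_conv snd_conv intro!: exI[of _ 1]) simp_all
qed

lemma bg_birational: "birational (bg_transformation \<kappa>0 \<kappa>t \<eta> x0 L)"
proof -
  have T: "bg_transformation \<kappa>0 \<kappa>t \<eta> x0 L = ((Zpol + Cpol L, 1), (Ypol * Zpol + Cpol p, 1))"
    unfolding bg_transformation_def Let_def p_eq[symmetric] ..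
  define T' :: "complex fls ratmap" where "T' = ((Zpol - Cpol p, Ypol - Cpol L), (Ypol - Cpol L, 1))"
  have ok: "ratmap_ok T'" by (simp add: T'_def ratmap_ok_def)
  have 1: "case_prod (map_eval T') (map_eval ((Zpol + Cpol L, 1), (Ypol * Zpol + Cpol p, 1)) y z) = (y, z)"
    if "eval2 PZ y z \<noteq> 0" for y z
    using that unfolding T'_def map_eval_def fst_conv snd_conv rat_eval.simps eval2_simps case_prod_conv
    by simp
  have 2: "case_prod (map_eval ((Zpol + Cpol L, 1), (Ypol * Zpol + Cpol p, 1))) (map_eval T' y z) = (y, z)"
    if "eval2 (PY - PC L) y z \<noteq> 0" for y z
    using that unfolding T'_def map_eval_def fst_conv snd_conv rat_eval.simps eval2_simps case_prod_conv
    by simp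
  have "PZ \<noteq> (0 :: complex fls poly poly)" "PY - PC L \<noteq> (0 :: complex fls poly poly)"
    by (simp_all add: PY_def PZ_def PC_def)
  then have g: "generically (\<lambda>y z. case_prod (map_eval T') (map_eval ((Zpol + Cpol L, 1), (Ypol * Zpol + Cpol p, 1)) y z) = (y, z))"
    "generically (\<lambda>y z. case_prod (map_eval ((Zpol + Cpol L, 1), (Ypol * Zpol + Cpol p, 1))) (map_eval T' y z) = (y, z))"
    using 1 2 unfolding generically_def by blast+
  have "ratmap_ok ((Zpol + Cpol L, 1), (Ypol * Zpol + Cpol p, 1))"
    by (simp add: ratmap_ok_def)
  then show ?thesis unfolding birational_def T using ok g by blast
qed

end

lemma fls_const_half: "fls_const (a / 2 :: complex) = fls_const a / 2"
proof -
  have "fls_const (a / 2) * 2 = fls_const (a / 2 * 2)" by (simp only: fls_const_norm fls_const_numeral)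
  then show ?thesis by (simp add: eq_divide_eq)
qed

definition dPV :: "complex \<Rightarrow> complex \<Rightarrow> complex \<Rightarrow> complex \<Rightarrow> dexp" where
  "dPV \<alpha> \<beta> \<gamma> \<delta> = (let y = Deriv 0; y1 = Deriv 1; w = dminus (Deriv 0) (Const 1) in
     dminus (Deriv (Suc (Suc 0)))
       (Plus (Plus (Plus (dminus
         (Times (Plus (Recip (Times (Const 2) y)) (Recip w)) (Times y1 y1))
         (Times y1 (Recip Indep)))
         (Times (Times (Times w w) (Recip (Times Indep Indep))) (Plus (Times (Const \<alpha>) y) (Times (Const \<beta>) (Recip y)))))
         (Times (Times (Const \<gamma>) y) (Recip Indep)))
         (Times (Times (Const \<delta>) (Times y (Plus y (Const 1)))) (Recip w))))"

lemma dexp_fun_dPV: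
  "dexp_fun q (dPV \<alpha> \<beta> \<gamma> \<delta>) x = deriv (deriv q) x - painleve_V_rhs \<alpha> \<beta> \<gamma> \<delta> x (q x) (deriv q x)"
  unfolding dexp_fun_def dPV_def dminus_def painleve_V_rhs_def Let_def
  by (simp add: inverse_eq_divide power2_eq_square)

lemma painleve_V_solution_germ:
  fixes x0 :: complex
  defines "L \<equiv> \<lambda>q. laurent_expansion q x0"
  assumes sol: "painleve_V_solution \<alpha> \<beta> \<gamma> \<delta> D q" and x0: "x0 \<in> D" and \<eta>: "\<eta> \<noteq> 0"
    and "\<alpha> = (\<kappa>0 + \<kappa>t)\<^sup>2 / 2 - 2 * \<kappa>" "\<beta> = - \<kappa>0\<^sup>2 / 2" "\<gamma> = \<eta> * (\<kappa>t + 1)" "\<delta> = - \<eta>\<^sup>2 / 2"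
  shows "bg_germ \<eta> (L q)" "q meromorphic_on {x0}" "dexp_germ x0 (L q) (dka \<kappa>0 \<kappa>t \<eta>) = fls_const \<kappa>"
proof -
  show mer: "q meromorphic_on {x0}"
    using sol x0 by (auto simp: painleve_V_solution_def intro: meromorphic_on_subset)
  have ev: "eventually (\<lambda>x. q x \<noteq> 0 \<and> q x \<noteq> 1 \<and>
      deriv (deriv q) x = painleve_V_rhs \<alpha> \<beta> \<gamma> \<delta> x (q x) (deriv q x)) (at x0)"
    using sol x0 unfolding painleve_V_solution_def by (auto simp: eventually_cosparse_open_eq)
  have nz: "dexp_germ x0 (L q) e \<noteq> 0" if "eventually (\<lambda>x. dexp_fun q e x \<noteq> 0) (at x0)" for e
  proof
    assume "dexp_germ x0 (L q) e = 0"
    then have "eventually (\<lambda>x. dexp_fun q e x = 0) (at x0)"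
      using dexp_germ_eq_0_iff[OF mer] by (simp add: L_def)
    with that have "eventually (\<lambda>x. False) (at x0)" by eventually_elim simp
    then show False by simp
  qed
  have "dexp_germ x0 (L q) (Deriv 0) \<noteq> 0"
    by (rule nz, rule eventually_mono[OF ev]) (simp add: dexp_fun_def)
  moreover have "dexp_germ x0 (L q) (dminus (Deriv 0) (Const 1)) \<noteq> 0"
    by (rule nz, rule eventually_mono[OF ev]) (simp add: dexp_fun_def dminus_def)
  ultimately show bg: "bg_germ \<eta> (L q)"
    using \<eta> by unfold_locales (auto simp: dminus_def)
  interpret bg_germ \<kappa>0 \<kappa>t \<eta> x0 "L q" by (rule bg)
  have "dexp_germ x0 (L q) (dPV \<alpha> \<beta> \<gamma> \<delta>) = 0"
    unfolding L_def dexp_germ_eq_0_iff[OF mer] dexp_fun_dPV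
    by (rule eventually_mono[OF ev]) simp
  moreover have "dexp_germ x0 (L q) (dPV \<alpha> \<beta> \<gamma> \<delta>) = fls_deriv (fls_deriv (L q)) - (
     (inverse (2 * L q) + inverse (L q - 1)) * (fls_deriv (L q) * fls_deriv (L q)) - fls_deriv (L q) * inverse x
     + (L q - 1) * (L q - 1) * inverse (x * x) * (fls_const \<alpha> * L q + fls_const \<beta> * inverse (L q))
     + fls_const \<gamma> * L q * inverse x + fls_const \<delta> * (L q * (L q + 1)) * inverse (L q - 1))"
    by (simp add: dPV_def dminus_def Let_def)
  ultimately have PV0: "fls_deriv (fls_deriv (L q)) =
     (inverse (2 * L q) + inverse (L q - 1)) * (fls_deriv (L q) * fls_deriv (L q)) - fls_deriv (L q) * inverse x
     + (L q - 1) * (L q - 1) * inverse (x * x) * (fls_const \<alpha> * L q + fls_const \<beta> * inverse (L q))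
     + fls_const \<gamma> * L q * inverse x + fls_const \<delta> * (L q * (L q + 1)) * inverse (L q - 1)"
    by (simp only: right_minus_eq)
  have c: "fls_const \<alpha> = (k0 + kt)\<^sup>2 / 2 - 2 * fls_const \<kappa>" "fls_const \<beta> = - k0\<^sup>2 / 2"
    "fls_const \<gamma> = fls_const \<eta> * (kt + 1)" "fls_const \<delta> = - (fls_const \<eta>)\<^sup>2 / 2"
    unfolding assms(5-8) by (simp_all add: fls_const_norm fls_const_half power2_eq_square)
  from PV0 have PV: "fls_deriv (fls_deriv (L q)) =
     (1 / (2 * L q) + 1 / (L q - 1)) * (fls_deriv (L q))\<^sup>2 - fls_deriv (L q) / x
     + (L q - 1)\<^sup>2 / x\<^sup>2 * (((k0 + kt)\<^sup>2 / 2 - 2 * fls_const \<kappa>) * L q + (- k0\<^sup>2 / 2) / L q)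
     + fls_const \<eta> * (kt + 1) * L q / x + (- (fls_const \<eta>)\<^sup>2 / 2) * L q * (L q + 1) / (L q - 1)"
    unfolding c by (simp add: inverse_eq_divide power2_eq_square mult.assoc)
  have "fls_deriv (x * fls_deriv (L q)) = fls_deriv (okF k0 kt h (L q) p)" unfolding xL ..
  then have q2: "fls_deriv (L q) + x * fls_deriv (fls_deriv (L q)) =
      2 * (L q - 1) * (3 * L q - 1) * fls_deriv (L q) * p + 2 * L q * (L q - 1)\<^sup>2 * fls_deriv p
       - (2 * k0 * (L q - 1) * fls_deriv (L q) + kt * (2 * L q - 1) * fls_deriv (L q)
         - fls_const \<eta> * L q - h * fls_deriv (L q))"
    unfolding okF_def by (simp add: power2_eq_square algebra_simps)
  show "ka = fls_const \<kappa>"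
    by (rule painleve_V_imp_okamoto[OF x_germ_nonzero L0 L1 refl xL xp q2 PV])
qed

lemma bg_system_defined_imp:
  assumes "system_defined x0 L (bg_system \<kappa>0 \<kappa>t \<eta>)" "\<eta> \<noteq> 0"
  shows "bg_germ \<eta> L"
proof -
  have "dexp_germ_defined x0 L (dp \<kappa>0 \<kappa>t \<eta>)"
    using assms(1) unfolding system_defined_def bg_system_def Let_def by simp
  then have "dexp_germ x0 L dA \<noteq> 0"
    unfolding dp_def by (simp add: dminus_def)
  then show ?thesis
    using assms(2) by unfold_locales (auto simp: dA_def dminus_def)
qed

lemma dka_not_constant:
  assumes "\<eta> \<noteq> 0"
  shows "dexp_germ x0 (fls_const 2) (dexp_deriv (dka \<kappa>0 \<kappa>t \<eta>)) \<noteq> 0"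
proof -
  have "fls_const (2 :: complex) \<noteq> 1" using fls_const_eq_1_iff[of "2 :: complex"] by (simp del: fls_const_eq_1_iff fls_const_numeral)
  then interpret bg_germ \<kappa>0 \<kappa>t \<eta> x0 "fls_const 2"
    using assms by unfold_locales simp_all
  have two: "fls_const 2 = (2 :: complex fls)" by simp
  have p: "p * 4 = k0 + 2 * kt - 2 * h"
    unfolding p_eq unfolding two by (simp add: field_simps)
  have "fls_deriv (p * 4) = fls_deriv (k0 + 2 * kt - 2 * h)" unfolding p ..
  then have dp: "fls_deriv p * 4 = - 2 * fls_const \<eta>" by simp
  have ka: "ka = okG k0 kt h 0 2 p - x * fls_deriv p"
    using xp unfolding okG_def two by (simp add: algebra_simps)
  have "ka * 16 = - 5 * (p * 4)\<^sup>2 + 4 * (p * 4) * (2 * k0 + 3 * kt - h) - 4 * x * (fls_deriv p * 4)"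
    unfolding ka okG_def by (simp add: power2_eq_square algebra_simps)
  also have "\<dots> = - 12 * h\<^sup>2 + (8 * kt + 8) * h
      + (- 5 * (k0 + 2 * kt)\<^sup>2 + 4 * (k0 + 2 * kt) * (2 * k0 + 3 * kt))"
    unfolding dp unfolding p by (simp add: power2_eq_square algebra_simps)
  finally have "ka * 16 = \<dots>" .
  then have "fls_deriv (ka * 16) = fls_deriv \<dots>" by simp
  then have D: "fls_deriv ka * 16 = (- 24 * h + (8 * kt + 8)) * fls_const \<eta>"
    by (simp add: power2_eq_square algebra_simps)
  have "fls_deriv ka \<noteq> 0"
  proof
    assume "fls_deriv ka = 0"
    then have "- 24 * h + (8 * kt + 8) = 0" using D assms by simp
    then have "fls_deriv (- 24 * h + (8 * kt + 8)) = 0" by simp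
    then have "- 24 * fls_const \<eta> = 0" by simp
    then show False using assms by simp
  qed
  then show ?thesis using dexp_deriv(2)[OF dka_defined] by simp
qed

lemma bg_map_functions:
  assumes "q meromorphic_on {x0}" "bg_germ \<eta> (laurent_expansion q x0)"
  shows "pair_map (\<lambda>c. laurent_expansion c x0)
       ((([(dexp_fun q (Const 1), 0, 1), (dexp_fun q (Deriv 0), 0, 0)], [(dexp_fun q (Const 1), 0, 0)]),
         ([(dexp_fun q (Const 1), 1, 1), (dexp_fun q (dp \<kappa>0 \<kappa>t \<eta>), 0, 0)], [(dexp_fun q (Const 1), 0, 0)])))
     = bg_transformation \<kappa>0 \<kappa>t \<eta> x0 (laurent_expansion q x0)"
  unfolding bg_germ.bg_map_eq[OF assms(2), symmetric] bg_map_def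
  by (simp only: pair_map.simps terms_poly_def list.map prod.case laurent_expansion_dexp_fun[OF assms(1)])

theorem proposition3p6:
  fixes \<kappa>0 \<kappa>t \<kappa>inf \<eta> \<kappa> \<alpha> \<beta> \<gamma> \<delta> :: complex
  assumes "\<eta> \<noteq> 0"
    and "\<kappa> = (\<kappa>0 + \<kappa>t)\<^sup>2 / 4 - \<kappa>inf\<^sup>2 / 4"
    and "\<alpha> = (\<kappa>0 + \<kappa>t)\<^sup>2 / 2 - 2 * \<kappa>"
    and "\<beta> = - \<kappa>0\<^sup>2 / 2"
    and "\<gamma> = \<eta> * (\<kappa>t + 1)"
    and "\<delta> = - \<eta>\<^sup>2 / 2"
  shows "\<exists>S. gives_rise_to \<kappa>0 \<kappa>t \<kappa> \<eta> (painleve_V_solution \<alpha> \<beta> \<gamma> \<delta>) S \<and>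
             bureau_guillot (okamoto_system \<kappa>0 \<kappa>t \<kappa> \<eta>) (painleve_V_solution \<alpha> \<beta> \<gamma> \<delta>) S"
proof (intro exI conjI)
  define S where "S = bg_system \<kappa>0 \<kappa>t \<eta>"
  let ?sol = "painleve_V_solution \<alpha> \<beta> \<gamma> \<delta>"
  let ?\<phi> = "dexp_deriv (dka \<kappa>0 \<kappa>t \<eta>)"
  note germ = painleve_V_solution_germ[OF _ _ assms(1,3-6)]
  have order: "\<forall>c\<in>pair_coeffs S. dexp_order c \<le> 1"
    by (simp add: S_def bg_system_def Let_def dA_def dA1_def dA2_def dB1_def dp_def dminus_def)
  have defined: "system_defined x0 (laurent_expansion q x0) S" if "?sol D q" "x0 \<in> D" for D q x0
    unfolding S_def by (rule bg_germ.bg_system_defined[OF germ(1)[OF that]])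
  have trans: "transforms_to fls_deriv (okamoto_system \<kappa>0 \<kappa>t \<kappa> \<eta> x0)
     (bg_transformation \<kappa>0 \<kappa>t \<eta> x0 (laurent_expansion q x0))
     (system_at x0 (laurent_expansion q x0) S)" if "?sol D q" "x0 \<in> D" for D q x0
    unfolding S_def by (rule bg_germ.bg_transforms[OF germ(1,3)[OF that]])
  show "gives_rise_to \<kappa>0 \<kappa>t \<kappa> \<eta> ?sol S"
    unfolding gives_rise_to_def using order defined trans by blast
  have mer: "q meromorphic_on D" if "?sol D q" for D q
    using that by (simp add: painleve_V_solution_def)
  have T: "\<exists>T :: (complex \<Rightarrow> complex) pair.
       (\<forall>c\<in>pair_coeffs T. c meromorphic_on D) \<and>
       (\<forall>x0\<in>D. birational (pair_map (\<lambda>c. laurent_expansion c x0) T) \<and>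
          transforms_to fls_deriv (okamoto_system \<kappa>0 \<kappa>t \<kappa> \<eta> x0) (pair_map (\<lambda>c. laurent_expansion c x0) T)
            (system_at x0 (laurent_expansion q x0) S))" if sol: "?sol D q" for D q
  proof (intro exI conjI ballI)
    let ?T = "(([(dexp_fun q (Const 1), 0, 1), (dexp_fun q (Deriv 0), 0, 0)], [(dexp_fun q (Const 1), 0, 0)]),
         ([(dexp_fun q (Const 1), 1, 1), (dexp_fun q (dp \<kappa>0 \<kappa>t \<eta>), 0, 0)], [(dexp_fun q (Const 1), 0, 0)]))
         :: (complex \<Rightarrow> complex) pair"
    show "c meromorphic_on D" if "c \<in> pair_coeffs ?T" for c
      using that dexp_fun_meromorphic[OF mer[OF sol]] by auto
    fix x0 assume x0: "x0 \<in> D"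
    note e = bg_map_functions[OF germ(2,1)[OF sol x0]]
    show "birational (pair_map (\<lambda>c. laurent_expansion c x0) ?T)"
      unfolding e by (rule bg_germ.bg_birational[OF germ(1)[OF sol x0]])
    show "transforms_to fls_deriv (okamoto_system \<kappa>0 \<kappa>t \<kappa> \<eta> x0) (pair_map (\<lambda>c. laurent_expansion c x0) ?T)
            (system_at x0 (laurent_expansion q x0) S)"
      unfolding e by (rule trans[OF sol x0])
  qed
  have satisfies: "satisfies x0 L [?\<phi>] \<longleftrightarrow> fls_deriv (dexp_germ x0 L (dka \<kappa>0 \<kappa>t \<eta>)) = 0"
    if "bg_germ \<eta> L" for x0 L
    using dexp_deriv[OF bg_germ.dka_defined[OF that]] by (simp add: satisfies_def)
  have reg: "regularised fls_deriv (system_at x0 L S) \<longleftrightarrow> satisfies x0 L [?\<phi>]"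
    if "system_defined x0 L S" for x0 L
  proof -
    have L: "bg_germ \<eta> L" using bg_system_defined_imp that assms(1) by (simp add: S_def)
    show ?thesis unfolding satisfies[OF L] S_def by (rule bg_germ.regularised_bg[OF L])
  qed
  have generic: "\<exists>q. q meromorphic_on {x0} \<and> system_defined x0 (laurent_expansion q x0) S \<and>
      \<not> satisfies x0 (laurent_expansion q x0) [?\<phi>]" for x0
  proof (intro exI conjI)
    show m: "(\<lambda>_. 2) meromorphic_on {x0}" by (rule meromorphic_on_const)
    have e: "laurent_expansion (\<lambda>_. 2) x0 = fls_const 2"
      by (rule laurent_expansion_eqI) (rule has_laurent_expansion_const)
    have bg: "bg_germ \<eta> (fls_const 2)"
      using assms(1) fls_const_eq_1_iff[of "2 :: complex"]
      by unfold_locales (simp_all del: fls_const_eq_1_iff fls_const_numeral)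
    show "system_defined x0 (laurent_expansion (\<lambda>_. 2) x0) S"
      unfolding e S_def by (rule bg_germ.bg_system_defined[OF bg])
    show "\<not> satisfies x0 (laurent_expansion (\<lambda>_. 2) x0) [?\<phi>]"
      unfolding e using dka_not_constant[OF assms(1)] by (simp add: satisfies_def)
  qed
  have sat: "satisfies x0 (laurent_expansion q x0) [?\<phi>]" if "?sol D q" "x0 \<in> D" for D q x0
    unfolding satisfies[OF germ(1)[OF that]] germ(3)[OF that] by simp
  show "bureau_guillot (okamoto_system \<kappa>0 \<kappa>t \<kappa> \<eta>) ?sol S"
    unfolding bureau_guillot_def
  proof (intro conjI allI impI exI[of _ "[?\<phi>]"] ballI)
    show "dexp_fun q c meromorphic_on D" if "?sol D q" for D q c
      by (rule dexp_fun_meromorphic[OF mer[OF that]])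
    show "regularised fls_deriv (system_at x0 (laurent_expansion q x0) S) =
        satisfies x0 (laurent_expansion q x0) [?\<phi>]"
      if "system_defined x0 (laurent_expansion q x0) S" for x0 q
      by (rule reg[OF that])
  qed (fact T defined generic sat)+
qed

end
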